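(* Let $U=U_d\cdots U_1$ be an ideal (unitary) quantum circuit on $N_q$ qubits, with associated unitary channel $\mathcal{U}=\{U\}$, and let $\mathcal{E}_{\mathcal N}=\mathcal{E}_d\circ\cdots\circ\mathcal{E}_1$ be a noisy circuit on $N_q$ qubits with $N_1$ single-qubit noises and $N_2$ two-qubit noises (all other $\mathcal{E}_i$ being noiseless unitary gates). Suppose all noise rates satisfy $\|M_{\mathcal{E}_s}-I\|\le p$, and let $N=N_1+N_2$. Let $0\le l\le N$ be an integer and let $F(l)$ be the $l$-level approximation of the Jamiołkowski fidelity $F_J(\mathcal{U},\mathcal{E}_{\mathcal N})$. Then $$\big|F_J(\mathcal{U},\mathcal{E}_{\mathcal N})-F(l)\big|\le\sum_{u=l+1}^{N}\binom{N}{u}(16p)^u(1+16p)^{N-u},$$ and the number of tensor network contractions used by the $l$-level approximation algorithm to compute $F(l)$ is $\mathcal{O}(15^lN^l)$.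
   Context: Conventions. $\|\cdot\|$ is the matrix 2-norm (operator/spectral norm). $*$ denotes the entrywise complex conjugate and $T$ the transpose in the computational basis. A quantum channel $\mathcal{E}=\{E_k\}_k$ is the map $\mathcal{E}(\rho)=\sum_k E_k\rho E_k^\dagger$ with $\sum_k E_k^\dagger E_k=I$. Its matrix representation is $M_{\mathcal{E}}=\sum_k E_k\otimes E_k^*$; for a unitary gate $\{U\}$ this is $U\otimes U^*$. Each $\mathcal{E}_i$ in a noisy circuit is either a noiseless unitary gate (on one or two qubits) or a noise, i.e. a quantum channel acting on one qubit (single-qubit noise) or two qubits (two-qubit noise), extended by the identity to the other qubits. Jamiołkowski fidelity. For a channel $\mathcal{E}$ on a Hilbert space $\mathcal{H}$ of dimension $D$, let $\rho_{\mathcal{E}}=(\mathcal{I}\otimes\mathcal{E})(|\Psi\rangle\langle\Psi|)$, where $|\Psi\rangle=\frac1{\sqrt D}\sum_i|ii\rangle$ and $\mathcal{I}$ is the identity channel. Then $F_J(\mathcal{E},\mathcal{F})=F(\rho_{\mathcal{E}},\rho_{\mathcal{F}})$, where $F(\rho,\sigma)=\big(\operatorname{Tr}\sqrt{\sqrt{\rho}\,\sigma\sqrt{\rho}}\big)^2$ is the quantum state fidelity. For a unitary channel $\mathcal{U}=\{U\}$ on $N_q$ qubits, one has $F_J(\mathcal{U},\mathcal{E}_{\mathcal N})=\frac1{2^{2N_q}}\operatorname{Tr}\big((U^\dagger\otimes U^T)M_{\mathcal{E}_{\mathcal N}}\big)$. Noise rate. For a noise $\mathcal{E}_s$ acting on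 a local space of dimension $q$ ($q=2$ for single-qubit, $q=4$ for two-qubit), $M_{\mathcal{E}_s}$ is regarded as a $q^2\times q^2$ matrix, and its noise rate is $\|M_{\mathcal{E}_s}-I\|$ with $I$ the identity of the same size. Tensor permutation. For a $q^2\times q^2$ matrix $A$ with rows indexed by pairs $(a,b)$ and columns by pairs $(c,e)$, $a,b,c,e\in\{0,\dots,q-1\}$, $\tilde A$ is the $q^2\times q^2$ matrix with $\tilde A_{(a,c),(b,e)}=A_{(a,b),(c,e)}$. SVD decomposition of a noise. For a noise $\mathcal{E}_s$ let $m=q^2$ ($m=4$ for single-qubit, $m=16$ for two-qubit) and take a singular value decomposition $\widetilde{M_{\mathcal{E}_s}}=SDT^\dagger$ (here $T$ is the right unitary factor), $D=\sum_{j=0}^{m-1}d_j|j\rangle\langle j|$, with $d_0$ the largest singular value. Let $U^s_j,V^s_j$ be the $q\times q$ matrices with $(U^s_j)_{a,c}=d_j S_{(a,c),j}$ and $(V^s_j)_{b,e}=\overline{T_{(b,e),j}}$. Then $M_{\mathcal{E}_s}=\sum_{j=0}^{m-1}U^s_j\otimes V^s_j$. Put $M'_{\mathcal{E}_s}=U^s_0\otimes V^s_0$ (dominant term) and $\overline{M_{\mathcal{E}_s}}=\sum_{j=1}^{m-1}U^s_j\otimes V^s_j$ (residual). $l$-level approximation. The full circuit has matrix representation $M_{\mathcal{E}_{\mathcal N}}=M_{\mathcal{E}_d}\cdots M_{\mathcal{E}_1}$, acting on two copies of the $N_q$-qubit space (each local matrix extended by the identity; the first tensor factor acts on the first copy and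 the second on the second copy). For $0\le u\le N$, $T_u$ is the sum, over all $u$-element subsets $P$ of the set of the $N$ noises, of the product $M_{\mathcal{E}_d}\cdots M_{\mathcal{E}_1}$ in which the factor $M_{\mathcal{E}_s}$ is replaced by $\overline{M_{\mathcal{E}_s}}$ for each noise $s\in P$ and by $M'_{\mathcal{E}_s}$ for each noise $s\notin P$, the noiseless gate factors being unchanged. Put $A(l)=\sum_{u=0}^{l}T_u$ and $F(l)=\frac1{2^{2N_q}}\operatorname{Tr}\big((U^\dagger\otimes U^T)A(l)\big)$. Algorithm and contraction count. The algorithm computes $F(l)$ as follows: for every $0\le u\le l$, every $u$-element set $P$ of noises, and every choice of one residual term $U^s_{j_s}\otimes V^s_{j_s}$ with $1\le j_s\le m_s-1$ for each $s\in P$ (where $m_s$ is $4$ or $16$ according to whether $s$ is single- or two-qubit), with all noises outside $P$ replaced by $U^s_0\otimes V^s_0$, the doubled closed (traced) network splits into two $N_q$-qubit networks; both are contracted (two contractions), the resulting scalars are multiplied, and all these products are added up (and normalized by $2^{-2N_q}$). The number of contractions is the total number of $N_q$-qubit networks contracted. *)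

theory Defs
  imports "Jordan_Normal_Form.Schur_Decomposition"
begin

section \<open>Matrices\<close>

text \<open>
  A pair \<open>(a, b)\<close> with \<open>a < d\<close>, \<open>b < q\<close> is encoded as the index \<open>a * q + b\<close> throughout.
\<close>

definition mat_trace :: "complex mat \<Rightarrow> complex" where
  "mat_trace A = (\<Sum>i<dim_row A. A $$ (i, i))"

definition mat_cnj :: "complex mat \<Rightarrow> complex mat" where
  "mat_cnj A = map_mat cnj A"

definition kron :: "complex mat \<Rightarrow> complex mat \<Rightarrow> complex mat" where
  "kron A B = mat (dim_row A * dim_row B) (dim_col A * dim_col B)
     (\<lambda>(i, j). A $$ (i div dim_row B, j div dim_col B) * B $$ (i mod dim_row B, j mod dim_col B))"

definition mat_sum :: "nat \<Rightarrow> ('i \<Rightarrow> complex mat) \<Rightarrow> 'i set \<Rightarrow> complex mat" where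
  "mat_sum D f I = mat D D (\<lambda>ij. \<Sum>x\<in>I. f x $$ ij)"

text \<open>\<open>time_ordered_prod D f k = f (k - 1) * \<dots> * f 1 * f 0\<close>\<close>

primrec time_ordered_prod :: "nat \<Rightarrow> (nat \<Rightarrow> complex mat) \<Rightarrow> nat \<Rightarrow> complex mat" where
  "time_ordered_prod D f 0 = 1\<^sub>m D"
| "time_ordered_prod D f (Suc k) = f k * time_ordered_prod D f k"

definition unitary_mat :: "nat \<Rightarrow> complex mat \<Rightarrow> bool" where
  "unitary_mat D A \<longleftrightarrow> A \<in> carrier_mat D D \<and> mat_adjoint A * A = 1\<^sub>m D \<and> A * mat_adjoint A = 1\<^sub>m D"

definition vec_norm2 :: "complex vec \<Rightarrow> real" where
  "vec_norm2 v = sqrt (\<Sum>i<dim_vec v. (cmod (v $ i))\<^sup>2)"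

definition spectral_norm :: "complex mat \<Rightarrow> real" where
  "spectral_norm A = (SUP v\<in>{v \<in> carrier_vec (dim_col A). vec_norm2 v \<le> 1}. vec_norm2 (A *\<^sub>v v))"

definition pos_semidef :: "nat \<Rightarrow> complex mat \<Rightarrow> bool" where
  "pos_semidef D A \<longleftrightarrow> A \<in> carrier_mat D D \<and> mat_adjoint A = A \<and>
     (\<forall>v\<in>carrier_vec D. 0 \<le> Re ((A *\<^sub>v v) \<bullet>c v))"

definition mat_sqrt :: "complex mat \<Rightarrow> complex mat" where
  "mat_sqrt A = (THE B. pos_semidef (dim_row A) B \<and> B * B = A)"


section \<open>Channels and fidelity\<close>

type_synonym channel = "complex mat \<Rightarrow> complex mat"

definition kraus_channel :: "nat \<Rightarrow> complex mat list \<Rightarrow> channel" where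
  "kraus_channel D Ks \<rho> = mat_sum D (\<lambda>k. (Ks ! k) * \<rho> * mat_adjoint (Ks ! k)) {..<length Ks}"

definition is_kraus :: "nat \<Rightarrow> complex mat list \<Rightarrow> bool" where
  "is_kraus D Ks \<longleftrightarrow> set Ks \<subseteq> carrier_mat D D \<and>
     mat_sum D (\<lambda>k. mat_adjoint (Ks ! k) * (Ks ! k)) {..<length Ks} = 1\<^sub>m D"

definition kraus_matrix :: "nat \<Rightarrow> complex mat list \<Rightarrow> complex mat" where
  "kraus_matrix D Ks = mat_sum (D\<^sup>2) (\<lambda>k. kron (Ks ! k) (mat_cnj (Ks ! k))) {..<length Ks}"

text \<open>
  \<open>\<I> \<otimes> \<E>\<close> for a linear map \<open>\<E>\<close> on \<open>D \<times> D\<close> matrices: the second factor of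
  \<open>\<rho> = (\<Sum>i j. |i\<rangle>\<langle>j| \<otimes> X i j)\<close> is transformed block by block.
\<close>

definition id_tensor_channel :: "nat \<Rightarrow> channel \<Rightarrow> channel" where
  "id_tensor_channel D \<E> \<rho> = mat (D\<^sup>2) (D\<^sup>2)
     (\<lambda>(r, c). \<E> (mat D D (\<lambda>(a, b). \<rho> $$ ((r div D) * D + a, (c div D) * D + b))) $$ (r mod D, c mod D))"

text \<open>The projector onto \<open>1/\<surd>D \<cdot> (\<Sum>i<D. |i i\<rangle>)\<close>.\<close>

definition max_entangled :: "nat \<Rightarrow> complex mat" where
  "max_entangled D = mat (D\<^sup>2) (D\<^sup>2)
     (\<lambda>(r, c). if r div D = r mod D \<and> c div D = c mod D then 1 / of_nat D else 0)"

definition choi_state :: "nat \<Rightarrow> channel \<Rightarrow> complex mat" where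
  "choi_state D \<E> = id_tensor_channel D \<E> (max_entangled D)"

text \<open>
  The fidelity is kept complex-valued (its value on states is real), so that it can be compared
  directly with the approximation, which is a complex number in general.
\<close>

definition state_fidelity :: "complex mat \<Rightarrow> complex mat \<Rightarrow> complex" where
  "state_fidelity \<rho> \<sigma> = (mat_trace (mat_sqrt (mat_sqrt \<rho> * \<sigma> * mat_sqrt \<rho>)))\<^sup>2"

definition jamiolkowski_fidelity :: "nat \<Rightarrow> channel \<Rightarrow> channel \<Rightarrow> complex" where
  "jamiolkowski_fidelity D \<E> \<F> = state_fidelity (choi_state D \<E>) (choi_state D \<F>)"


section \<open>Circuits\<close>

text \<open>
  Qubits are numbered \<open>0, \<dots>, n - 1\<close>; the value of qubit \<open>k\<close> in the basis state \<open>|i\<rangle>\<close>,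
  \<open>i < 2 ^ n\<close>, is bit \<open>k\<close> of \<open>i\<close>.  For a list of qubits \<open>qs\<close>, \<open>local_index qs i\<close> reads off
  their values with the head of \<open>qs\<close> as most significant digit, so that the head is the first
  tensor factor of an operator on \<open>qs\<close>.
\<close>

definition local_index :: "nat list \<Rightarrow> nat \<Rightarrow> nat" where
  "local_index qs i = horner_sum of_bool 2 (map (bit i) (rev qs))"

text \<open>Extension of an operator on the qubits \<open>qs\<close> by the identity on all other qubits.\<close>

definition embed :: "nat \<Rightarrow> nat list \<Rightarrow> complex mat \<Rightarrow> complex mat" where
  "embed n qs A = mat (2 ^ n) (2 ^ n)
     (\<lambda>(i, j). if \<forall>k<n. k \<notin> set qs \<longrightarrow> bit i k = bit j k
               then A $$ (local_index qs i, local_index qs j) else 0)"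

text \<open>
  The same for an operator on two copies of \<open>qs\<close>.  The basis state \<open>|i\<rangle>|j\<rangle>\<close> of two copies of
  the \<open>n\<close>-qubit space has index \<open>i * 2 ^ n + j\<close>, so qubit \<open>k\<close> of the first copy is bit \<open>n + k\<close>.
\<close>

definition embed_doubled :: "nat \<Rightarrow> nat list \<Rightarrow> complex mat \<Rightarrow> complex mat" where
  "embed_doubled n qs M = embed (2 * n) (map ((+) n) qs @ qs) M"

text \<open>Matrices in a circuit element are local, i.e. they act on \<open>support\<close> only.\<close>

datatype circuit_element =
    Gate (support: "nat list") (gate_matrix: "complex mat")
  | is_noise: Noise (support: "nat list") (noise_kraus: "complex mat list")

definition local_dim :: "circuit_element \<Rightarrow> nat" where
  "local_dim c = 2 ^ length (support c)"

definition valid_element :: "nat \<Rightarrow> circuit_element \<Rightarrow> bool" where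
  "valid_element n c \<longleftrightarrow>
     distinct (support c) \<and> set (support c) \<subseteq> {..<n} \<and> length (support c) \<in> {1, 2} \<and>
     (case c of Gate qs A \<Rightarrow> unitary_mat (local_dim c) A
              | Noise qs Ks \<Rightarrow> is_kraus (local_dim c) Ks)"

text \<open>A circuit lists its elements in the order in which they are applied.\<close>

definition noisy_circuit :: "nat \<Rightarrow> circuit_element list \<Rightarrow> bool" where
  "noisy_circuit n C \<longleftrightarrow> (\<forall>c\<in>set C. valid_element n c)"

text \<open>
  For the ideal circuit only the operators on the full space matter, so they may be arbitrary
  unitaries (in particular extensions of one- and two-qubit gates).
\<close>

definition ideal_circuit :: "nat \<Rightarrow> complex mat list \<Rightarrow> bool" where
  "ideal_circuit n Us \<longleftrightarrow> (\<forall>A\<in>set Us. unitary_mat (2 ^ n) A)"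

definition circuit_unitary :: "nat \<Rightarrow> complex mat list \<Rightarrow> complex mat" where
  "circuit_unitary n Us = time_ordered_prod (2 ^ n) (\<lambda>i. Us ! i) (length Us)"

definition unitary_channel :: "nat \<Rightarrow> complex mat \<Rightarrow> channel" where
  "unitary_channel n U = kraus_channel (2 ^ n) [U]"

fun element_channel :: "nat \<Rightarrow> circuit_element \<Rightarrow> channel" where
  "element_channel n (Gate qs A) = kraus_channel (2 ^ n) [embed n qs A]"
| "element_channel n (Noise qs Ks) = kraus_channel (2 ^ n) (map (embed n qs) Ks)"

definition circuit_channel :: "nat \<Rightarrow> circuit_element list \<Rightarrow> channel" where
  "circuit_channel n C = fold (element_channel n) C"

definition noises :: "circuit_element list \<Rightarrow> nat set" where
  "noises C = {s. s < length C \<and> is_noise (C ! s)}"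

definition num_noises :: "nat \<Rightarrow> circuit_element list \<Rightarrow> nat" where
  "num_noises k C = card {s \<in> noises C. length (support (C ! s)) = k}"

fun element_matrix :: "circuit_element \<Rightarrow> complex mat" where
  "element_matrix (Gate qs A) = kraus_matrix (2 ^ length qs) [A]"
| "element_matrix (Noise qs Ks) = kraus_matrix (2 ^ length qs) Ks"

definition noise_rate :: "circuit_element \<Rightarrow> real" where
  "noise_rate c = spectral_norm (element_matrix c - 1\<^sub>m ((local_dim c)\<^sup>2))"


section \<open>Singular value decomposition of noises\<close>

definition tensor_permute :: "nat \<Rightarrow> complex mat \<Rightarrow> complex mat" where
  "tensor_permute q A = mat (q\<^sup>2) (q\<^sup>2)
     (\<lambda>(ac, be). A $$ ((ac div q) * q + be div q, (ac mod q) * q + be mod q))"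

datatype svd =
  SVD (left_vectors: "complex mat") (sing_val: "nat \<Rightarrow> real") (right_vectors: "complex mat")

text \<open>Only \<open>sing_val \<sigma> 0\<close> is required to be maximal; the others may come in any order.\<close>

definition is_svd :: "nat \<Rightarrow> complex mat \<Rightarrow> svd \<Rightarrow> bool" where
  "is_svd m A \<sigma> \<longleftrightarrow>
     unitary_mat m (left_vectors \<sigma>) \<and> unitary_mat m (right_vectors \<sigma>) \<and>
     (\<forall>j<m. 0 \<le> sing_val \<sigma> j \<and> sing_val \<sigma> j \<le> sing_val \<sigma> 0) \<and>
     A = left_vectors \<sigma> * mat_diag m (\<lambda>j. complex_of_real (sing_val \<sigma> j)) * mat_adjoint (right_vectors \<sigma>)"

definition noise_svds :: "circuit_element list \<Rightarrow> (nat \<Rightarrow> svd) \<Rightarrow> bool" where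
  "noise_svds C \<sigma> \<longleftrightarrow> (\<forall>s\<in>noises C.
     is_svd ((local_dim (C ! s))\<^sup>2) (tensor_permute (local_dim (C ! s)) (element_matrix (C ! s))) (\<sigma> s))"

definition svd_U :: "nat \<Rightarrow> svd \<Rightarrow> nat \<Rightarrow> complex mat" where
  "svd_U q \<sigma> j = mat q q (\<lambda>(a, c). complex_of_real (sing_val \<sigma> j) * left_vectors \<sigma> $$ (a * q + c, j))"

definition svd_V :: "nat \<Rightarrow> svd \<Rightarrow> nat \<Rightarrow> complex mat" where
  "svd_V q \<sigma> j = mat q q (\<lambda>(b, e). cnj (right_vectors \<sigma> $$ (b * q + e, j)))"

definition dominant_term :: "nat \<Rightarrow> svd \<Rightarrow> complex mat" where
  "dominant_term q \<sigma> = kron (svd_U q \<sigma> 0) (svd_V q \<sigma> 0)"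

definition residual_term :: "nat \<Rightarrow> svd \<Rightarrow> complex mat" where
  "residual_term q \<sigma> = mat_sum (q\<^sup>2) (\<lambda>j. kron (svd_U q \<sigma> j) (svd_V q \<sigma> j)) {1..q\<^sup>2 - 1}"


section \<open>The approximation and the algorithm\<close>

definition approx_factor :: "circuit_element list \<Rightarrow> (nat \<Rightarrow> svd) \<Rightarrow> nat set \<Rightarrow> nat \<Rightarrow> complex mat" where
  "approx_factor C \<sigma> P s =
     (if s \<in> noises C
      then if s \<in> P then residual_term (local_dim (C ! s)) (\<sigma> s)
           else dominant_term (local_dim (C ! s)) (\<sigma> s)
      else element_matrix (C ! s))"

definition noise_subsets :: "circuit_element list \<Rightarrow> nat \<Rightarrow> nat set set" where
  "noise_subsets C u = {P. P \<subseteq> noises C \<and> card P = u}"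

definition level_term :: "nat \<Rightarrow> circuit_element list \<Rightarrow> (nat \<Rightarrow> svd) \<Rightarrow> nat \<Rightarrow> complex mat" where
  "level_term n C \<sigma> u = mat_sum (2 ^ (2 * n))
     (\<lambda>P. time_ordered_prod (2 ^ (2 * n))
        (\<lambda>s. embed_doubled n (support (C ! s)) (approx_factor C \<sigma> P s)) (length C))
     (noise_subsets C u)"

definition approx_matrix :: "nat \<Rightarrow> circuit_element list \<Rightarrow> (nat \<Rightarrow> svd) \<Rightarrow> nat \<Rightarrow> complex mat" where
  "approx_matrix n C \<sigma> l = mat_sum (2 ^ (2 * n)) (level_term n C \<sigma>) {0..l}"

definition approx_fidelity ::
  "nat \<Rightarrow> complex mat \<Rightarrow> circuit_element list \<Rightarrow> (nat \<Rightarrow> svd) \<Rightarrow> nat \<Rightarrow> complex" where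
  "approx_fidelity n U C \<sigma> l =
     1 / 2 ^ (2 * n) * mat_trace (kron (mat_adjoint U) (transpose_mat U) * approx_matrix n C \<sigma> l)"

text \<open>
  The algorithm runs through all triples \<open>(u, P, j)\<close>, where \<open>j s\<close> is the residual term chosen for
  the noise \<open>s \<in> P\<close>, and contracts one network per triple and copy of the \<open>n\<close>-qubit space.
\<close>

datatype copy = First | Second

type_synonym choice = "nat \<times> nat set \<times> (nat \<Rightarrow> nat)"

definition alg_choices :: "circuit_element list \<Rightarrow> nat \<Rightarrow> choice set" where
  "alg_choices C l = (SIGMA u:{0..l}. SIGMA P:noise_subsets C u.
     PiE P (\<lambda>s. {1..(local_dim (C ! s))\<^sup>2 - 1}))"

definition alg_networks :: "circuit_element list \<Rightarrow> nat \<Rightarrow> (choice \<times> copy) set" where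
  "alg_networks C l = alg_choices C l \<times> {First, Second}"

definition num_contractions :: "circuit_element list \<Rightarrow> nat \<Rightarrow> nat" where
  "num_contractions C l = card (alg_networks C l)"

fun network_factor ::
  "circuit_element list \<Rightarrow> (nat \<Rightarrow> svd) \<Rightarrow> choice \<times> copy \<Rightarrow> nat \<Rightarrow> complex mat" where
  "network_factor C \<sigma> ((u, P, j), First) s =
     (case C ! s of Gate qs A \<Rightarrow> A
        | Noise qs Ks \<Rightarrow> svd_U (local_dim (C ! s)) (\<sigma> s) (if s \<in> P then j s else 0))"
| "network_factor C \<sigma> ((u, P, j), Second) s =
     (case C ! s of Gate qs A \<Rightarrow> mat_cnj A
        | Noise qs Ks \<Rightarrow> svd_V (local_dim (C ! s)) (\<sigma> s) (if s \<in> P then j s else 0))"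

definition contract_network ::
  "nat \<Rightarrow> complex mat \<Rightarrow> circuit_element list \<Rightarrow> (nat \<Rightarrow> svd) \<Rightarrow> choice \<times> copy \<Rightarrow> complex" where
  "contract_network n U C \<sigma> w = mat_trace
     ((case snd w of First \<Rightarrow> mat_adjoint U | Second \<Rightarrow> transpose_mat U) *
      time_ordered_prod (2 ^ n) (\<lambda>s. embed n (support (C ! s)) (network_factor C \<sigma> w s)) (length C))"

definition alg_output ::
  "nat \<Rightarrow> complex mat \<Rightarrow> circuit_element list \<Rightarrow> (nat \<Rightarrow> svd) \<Rightarrow> nat \<Rightarrow> complex" where
  "alg_output n U C \<sigma> l = 1 / 2 ^ (2 * n) *
     (\<Sum>t\<in>alg_choices C l. contract_network n U C \<sigma> (t, First) * contract_network n U C \<sigma> (t, Second))"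

end

theory Submission
  imports Defs "HOL-Analysis.L2_Norm"
begin

text \<open>
  Write \<open>M = 1 + E\<close> for the matrix of a noise on a \<open>q\<close>-dimensional space, with \<open>\<parallel>E\<parallel> \<le> p\<close>.  The tensor
  permutation preserves the Frobenius norm and turns \<open>1\<close> into a matrix of rank one, so by
  Eckart-Young truncating the singular value decomposition of the permuted \<open>M\<close> at rank one loses
  at most \<open>\<parallel>E\<parallel>\<close> in Frobenius norm, which is at most \<open>q p \<le> 4 p\<close>.  Hence the residual has operator norm
  at most \<open>4 p\<close> and the dominant term at most \<open>1 + p + 4 p\<close>.  Expanding the product of all
  \<open>M = dominant + residual\<close> over the sets of noises, the error consists of the terms with more than
  \<open>l\<close> residual factors, and a normalised trace is bounded by the operator norm.  The fidelity itself is
  computed with the square roots of multiples of the pure state belonging to the ideal circuit.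
\<close>

section \<open>Matrices by their entries\<close>

text \<open>The estimate runs through the Frobenius norm because the tensor permutation only
  reorders entries, whereas it does not respect the operator norm. The detour costs the factor
  \<open>q\<close>: a matrix of operator norm \<open>p\<close> with \<open>q^2\<close> columns has
  all its columns of length at most \<open>p\<close>. The permuted identity is the rank-one
  competitor in Eckart-Young, so the singular vectors themselves never have to be estimated. The
  resulting constants 4 and 5 are both covered by the 16 of the theorem. In the count of
  contractions, estimating every level by the top one alone would cost a factor l + 1; the 1 / u!
  kept from the binomial coefficient sums to at most e instead, which makes the constant of the
  O-bound uniform. Two definitions shape the work. \<open>spectral_norm\<close> is a supremum and
  says nothing before boundedness is known, so estimates are carried by the predicate
  \<open>op_bound\<close>. \<open>mat_sqrt\<close> is a definite description, so positive square
  roots must be shown unique; this is done for multiples of a rank-one projector, the only matrices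
  whose roots occur in a fidelity with a pure state.\<close>

lemma mat_adjoint_dim [simp]:
  fixes A :: "complex mat"
  shows "dim_row (mat_adjoint A) = dim_col A" "dim_col (mat_adjoint A) = dim_row A"
  by (simp_all add: mat_adjoint_def)

lemma mat_adjoint_carrier [simp]:
  "A \<in> carrier_mat n m \<Longrightarrow> mat_adjoint (A :: complex mat) \<in> carrier_mat m n"
  by (intro carrier_matI) auto

lemma mat_adjoint_index [simp]:
  "i < dim_col A \<Longrightarrow> j < dim_row A \<Longrightarrow> mat_adjoint A $$ (i, j) = cnj (A $$ (j, i))"
  by (simp add: mat_adjoint_def mat_of_rows_index)

text \<open>Plain sums over \<open>{..<k}\<close> are what \<open>sum.swap\<close> and
  \<open>sum_pair_index\<close> act on. The library rule \<open>index_mult_mat(1)\<close>, which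
  produces scalar products of rows and columns, is therefore switched off in many later
  proofs.\<close>

lemma mult_mat_index:
  fixes A B :: "complex mat"
  assumes "A \<in> carrier_mat n k" "B \<in> carrier_mat k m" "i < n" "j < m"
  shows "(A * B) $$ (i, j) = (\<Sum>l<k. A $$ (i, l) * B $$ (l, j))"
  using assms by (auto simp: scalar_prod_def atLeast0LessThan intro!: sum.cong)

lemma mult_mat_vec_index:
  fixes A :: "complex mat"
  assumes "A \<in> carrier_mat n k" "v \<in> carrier_vec k" "i < n"
  shows "(A *\<^sub>v v) $ i = (\<Sum>l<k. A $$ (i, l) * v $ l)"
  using assms by (auto simp: scalar_prod_def atLeast0LessThan intro!: sum.cong)

lemma mat_adjoint_mult:
  fixes A B :: "complex mat"
  assumes "A \<in> carrier_mat n k" "B \<in> carrier_mat k m"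
  shows "mat_adjoint (A * B) = mat_adjoint B * mat_adjoint A"
proof (rule eq_matI)
  fix i j assume ij: "i < dim_row (mat_adjoint B * mat_adjoint A)"
    "j < dim_col (mat_adjoint B * mat_adjoint A)"
  with assms have ij': "i < m" "j < n" by auto
  have "mat_adjoint (A * B) $$ (i, j) = cnj ((A * B) $$ (j, i))"
    using assms ij' by (subst mat_adjoint_index) auto
  also have "\<dots> = (\<Sum>l<k. cnj (A $$ (j, l)) * cnj (B $$ (l, i)))"
    using assms ij' by (subst mult_mat_index[of A n k B m]) auto
  also have "\<dots> = (\<Sum>l<k. mat_adjoint B $$ (i, l) * mat_adjoint A $$ (l, j))"
    using assms ij' by (intro sum.cong refl) (auto simp: mult.commute)
  also have "\<dots> = (mat_adjoint B * mat_adjoint A) $$ (i, j)"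
    using assms ij' by (subst mult_mat_index[of _ m k _ n]) auto
  finally show "mat_adjoint (A * B) $$ (i, j) = (mat_adjoint B * mat_adjoint A) $$ (i, j)" .
qed (use assms in auto)

lemma mat_adjoint_adjoint [simp]: "mat_adjoint (mat_adjoint A) = (A :: complex mat)"
  by (rule eq_matI) auto

lemma mat_cnj_dim [simp]: "dim_row (mat_cnj A) = dim_row A" "dim_col (mat_cnj A) = dim_col A"
  by (simp_all add: mat_cnj_def)

lemma mat_cnj_carrier [simp]: "A \<in> carrier_mat n m \<Longrightarrow> mat_cnj A \<in> carrier_mat n m"
  by (simp add: mat_cnj_def)

lemma mat_cnj_index [simp]:
  "i < dim_row A \<Longrightarrow> j < dim_col A \<Longrightarrow> mat_cnj A $$ (i, j) = cnj (A $$ (i, j))"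
  by (simp add: mat_cnj_def)

section \<open>Kronecker products and the pair encoding of indices\<close>

lemma kron_dim [simp]:
  "dim_row (kron A B) = dim_row A * dim_row B" "dim_col (kron A B) = dim_col A * dim_col B"
  by (simp_all add: kron_def)

lemma kron_carrier [simp]:
  "A \<in> carrier_mat n m \<Longrightarrow> B \<in> carrier_mat n' m' \<Longrightarrow> kron A B \<in> carrier_mat (n * n') (m * m')"
  by (intro carrier_matI) auto

lemma div_less_of_less_mult: "(i::nat) < n * k \<Longrightarrow> i div k < n"
  by (simp add: less_mult_imp_div_less)

lemma mod_less_of_less_mult: "(i::nat) < n * k \<Longrightarrow> i mod k < k"
  by (metis gr_zeroI mod_less_divisor mult_0_right not_less_zero)

lemma pair_index_less: "a < n \<Longrightarrow> b < k \<Longrightarrow> a * k + b < n * (k::nat)"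
proof -
  assume "a < n" "b < k"
  then have "a * k + b < Suc a * k" by simp
  also have "\<dots> \<le> n * k" using \<open>a < n\<close> by (intro mult_right_mono) auto
  finally show ?thesis .
qed

lemma pair_index_div_mod:
  assumes "b < (k::nat)"
  shows "(a * k + b) div k = a" "(a * k + b) mod k = b"
  using assms by simp_all

lemma kron_index [simp]:
  "i < dim_row A * dim_row B \<Longrightarrow> j < dim_col A * dim_col B \<Longrightarrow>
    kron A B $$ (i, j) = A $$ (i div dim_row B, j div dim_col B) * B $$ (i mod dim_row B, j mod dim_col B)"
  by (simp add: kron_def)

lemma kron_index_pair:
  assumes "A \<in> carrier_mat n m" "B \<in> carrier_mat n' m'" "a < n" "c < m" "b < n'" "e < m'"
  shows "kron A B $$ (a * n' + b, c * m' + e) = A $$ (a, c) * B $$ (b, e)"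
  using assms pair_index_less[of a n b n'] pair_index_less[of c m e m'] by simp

text \<open>Division with remainder by \<open>k\<close> inverts the pair encoding. The computations
  with Kronecker products, permuted tensors and composed Kraus lists rest on this splitting.\<close>

lemma sum_pair_index:
  fixes f :: "nat \<Rightarrow> 'a :: comm_monoid_add"
  shows "(\<Sum>i<n * k. f i) = (\<Sum>a<n. \<Sum>b<k. f (a * k + b))"
proof -
  have "(\<Sum>i<n * k. f i) = (\<Sum>(a, b)\<in>{..<n} \<times> {..<k}. f (a * k + b))"
    by (rule sum.reindex_bij_witness[of _ "\<lambda>(a, b). a * k + b" "\<lambda>i. (i div k, i mod k)"])
      (auto simp: div_less_of_less_mult mod_less_of_less_mult pair_index_less)
  then show ?thesis by (simp add: sum.cartesian_product)
qed

text \<open>The mixed-product rule: the sum over the paired middle index separates into a product of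
  two sums.\<close>

lemma kron_mult:
  assumes "A \<in> carrier_mat n n" "B \<in> carrier_mat m m" "A' \<in> carrier_mat n n" "B' \<in> carrier_mat m m"
  shows "kron A B * kron A' B' = kron (A * A') (B * B')"
proof (rule eq_matI)
  fix i j assume "i < dim_row (kron (A * A') (B * B'))" "j < dim_col (kron (A * A') (B * B'))"
  with assms have ij: "i < n * m" "j < n * m" by auto
  then have d: "i div m < n" "j div m < n" "i mod m < m" "j mod m < m"
    by (simp_all add: div_less_of_less_mult mod_less_of_less_mult)
  have "(kron A B * kron A' B') $$ (i, j) = (\<Sum>l<n * m. kron A B $$ (i, l) * kron A' B' $$ (l, j))"
    using assms ij by (intro mult_mat_index[of _ "n * m" _ _ "n * m"]) auto
  also have "\<dots> = (\<Sum>a<n. \<Sum>b<m. kron A B $$ (i, a * m + b) * kron A' B' $$ (a * m + b, j))"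
    by (rule sum_pair_index)
  also have "\<dots> = (\<Sum>a<n. \<Sum>b<m. (A $$ (i div m, a) * A' $$ (a, j div m)) *
      (B $$ (i mod m, b) * B' $$ (b, j mod m)))"
    using assms ij by (intro sum.cong refl) (auto simp: pair_index_less)
  also have "\<dots> = (\<Sum>a<n. A $$ (i div m, a) * A' $$ (a, j div m)) *
      (\<Sum>b<m. B $$ (i mod m, b) * B' $$ (b, j mod m))"
    by (simp add: sum_product)
  also have "\<dots> = kron (A * A') (B * B') $$ (i, j)"
    using assms ij d by (subst (1 2) mult_mat_index[symmetric]) auto
  finally show "(kron A B * kron A' B') $$ (i, j) = kron (A * A') (B * B') $$ (i, j)" .
qed (use assms in auto)

lemma kron_one: "kron (1\<^sub>m n) (1\<^sub>m m) = 1\<^sub>m (n * m)"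
proof (rule eq_matI)
  fix i j assume "i < dim_row (1\<^sub>m (n * m) :: complex mat)" "j < dim_col (1\<^sub>m (n * m) :: complex mat)"
  then have ij: "i < n * m" "j < n * m" by auto
  then have "i = j \<longleftrightarrow> i div m = j div m \<and> i mod m = j mod m"
    by (metis div_mult_mod_eq)
  with ij show "kron (1\<^sub>m n) (1\<^sub>m m) $$ (i, j) = (1\<^sub>m (n * m) :: complex mat) $$ (i, j)"
    by (auto simp: div_less_of_less_mult mod_less_of_less_mult)
qed auto

lemma mat_trace_kron:
  assumes "A \<in> carrier_mat n n" "B \<in> carrier_mat m m"
  shows "mat_trace (kron A B) = mat_trace A * mat_trace B"
  using assms by (simp add: mat_trace_def sum_pair_index sum_product pair_index_less)

lemma adjoint_kron:
  assumes "A \<in> carrier_mat n n" "B \<in> carrier_mat m m"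
  shows "mat_adjoint (kron A B) = kron (mat_adjoint A) (mat_adjoint B)"
  by (rule eq_matI) (use assms in \<open>auto simp: div_less_of_less_mult mod_less_of_less_mult\<close>)

section \<open>Finite sums of matrices\<close>

lemma mat_sum_dim [simp]: "dim_row (mat_sum D f I) = D" "dim_col (mat_sum D f I) = D"
  by (simp_all add: mat_sum_def)

lemma mat_sum_carrier [simp]: "mat_sum D f I \<in> carrier_mat D D"
  by (simp add: mat_sum_def)

lemma mat_sum_index [simp]:
  "i < D \<Longrightarrow> j < D \<Longrightarrow> mat_sum D f I $$ (i, j) = (\<Sum>x\<in>I. f x $$ (i, j))"
  by (simp add: mat_sum_def)

lemma mat_sum_cong:
  "I = J \<Longrightarrow> (\<And>x. x \<in> J \<Longrightarrow> f x = g x) \<Longrightarrow> mat_sum D f I = mat_sum D g J"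
  by (simp add: mat_sum_def)

lemma mat_sum_singleton: "f x \<in> carrier_mat D D \<Longrightarrow> mat_sum D f {x} = f x"
  by (rule eq_matI) auto

lemma mat_sum_pair_index:
  fixes f :: "nat \<Rightarrow> complex mat"
  shows "mat_sum D f {..<n * k} = mat_sum D (\<lambda>a. mat_sum D (\<lambda>b. f (a * k + b)) {..<k}) {..<n}"
  by (rule eq_matI) (simp_all add: sum_pair_index)

lemma mat_sum_mult_left:
  assumes "A \<in> carrier_mat D D" "\<And>x. x \<in> I \<Longrightarrow> f x \<in> carrier_mat D D"
  shows "A * mat_sum D f I = mat_sum D (\<lambda>x. A * f x) I"
proof (rule eq_matI)
  fix i j assume "i < dim_row (mat_sum D (\<lambda>x. A * f x) I)" "j < dim_col (mat_sum D (\<lambda>x. A * f x) I)"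
  then have ij: "i < D" "j < D" by auto
  have "(A * mat_sum D f I) $$ (i, j) = (\<Sum>l<D. \<Sum>x\<in>I. A $$ (i, l) * f x $$ (l, j))"
    using assms ij by (subst mult_mat_index[of _ D D _ D]) (auto simp: sum_distrib_left)
  also have "\<dots> = (\<Sum>x\<in>I. \<Sum>l<D. A $$ (i, l) * f x $$ (l, j))"
    by (rule sum.swap)
  also have "\<dots> = (\<Sum>x\<in>I. (A * f x) $$ (i, j))"
    using assms ij by (intro sum.cong refl mult_mat_index[symmetric]) auto
  finally show "(A * mat_sum D f I) $$ (i, j) = mat_sum D (\<lambda>x. A * f x) I $$ (i, j)"
    using ij by simp
qed (use assms in auto)

lemma mat_sum_mult_right:
  assumes "A \<in> carrier_mat D D" "\<And>x. x \<in> I \<Longrightarrow> f x \<in> carrier_mat D D"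
  shows "mat_sum D f I * A = mat_sum D (\<lambda>x. f x * A) I"
proof (rule eq_matI)
  fix i j assume "i < dim_row (mat_sum D (\<lambda>x. f x * A) I)" "j < dim_col (mat_sum D (\<lambda>x. f x * A) I)"
  then have ij: "i < D" "j < D" by auto
  have "(mat_sum D f I * A) $$ (i, j) = (\<Sum>l<D. \<Sum>x\<in>I. f x $$ (i, l) * A $$ (l, j))"
    using assms ij by (subst mult_mat_index[of _ D D _ D]) (auto simp: sum_distrib_right)
  also have "\<dots> = (\<Sum>x\<in>I. \<Sum>l<D. f x $$ (i, l) * A $$ (l, j))"
    by (rule sum.swap)
  also have "\<dots> = (\<Sum>x\<in>I. (f x * A) $$ (i, j))"
    using assms ij by (intro sum.cong refl mult_mat_index[symmetric]) auto
  finally show "(mat_sum D f I * A) $$ (i, j) = mat_sum D (\<lambda>x. f x * A) I $$ (i, j)"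
    using ij by simp
qed (use assms in auto)

lemma mat_trace_mat_sum: "mat_trace (mat_sum D f I) = (\<Sum>x\<in>I. \<Sum>i<D. f x $$ (i, i))"
  by (simp add: mat_trace_def sum.swap[of _ I])

lemma mat_trace_mult_mat_sum:
  assumes "A \<in> carrier_mat D D" "\<And>x. x \<in> I \<Longrightarrow> f x \<in> carrier_mat D D"
  shows "mat_trace (A * mat_sum D f I) = (\<Sum>x\<in>I. mat_trace (A * f x))"
proof -
  have "mat_trace (A * mat_sum D f I) = (\<Sum>x\<in>I. \<Sum>i<D. (A * f x) $$ (i, i))"
    using assms by (simp only: mat_sum_mult_left mat_trace_mat_sum)
  also have "\<dots> = (\<Sum>x\<in>I. mat_trace (A * f x))"
    using assms by (intro sum.cong refl) (auto simp: mat_trace_def)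
  finally show ?thesis .
qed

section \<open>Time-ordered products and their distributive law\<close>

lemma time_ordered_prod_carrier [simp]:
  "(\<And>s. s < k \<Longrightarrow> f s \<in> carrier_mat D D) \<Longrightarrow> time_ordered_prod D f k \<in> carrier_mat D D"
  by (induction k) (auto intro!: mult_carrier_mat)

lemma time_ordered_prod_cong:
  "(\<And>s. s < k \<Longrightarrow> f s = g s) \<Longrightarrow> time_ordered_prod D f k = time_ordered_prod D g k"
  by (induction k) auto

lemma time_ordered_prod_kron:
  assumes "\<And>s. s < k \<Longrightarrow> f s \<in> carrier_mat n n" "\<And>s. s < k \<Longrightarrow> g s \<in> carrier_mat m m"
  shows "time_ordered_prod (n * m) (\<lambda>s. kron (f s) (g s)) k =
    kron (time_ordered_prod n f k) (time_ordered_prod m g k)"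
  using assms by (induction k) (auto simp: kron_one kron_mult[of _ n _ m])

text \<open>A choice function on \<open>insert k S\<close> is a value at \<open>k\<close> together
  with a choice function on \<open>S\<close>; this drives the induction for the distributive
  law.\<close>

lemma mat_sum_PiE_insert:
  assumes "k \<notin> S"
  shows "mat_sum D F (PiE (insert k S) J) =
    mat_sum D (\<lambda>x. mat_sum D (\<lambda>j. F (j(k := x))) (PiE S J)) (J k)"
proof -
  have inj: "inj_on (\<lambda>(y, g). g(k := y)) (J k \<times> PiE S J)"
    using assms by (rule inj_combinator)
  show ?thesis
    by (rule eq_matI)
      (simp_all add: PiE_insert_eq sum.reindex[OF inj, unfolded split_def] sum.cartesian_product
        o_def split_def)
qed

text \<open>The noncommutative distributive law: the factors in \<open>S\<close> are sums, the
  others stay whole. It is applied twice, with Boolean choices to split noises into dominant and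
  residual part, and with singular indices to split residuals into Kronecker products. Intersecting
  \<open>S\<close> with \<open>{..<k}\<close> lets the choice functions grow along with the
  product.\<close>

lemma time_ordered_prod_mat_sum:
  assumes "\<And>s x. s < k \<Longrightarrow> s \<in> S \<Longrightarrow> x \<in> J s \<Longrightarrow> f s x \<in> carrier_mat D D"
    and "\<And>s. s < k \<Longrightarrow> s \<notin> S \<Longrightarrow> g s \<in> carrier_mat D D"
  shows "time_ordered_prod D (\<lambda>s. if s \<in> S then mat_sum D (f s) (J s) else g s) k =
    mat_sum D (\<lambda>j. time_ordered_prod D (\<lambda>s. if s \<in> S then f s (j s) else g s) k)
      (PiE (S \<inter> {..<k}) J)"
  using assms
proof (induction k)
  case 0
  show ?case by (simp add: mat_sum_singleton)
next
  case (Suc k)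
  let ?T = "\<lambda>j. time_ordered_prod D (\<lambda>s. if s \<in> S then f s (j s) else g s) k"
  let ?P = "PiE (S \<inter> {..<k}) J"
  have IH: "time_ordered_prod D (\<lambda>s. if s \<in> S then mat_sum D (f s) (J s) else g s) k =
      mat_sum D ?T ?P"
    using Suc by auto
  have T: "?T j \<in> carrier_mat D D" if "j \<in> ?P" for j
    using that Suc.prems by (intro time_ordered_prod_carrier) (auto simp: PiE_iff)
  show ?case
  proof (cases "k \<in> S")
    case True
    \<comment> \<open>The first \<open>k\<close> factors never consult the choice at
      \<open>k\<close>.\<close>
    have upd: "?T (j(k := x)) = ?T j" for j x
      by (intro time_ordered_prod_cong) auto
    have "S \<inter> {..<Suc k} = insert k (S \<inter> {..<k})" using True by auto
    then have "mat_sum D (\<lambda>j. time_ordered_prod D (\<lambda>s. if s \<in> S then f s (j s) else g s) (Suc k))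
        (PiE (S \<inter> {..<Suc k}) J) =
        mat_sum D (\<lambda>x. mat_sum D (\<lambda>j. f k x * ?T j) ?P) (J k)"
      using True by (simp add: mat_sum_PiE_insert upd)
    also have "\<dots> = mat_sum D (\<lambda>x. f k x * mat_sum D ?T ?P) (J k)"
      using Suc.prems True T by (intro mat_sum_cong refl mat_sum_mult_left[symmetric]) auto
    also have "\<dots> = mat_sum D (f k) (J k) * mat_sum D ?T ?P"
      using Suc.prems True by (intro mat_sum_mult_right[symmetric]) auto
    finally show ?thesis using True IH by simp
  next
    case False
    then have "S \<inter> {..<Suc k} = S \<inter> {..<k}" by (auto simp: less_Suc_eq)
    with False IH T Suc.prems show ?thesis by (simp add: mat_sum_mult_left)
  qed
qed

section \<open>Operator and Frobenius norms\<close>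

text \<open>An upper bound on the operator norm that avoids the supremum, so that bounds can be
  added, multiplied and weakened directly. The sign of \<open>c\<close> is left open, which is why
  \<open>op_bound_mult\<close> asks for a nonnegative bound on its left factor.\<close>

definition op_bound :: "complex mat \<Rightarrow> real \<Rightarrow> bool" where
  "op_bound A c \<longleftrightarrow> (\<forall>v\<in>carrier_vec (dim_col A). vec_norm2 (A *\<^sub>v v) \<le> c * vec_norm2 v)"

definition frobenius_sq :: "complex mat \<Rightarrow> real" where
  "frobenius_sq A = (\<Sum>i<dim_row A. \<Sum>j<dim_col A. (cmod (A $$ (i, j)))\<^sup>2)"

text \<open>Gives access to the Minkowski and Cauchy-Schwarz inequalities for
  \<open>L2_set\<close>.\<close>

lemma vec_norm2_eq_L2_set: "vec_norm2 v = L2_set (\<lambda>i. cmod (v $ i)) {..<dim_vec v}"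
  by (simp add: vec_norm2_def L2_set_def)

lemma vec_norm2_nonneg [simp]: "0 \<le> vec_norm2 v"
  by (simp add: vec_norm2_eq_L2_set)

lemma vec_norm2_sq: "(vec_norm2 v)\<^sup>2 = (\<Sum>i<dim_vec v. (cmod (v $ i))\<^sup>2)"
  by (simp add: vec_norm2_def sum_nonneg)

text \<open>In complex form a squared length can be expanded and rearranged together with
  conjugates; injectivity of \<open>of_real\<close> returns to the reals at the end.\<close>

lemma vec_norm2_sq_complex:
  "complex_of_real ((vec_norm2 v)\<^sup>2) = (\<Sum>i<dim_vec v. v $ i * cnj (v $ i))"
  unfolding vec_norm2_sq of_real_sum complex_norm_square[symmetric] ..

lemma cmod_index_le_vec_norm2: "i < dim_vec v \<Longrightarrow> cmod (v $ i) \<le> vec_norm2 v"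
  unfolding vec_norm2_eq_L2_set by (rule member_le_L2_set) auto

lemma vec_norm2_triangle:
  assumes "v \<in> carrier_vec n" "w \<in> carrier_vec n"
  shows "vec_norm2 (v + w) \<le> vec_norm2 v + vec_norm2 w"
proof -
  have "vec_norm2 (v + w) \<le> L2_set (\<lambda>i. cmod (v $ i) + cmod (w $ i)) {..<n}"
    unfolding vec_norm2_eq_L2_set using assms by (auto intro!: L2_set_mono norm_triangle_ineq)
  also have "\<dots> \<le> vec_norm2 v + vec_norm2 w"
    using assms L2_set_triangle_ineq by (auto simp: vec_norm2_eq_L2_set)
  finally show ?thesis .
qed

lemma vec_norm2_smult: "vec_norm2 (a \<cdot>\<^sub>v v) = cmod a * vec_norm2 v"
proof -
  have "vec_norm2 (a \<cdot>\<^sub>v v) = L2_set (\<lambda>i. cmod a * cmod (v $ i)) {..<dim_vec v}"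
    unfolding vec_norm2_eq_L2_set by (rule L2_set_cong) (auto simp: norm_mult)
  then show ?thesis by (simp add: vec_norm2_eq_L2_set L2_set_right_distrib)
qed

lemma cauchy_schwarz_cmod:
  "cmod (\<Sum>i\<in>I. f i * g i) \<le> L2_set (\<lambda>i. cmod (f i)) I * L2_set (\<lambda>i. cmod (g i)) I"
proof -
  have "cmod (\<Sum>i\<in>I. f i * g i) \<le> (\<Sum>i\<in>I. \<bar>cmod (f i)\<bar> * \<bar>cmod (g i)\<bar>)"
    using norm_sum[of "\<lambda>i. f i * g i" I] by (simp add: norm_mult)
  also have "\<dots> \<le> L2_set (\<lambda>i. cmod (f i)) I * L2_set (\<lambda>i. cmod (g i)) I"
    by (rule L2_set_mult_ineq)
  finally show ?thesis .
qed

lemma op_boundD: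
  "op_bound A c \<Longrightarrow> A \<in> carrier_mat n m \<Longrightarrow> v \<in> carrier_vec m \<Longrightarrow>
    vec_norm2 (A *\<^sub>v v) \<le> c * vec_norm2 v"
  by (auto simp: op_bound_def)

lemma op_boundI:
  "A \<in> carrier_mat n m \<Longrightarrow> (\<And>v. v \<in> carrier_vec m \<Longrightarrow> vec_norm2 (A *\<^sub>v v) \<le> c * vec_norm2 v) \<Longrightarrow>
    op_bound A c"
  by (auto simp: op_bound_def)

lemma op_bound_mono: "op_bound A c \<Longrightarrow> c \<le> c' \<Longrightarrow> op_bound A c'"
  unfolding op_bound_def by (meson mult_right_mono order_trans vec_norm2_nonneg)

lemma op_bound_one: "op_bound (1\<^sub>m n) 1"
  by (rule op_boundI[of _ n n]) auto

lemma op_bound_mult: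
  assumes "A \<in> carrier_mat n k" "B \<in> carrier_mat k m" "op_bound A a" "op_bound B b" "0 \<le> a"
  shows "op_bound (A * B) (a * b)"
proof (rule op_boundI)
  fix v :: "complex vec" assume v: "v \<in> carrier_vec m"
  have "vec_norm2 (A * B *\<^sub>v v) = vec_norm2 (A *\<^sub>v (B *\<^sub>v v))"
    using assms v by (simp add: assoc_mult_mat_vec)
  also have "\<dots> \<le> a * vec_norm2 (B *\<^sub>v v)"
    using assms v by (intro op_boundD[of A a n k]) auto
  also have "\<dots> \<le> a * (b * vec_norm2 v)"
    using assms v by (intro mult_left_mono op_boundD[of B b k m]) auto
  finally show "vec_norm2 (A * B *\<^sub>v v) \<le> a * b * vec_norm2 v" by (simp add: mult.assoc)
qed (use assms in auto)

lemma op_bound_add: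
  assumes "A \<in> carrier_mat n m" "B \<in> carrier_mat n m" "op_bound A a" "op_bound B b"
  shows "op_bound (A + B) (a + b)"
proof (rule op_boundI)
  fix v :: "complex vec" assume v: "v \<in> carrier_vec m"
  have "vec_norm2 ((A + B) *\<^sub>v v) = vec_norm2 (A *\<^sub>v v + B *\<^sub>v v)"
    using assms v by (simp add: add_mult_distrib_mat_vec)
  also have "\<dots> \<le> vec_norm2 (A *\<^sub>v v) + vec_norm2 (B *\<^sub>v v)"
    using assms v by (intro vec_norm2_triangle[of _ n]) auto
  also have "\<dots> \<le> a * vec_norm2 v + b * vec_norm2 v"
    using assms v by (intro add_mono op_boundD[of _ _ n m]) auto
  finally show "vec_norm2 ((A + B) *\<^sub>v v) \<le> (a + b) * vec_norm2 v"
    by (simp add: algebra_simps)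
qed (use assms in auto)

lemma op_bound_uminus:
  assumes "A \<in> carrier_mat n m" "op_bound A a"
  shows "op_bound (- A) a"
proof (rule op_boundI)
  fix v :: "complex vec" assume v: "v \<in> carrier_vec m"
  have "- A *\<^sub>v v = (-1) \<cdot>\<^sub>v (A *\<^sub>v v)"
    using assms(1) v by (intro eq_vecI) (auto simp: scalar_prod_def sum_negf)
  then have "vec_norm2 (- A *\<^sub>v v) = vec_norm2 (A *\<^sub>v v)"
    by (simp add: vec_norm2_smult)
  then show "vec_norm2 (- A *\<^sub>v v) \<le> a * vec_norm2 v"
    using op_boundD[OF assms(2,1) v] by simp
qed (use assms in auto)

lemma op_bound_time_ordered_prod:
  assumes "\<And>s. s < k \<Longrightarrow> f s \<in> carrier_mat D D" "\<And>s. s < k \<Longrightarrow> op_bound (f s) (c s)"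
    and "\<And>s. s < k \<Longrightarrow> 0 \<le> c s"
  shows "op_bound (time_ordered_prod D f k) (\<Prod>s<k. c s)"
  using assms
proof (induction k)
  case 0
  show ?case by (simp add: op_bound_one)
next
  case (Suc k)
  then have "op_bound (f k * time_ordered_prod D f k) (c k * (\<Prod>s<k. c s))"
    by (intro op_bound_mult[of _ D D _ D]) auto
  then show ?case by (simp add: mult.commute)
qed

lemma vec_norm2_unit_vec: "i < n \<Longrightarrow> vec_norm2 (unit_vec n i) = 1"
proof -
  assume "i < n"
  have "(\<Sum>j<n. (cmod (unit_vec n i $ j))\<^sup>2) = (\<Sum>j<n. if j = i then 1 else 0)"
    using \<open>i < n\<close> by (intro sum.cong) auto
  with \<open>i < n\<close> show ?thesis by (simp add: vec_norm2_def)
qed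

lemma mult_mat_unit_vec:
  fixes A :: "complex mat"
  shows "A \<in> carrier_mat n m \<Longrightarrow> j < m \<Longrightarrow> A *\<^sub>v unit_vec m j = col A j"
  by (intro eq_vecI) auto

lemma op_bound_col:
  assumes "A \<in> carrier_mat n m" "op_bound A c" "j < m"
  shows "vec_norm2 (col A j) \<le> c"
  using op_boundD[OF assms(2,1), of "unit_vec m j"] assms
  by (simp add: mult_mat_unit_vec vec_norm2_unit_vec)

text \<open>A diagonal entry is at most the length of its column, and a column is the image of a
  unit vector. The dimension factor is later cancelled by the normalisation of the fidelity.\<close>

lemma cmod_trace_le:
  assumes "A \<in> carrier_mat n n" "op_bound A c"
  shows "cmod (mat_trace A) \<le> real n * c"
proof -
  have "cmod (A $$ (i, i)) \<le> c" if "i < n" for i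
    using cmod_index_le_vec_norm2[of i "col A i"] op_bound_col[OF assms that] assms(1) that by auto
  then have "(\<Sum>i<n. cmod (A $$ (i, i))) \<le> (\<Sum>i<n. c)"
    by (intro sum_mono) auto
  with norm_sum[of "\<lambda>i. A $$ (i, i)" "{..<n}"] assms(1) show ?thesis
    by (simp add: mat_trace_def)
qed

section \<open>The Frobenius norm\<close>

lemma frobenius_sq_cols:
  "frobenius_sq A = (\<Sum>j<dim_col A. (vec_norm2 (col A j))\<^sup>2)"
  by (simp add: frobenius_sq_def vec_norm2_sq sum.swap[of _ "{..<dim_col A}"])

lemma frobenius_sq_nonneg: "0 \<le> frobenius_sq A"
  by (simp add: frobenius_sq_def sum_nonneg)

text \<open>Each of the \<open>m\<close> columns has length at most \<open>c\<close>. For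
  \<open>m\<close> the square of \<open>q\<close> this is where the factor \<open>q\<close> in the
  residual bound comes from.\<close>

lemma frobenius_sq_le:
  assumes "A \<in> carrier_mat n m" "op_bound A c"
  shows "frobenius_sq A \<le> real m * c\<^sup>2"
proof -
  have "(vec_norm2 (col A j))\<^sup>2 \<le> c\<^sup>2" if "j < m" for j
    using op_bound_col[OF assms that] by (intro power_mono) auto
  then have "(\<Sum>j<m. (vec_norm2 (col A j))\<^sup>2) \<le> (\<Sum>j<m. c\<^sup>2)"
    by (intro sum_mono) auto
  then have "frobenius_sq A \<le> (\<Sum>j<m. c\<^sup>2)"
    using assms(1) by (simp add: frobenius_sq_cols)
  then show ?thesis by simp
qed

text \<open>Cauchy-Schwarz in every row.\<close>

lemma op_bound_frobenius: "op_bound A (sqrt (frobenius_sq A))"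
proof (rule op_boundI)
  fix v :: "complex vec" assume v: "v \<in> carrier_vec (dim_col A)"
  have row: "(cmod ((A *\<^sub>v v) $ i))\<^sup>2 \<le> (\<Sum>j<dim_col A. (cmod (A $$ (i, j)))\<^sup>2) * (vec_norm2 v)\<^sup>2"
    if "i < dim_row A" for i
  proof -
    have "(A *\<^sub>v v) $ i = (\<Sum>j<dim_col A. A $$ (i, j) * v $ j)"
      using that v by (intro mult_mat_vec_index[of _ "dim_row A"]) auto
    then have "cmod ((A *\<^sub>v v) $ i) \<le> L2_set (\<lambda>j. cmod (A $$ (i, j))) {..<dim_col A} * vec_norm2 v"
      using cauchy_schwarz_cmod[of "\<lambda>j. A $$ (i, j)" "\<lambda>j. v $ j" "{..<dim_col A}"] v
      by (simp add: vec_norm2_eq_L2_set)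
    then have "(cmod ((A *\<^sub>v v) $ i))\<^sup>2 \<le> (L2_set (\<lambda>j. cmod (A $$ (i, j))) {..<dim_col A} * vec_norm2 v)\<^sup>2"
      by (intro power_mono) auto
    then show ?thesis by (simp add: power_mult_distrib L2_set_def sum_nonneg)
  qed
  have "(vec_norm2 (A *\<^sub>v v))\<^sup>2 = (\<Sum>i<dim_row A. (cmod ((A *\<^sub>v v) $ i))\<^sup>2)"
    by (simp add: vec_norm2_sq)
  also have "\<dots> \<le> (\<Sum>i<dim_row A. (\<Sum>j<dim_col A. (cmod (A $$ (i, j)))\<^sup>2) * (vec_norm2 v)\<^sup>2)"
    using row by (intro sum_mono) auto
  also have "\<dots> = (sqrt (frobenius_sq A) * vec_norm2 v)\<^sup>2"
    by (simp add: frobenius_sq_nonneg power_mult_distrib sum_distrib_right[symmetric])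
      (simp add: frobenius_sq_def)
  finally show "vec_norm2 (A *\<^sub>v v) \<le> sqrt (frobenius_sq A) * vec_norm2 v"
    by (rule power2_le_imp_le) (simp add: frobenius_sq_nonneg)
qed auto

text \<open>A real \<open>SUP\<close> carries information only over a set that is bounded above; the
  Frobenius norm supplies the bound.\<close>

lemma spectral_norm_bdd_above:
  "bdd_above ((\<lambda>v. vec_norm2 (A *\<^sub>v v)) ` {v \<in> carrier_vec (dim_col A). vec_norm2 v \<le> 1})"
proof (rule bdd_aboveI2)
  fix v assume "v \<in> {v \<in> carrier_vec (dim_col A). vec_norm2 v \<le> 1}"
  then have "vec_norm2 (A *\<^sub>v v) \<le> sqrt (frobenius_sq A) * vec_norm2 v" "vec_norm2 v \<le> 1"
    using op_bound_frobenius by (auto simp: op_bound_def)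
  moreover have "sqrt (frobenius_sq A) * vec_norm2 v \<le> sqrt (frobenius_sq A) * 1"
    using \<open>vec_norm2 v \<le> 1\<close> by (intro mult_left_mono) (auto simp: frobenius_sq_nonneg)
  ultimately show "vec_norm2 (A *\<^sub>v v) \<le> sqrt (frobenius_sq A)" by simp
qed

lemma spectral_norm_upper:
  "v \<in> carrier_vec (dim_col A) \<Longrightarrow> vec_norm2 v \<le> 1 \<Longrightarrow> vec_norm2 (A *\<^sub>v v) \<le> spectral_norm A"
  unfolding spectral_norm_def by (rule cSUP_upper[OF _ spectral_norm_bdd_above]) auto

lemma spectral_norm_nonneg: "0 \<le> spectral_norm A"
proof -
  have "vec_norm2 (0\<^sub>v (dim_col A)) \<le> 1" by (simp add: vec_norm2_def)
  then have "vec_norm2 (A *\<^sub>v 0\<^sub>v (dim_col A)) \<le> spectral_norm A"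
    by (intro spectral_norm_upper) auto
  then show ?thesis using vec_norm2_nonneg order_trans by blast
qed

lemma op_bound_spectral_norm: "op_bound A (spectral_norm A)"
proof (rule op_boundI)
  fix v :: "complex vec" assume v: "v \<in> carrier_vec (dim_col A)"
  show "vec_norm2 (A *\<^sub>v v) \<le> spectral_norm A * vec_norm2 v"
  proof (cases "vec_norm2 v = 0")
    case True
    \<comment> \<open>A vector of length 0 cannot be rescaled to length 1, but the Frobenius bound
      already makes its image vanish.\<close>
    then show ?thesis
      using op_boundD[OF op_bound_frobenius, of A "dim_row A" "dim_col A" v] v by simp
  next
    case False
    define r where "r = vec_norm2 v"
    have r: "r > 0" using False vec_norm2_nonneg[of v] unfolding r_def by linarith
    have "vec_norm2 (complex_of_real (1 / r) \<cdot>\<^sub>v v) = 1"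
      using r by (simp only: vec_norm2_smult norm_of_real) (simp add: r_def)
    then have "vec_norm2 (A *\<^sub>v (complex_of_real (1 / r) \<cdot>\<^sub>v v)) \<le> spectral_norm A"
      using v by (intro spectral_norm_upper) auto
    also have "A *\<^sub>v (complex_of_real (1 / r) \<cdot>\<^sub>v v) = complex_of_real (1 / r) \<cdot>\<^sub>v (A *\<^sub>v v)"
      using v by (intro mult_mat_vec[of _ "dim_row A"]) auto
    finally have "1 / r * vec_norm2 (A *\<^sub>v v) \<le> spectral_norm A"
      using r by (simp only: vec_norm2_smult norm_of_real) simp
    then show ?thesis using r by (simp add: r_def field_simps)
  qed
qed auto

text \<open>Expanding the squared length and moving the sum over the rows innermost exhibits the
  entries of \<open>mat_adjoint A * A\<close>.\<close>

lemma vec_norm2_isometry: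
  assumes A: "A \<in> carrier_mat n m" "mat_adjoint A * A = 1\<^sub>m m" and v: "v \<in> carrier_vec m"
  shows "vec_norm2 (A *\<^sub>v v) = vec_norm2 v"
proof -
  have "complex_of_real ((vec_norm2 (A *\<^sub>v v))\<^sup>2) =
      (\<Sum>i<n. (\<Sum>j<m. A $$ (i, j) * v $ j) * cnj (\<Sum>k<m. A $$ (i, k) * v $ k))"
    unfolding vec_norm2_sq_complex using A(1) mult_mat_vec_index[OF A(1) v]
    by (intro sum.cong) (auto simp del: index_mult_mat_vec)
  also have "\<dots> = (\<Sum>i<n. \<Sum>j<m. \<Sum>k<m. v $ j * (cnj (v $ k) * (cnj (A $$ (i, k)) * A $$ (i, j))))"
    by (simp add: sum_product mult_ac)
  also have "\<dots> = (\<Sum>j<m. \<Sum>i<n. \<Sum>k<m. v $ j * (cnj (v $ k) * (cnj (A $$ (i, k)) * A $$ (i, j))))"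
    by (rule sum.swap)
  also have "\<dots> = (\<Sum>j<m. \<Sum>k<m. \<Sum>i<n. v $ j * (cnj (v $ k) * (cnj (A $$ (i, k)) * A $$ (i, j))))"
    by (intro sum.cong refl sum.swap)
  also have "\<dots> = (\<Sum>j<m. \<Sum>k<m. v $ j * (cnj (v $ k) * (mat_adjoint A * A) $$ (k, j)))"
    using A(1) by (intro sum.cong refl)
      (simp add: mult_mat_index[of _ m n _ m] sum_distrib_left del: index_mult_mat(1))
  also have "\<dots> = (\<Sum>j<m. \<Sum>k<m. if j = k then v $ j * cnj (v $ k) else 0)"
    using A(2) by (intro sum.cong refl) auto
  also have "\<dots> = (\<Sum>j<m. v $ j * cnj (v $ j))"
    by (intro sum.cong refl) (simp add: sum.delta)
  also have "\<dots> = complex_of_real ((vec_norm2 v)\<^sup>2)"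
    unfolding vec_norm2_sq_complex using v by auto
  finally have "(vec_norm2 (A *\<^sub>v v))\<^sup>2 = (vec_norm2 v)\<^sup>2"
    using of_real_eq_iff by blast
  then show ?thesis by simp
qed

section \<open>Unitary matrices and the norms they preserve\<close>

lemma unitary_matD:
  assumes "unitary_mat n A"
  shows "A \<in> carrier_mat n n" "mat_adjoint A * A = 1\<^sub>m n" "A * mat_adjoint A = 1\<^sub>m n"
  using assms by (auto simp: unitary_mat_def)

lemma unitary_mat_adjoint: "unitary_mat n A \<Longrightarrow> unitary_mat n (mat_adjoint A)"
  by (auto simp: unitary_mat_def)

lemma unitary_mat_cnj:
  assumes "unitary_mat n A"
  shows "unitary_mat n (mat_cnj A)"
proof -
  have A: "A \<in> carrier_mat n n" by (rule unitary_matD[OF assms])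
  have 1: "mat_adjoint (mat_cnj A) * mat_cnj A = mat_cnj (mat_adjoint A * A)"
    by (rule eq_matI) (use A in \<open>auto simp: mult_mat_index[of _ n n _ n] simp del: index_mult_mat(1)\<close>)
  have 2: "mat_cnj A * mat_adjoint (mat_cnj A) = mat_cnj (A * mat_adjoint A)"
    by (rule eq_matI) (use A in \<open>auto simp: mult_mat_index[of _ n n _ n] simp del: index_mult_mat(1)\<close>)
  have 3: "mat_cnj (1\<^sub>m n) = 1\<^sub>m n"
    by (rule eq_matI) auto
  show ?thesis
    unfolding unitary_mat_def using A unitary_matD[OF assms] by (simp add: 1 2 3)
qed

lemma unitary_mat_kron:
  assumes "unitary_mat n A" "unitary_mat m B"
  shows "unitary_mat (n * m) (kron A B)"
  using unitary_matD[OF assms(1)] unitary_matD[OF assms(2)]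
  by (simp add: unitary_mat_def adjoint_kron[of _ n _ m] kron_mult[of _ n _ m] kron_one)

lemma unitary_mat_mult:
  assumes "unitary_mat n A" "unitary_mat n B"
  shows "unitary_mat n (A * B)"
proof -
  note A = unitary_matD[OF assms(1)] and B = unitary_matD[OF assms(2)]
  have assoc: "X * Y * Z = X * (Y * Z)"
    if "X \<in> carrier_mat n n" "Y \<in> carrier_mat n n" "Z \<in> carrier_mat n n" for X Y Z :: "complex mat"
    using that by (rule assoc_mult_mat)
  have "mat_adjoint (A * B) * (A * B) = mat_adjoint B * (mat_adjoint A * (A * B))"
    using A(1) B(1) by (simp add: mat_adjoint_mult[of _ n n _ n] assoc)
  also have "mat_adjoint A * (A * B) = mat_adjoint A * A * B"
    using A(1) B(1) by (intro assoc[symmetric]) auto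
  finally have 1: "mat_adjoint (A * B) * (A * B) = 1\<^sub>m n"
    using A B by simp
  have "A * B * mat_adjoint (A * B) = A * (B * (mat_adjoint B * mat_adjoint A))"
    using A(1) B(1) by (simp add: mat_adjoint_mult[of _ n n _ n] assoc mult_carrier_mat[of _ n n _ n])
  also have "B * (mat_adjoint B * mat_adjoint A) = B * mat_adjoint B * mat_adjoint A"
    using A(1) B(1) by (intro assoc[symmetric]) auto
  finally have 2: "A * B * mat_adjoint (A * B) = 1\<^sub>m n"
    using A B by (simp add: left_mult_one_mat[of _ n n])
  show ?thesis using A B 1 2 by (simp add: unitary_mat_def)
qed

lemma unitary_mat_time_ordered_prod:
  "(\<And>s. s < k \<Longrightarrow> unitary_mat D (f s)) \<Longrightarrow> unitary_mat D (time_ordered_prod D f k)"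
proof (induction k)
  case 0
  have "mat_adjoint (1\<^sub>m D) = (1\<^sub>m D :: complex mat)" by (rule eq_matI) auto
  then show ?case by (simp add: unitary_mat_def)
qed (auto intro: unitary_mat_mult)

lemma op_bound_unitary: "unitary_mat n A \<Longrightarrow> op_bound A 1"
  by (rule op_boundI[of _ n n]) (auto simp: unitary_matD vec_norm2_isometry[of _ n n])

lemma frobenius_sq_adjoint: "frobenius_sq (mat_adjoint A) = frobenius_sq A"
  by (simp add: frobenius_sq_def sum.swap[of _ "{..<dim_col A}"])

lemma frobenius_sq_isometry:
  assumes "A \<in> carrier_mat n m" "mat_adjoint A * A = 1\<^sub>m m" "X \<in> carrier_mat m k"
  shows "frobenius_sq (A * X) = frobenius_sq X"
proof -
  have "col (A * X) j = A *\<^sub>v col X j" if "j < k" for j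
    using that assms by (intro col_mult2[of _ n m _ k]) auto
  then show ?thesis
    unfolding frobenius_sq_cols using assms
    by (auto intro!: sum.cong simp: vec_norm2_isometry[OF assms(1,2)])
qed

text \<open>The left factor is an isometry on the columns; the right factor is brought to the left
  by passing to adjoints, which keeps the Frobenius norm.\<close>

lemma frobenius_sq_unitary_conj:
  assumes "unitary_mat m S" "unitary_mat m T" "X \<in> carrier_mat m m"
  shows "frobenius_sq (S * X * mat_adjoint T) = frobenius_sq X"
proof -
  note S = unitary_matD[OF assms(1)] and T = unitary_matD[OF assms(2)]
  have "frobenius_sq (S * X * mat_adjoint T) = frobenius_sq (S * (X * mat_adjoint T))"
    using S(1) T(1) assms(3) by (simp add: assoc_mult_mat[of _ m m _ m _ m])
  also have "\<dots> = frobenius_sq (X * mat_adjoint T)"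
    using S T(1) assms(3) by (intro frobenius_sq_isometry[of _ m m _ m]) auto
  also have "\<dots> = frobenius_sq (T * mat_adjoint X)"
    using T(1) assms(3) frobenius_sq_adjoint[of "X * mat_adjoint T"]
    by (simp add: mat_adjoint_mult[of _ m m _ m])
  also have "\<dots> = frobenius_sq (mat_adjoint X)"
    using T assms(3) by (intro frobenius_sq_isometry[of _ m m _ m]) auto
  finally show ?thesis by (simp add: frobenius_sq_adjoint)
qed

section \<open>Splitting a noise at its largest singular value\<close>

lemma tensor_permute_index:
  assumes "a < q" "b < q" "c < q" "e < q"
  shows "tensor_permute q A $$ (a * q + c, b * q + e) = A $$ (a * q + b, c * q + e)"
  using assms pair_index_less[of a q c q] pair_index_less[of b q e q]
  by (simp add: tensor_permute_def power2_eq_square)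

lemma tensor_permute_carrier [simp]: "tensor_permute q A \<in> carrier_mat (q\<^sup>2) (q\<^sup>2)"
  by (simp add: tensor_permute_def)

text \<open>Entries are only moved around: written with four digits, the two middle sums are
  exchanged.\<close>

lemma frobenius_sq_tensor_permute:
  assumes "A \<in> carrier_mat (q\<^sup>2) (q\<^sup>2)"
  shows "frobenius_sq (tensor_permute q A) = frobenius_sq A"
proof -
  have "frobenius_sq (tensor_permute q A) =
      (\<Sum>a<q. \<Sum>c<q. \<Sum>b<q. \<Sum>e<q. (cmod (tensor_permute q A $$ (a * q + c, b * q + e)))\<^sup>2)"
    using tensor_permute_carrier[of q A]
    by (simp only: frobenius_sq_def carrier_matD power2_eq_square[of q] sum_pair_index)
  also have "\<dots> = (\<Sum>a<q. \<Sum>c<q. \<Sum>b<q. \<Sum>e<q. (cmod (A $$ (a * q + b, c * q + e)))\<^sup>2)"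
    by (intro sum.cong refl) (simp add: tensor_permute_index)
  also have "\<dots> = (\<Sum>a<q. \<Sum>b<q. \<Sum>c<q. \<Sum>e<q. (cmod (A $$ (a * q + b, c * q + e)))\<^sup>2)"
    by (intro sum.cong refl sum.swap)
  also have "\<dots> = frobenius_sq A"
    using assms by (simp add: frobenius_sq_def sum_pair_index power2_eq_square)
  finally show ?thesis .
qed

lemma tensor_permute_diff:
  assumes "A \<in> carrier_mat (q\<^sup>2) (q\<^sup>2)" "B \<in> carrier_mat (q\<^sup>2) (q\<^sup>2)"
  shows "tensor_permute q (A - B) = tensor_permute q A - tensor_permute q B"
proof (rule eq_matI)
  fix i j assume "i < dim_row (tensor_permute q A - tensor_permute q B)"
    "j < dim_col (tensor_permute q A - tensor_permute q B)"
  then have "i < q * q" "j < q * q" by (auto simp: tensor_permute_def power2_eq_square)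
  with assms show "tensor_permute q (A - B) $$ (i, j) = (tensor_permute q A - tensor_permute q B) $$ (i, j)"
    by (simp add: tensor_permute_def power2_eq_square pair_index_less div_less_of_less_mult
        mod_less_of_less_mult)
qed (auto simp: tensor_permute_def)

section \<open>Kronecker terms of a singular value decomposition\<close>

lemma svd_U_carrier [simp]: "svd_U q \<sigma> j \<in> carrier_mat q q"
  by (simp add: svd_U_def)

lemma svd_V_carrier [simp]: "svd_V q \<sigma> j \<in> carrier_mat q q"
  by (simp add: svd_V_def)

lemma kron_svd_carrier [simp]: "kron (svd_U q \<sigma> j) (svd_V q \<sigma> j) \<in> carrier_mat (q\<^sup>2) (q\<^sup>2)"
  unfolding power2_eq_square by (intro kron_carrier) auto

lemma dominant_term_carrier [simp]: "dominant_term q \<sigma> \<in> carrier_mat (q\<^sup>2) (q\<^sup>2)"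
  by (simp add: dominant_term_def)

lemma residual_term_carrier [simp]: "residual_term q \<sigma> \<in> carrier_mat (q\<^sup>2) (q\<^sup>2)"
  by (simp add: residual_term_def)

lemma is_svdD:
  assumes "is_svd m A \<sigma>"
  shows "unitary_mat m (left_vectors \<sigma>)" "unitary_mat m (right_vectors \<sigma>)"
    "\<And>j. j < m \<Longrightarrow> 0 \<le> sing_val \<sigma> j" "\<And>j. j < m \<Longrightarrow> sing_val \<sigma> j \<le> sing_val \<sigma> 0"
    "A = left_vectors \<sigma> * mat_diag m (\<lambda>j. complex_of_real (sing_val \<sigma> j)) * mat_adjoint (right_vectors \<sigma>)"
  using assms by (auto simp: is_svd_def)

lemma svd_form_index:
  assumes "S \<in> carrier_mat m m" "T \<in> carrier_mat m m" "i < m" "k < m"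
  shows "(S * mat_diag m d * mat_adjoint T) $$ (i, k) = (\<Sum>j<m. d j * S $$ (i, j) * cnj (T $$ (k, j)))"
proof -
  have "(S * mat_diag m d * mat_adjoint T) $$ (i, k) =
      (\<Sum>j<m. (S * mat_diag m d) $$ (i, j) * mat_adjoint T $$ (j, k))"
    using assms by (intro mult_mat_index[of _ m m _ m]) auto
  also have "\<dots> = (\<Sum>j<m. d j * S $$ (i, j) * cnj (T $$ (k, j)))"
    using assms by (intro sum.cong refl) (auto simp: mat_diag_mult_right)
  finally show ?thesis .
qed

text \<open>The left vectors see the digits \<open>(a, c)\<close> and the right ones
  \<open>(b, e)\<close>, exactly the row and column of the permuted matrix. The index set
  \<open>J\<close> is arbitrary so that one formula serves both the full sum and the
  residual.\<close>

lemma mat_sum_kron_svd_index: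
  assumes "unitary_mat (q\<^sup>2) (left_vectors \<sigma>)" "unitary_mat (q\<^sup>2) (right_vectors \<sigma>)"
    and "a < q" "b < q" "c < q" "e < q"
  shows "mat_sum (q\<^sup>2) (\<lambda>j. kron (svd_U q \<sigma> j) (svd_V q \<sigma> j)) J $$ (a * q + b, c * q + e) =
    (\<Sum>j\<in>J. complex_of_real (sing_val \<sigma> j) * left_vectors \<sigma> $$ (a * q + c, j) *
      cnj (right_vectors \<sigma> $$ (b * q + e, j)))"
proof -
  have "mat_sum (q\<^sup>2) (\<lambda>j. kron (svd_U q \<sigma> j) (svd_V q \<sigma> j)) J $$ (a * q + b, c * q + e) =
      (\<Sum>j\<in>J. kron (svd_U q \<sigma> j) (svd_V q \<sigma> j) $$ (a * q + b, c * q + e))"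
    using assms by (intro mat_sum_index) (auto simp: pair_index_less power2_eq_square)
  also have "\<dots> = (\<Sum>j\<in>J. svd_U q \<sigma> j $$ (a, c) * svd_V q \<sigma> j $$ (b, e))"
    using assms by (intro sum.cong refl kron_index_pair[of _ q q]) auto
  finally show ?thesis using assms by (simp add: svd_U_def svd_V_def)
qed

text \<open>The operator-Schmidt decomposition: a rank-one summand of the permuted matrix turns into
  a Kronecker product once the permutation is undone.\<close>

lemma kron_svd_sum:
  assumes svd: "is_svd (q\<^sup>2) (tensor_permute q M) \<sigma>" and M: "M \<in> carrier_mat (q\<^sup>2) (q\<^sup>2)"
  shows "mat_sum (q\<^sup>2) (\<lambda>j. kron (svd_U q \<sigma> j) (svd_V q \<sigma> j)) {..<q\<^sup>2} = M"
proof (rule eq_matI)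
  fix i k assume "i < dim_row M" "k < dim_col M"
  with M have ik: "i < q * q" "k < q * q" by (auto simp: power2_eq_square)
  define a b c e where "a = i div q" "b = i mod q" "c = k div q" "e = k mod q"
  with ik have le: "a < q" "b < q" "c < q" "e < q"
    by (auto simp: div_less_of_less_mult mod_less_of_less_mult)
  have i: "i = a * q + b" and k: "k = c * q + e" by (simp_all add: a_b_c_e_def)
  note S = is_svdD[OF svd]
  show "mat_sum (q\<^sup>2) (\<lambda>j. kron (svd_U q \<sigma> j) (svd_V q \<sigma> j)) {..<q\<^sup>2} $$ (i, k) = M $$ (i, k)"
    unfolding i k mat_sum_kron_svd_index[OF S(1,2) le]
    unfolding tensor_permute_index[OF le, symmetric] S(5)
    using le unitary_matD(1)[OF S(1)] unitary_matD(1)[OF S(2)]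
    by (intro svd_form_index[symmetric]) (auto simp: pair_index_less power2_eq_square)
qed (use M in auto)

lemma dominant_plus_residual:
  assumes svd: "is_svd (q\<^sup>2) (tensor_permute q M) \<sigma>" and M: "M \<in> carrier_mat (q\<^sup>2) (q\<^sup>2)" and q: "0 < q"
  shows "dominant_term q \<sigma> + residual_term q \<sigma> = M"
proof -
  \<comment> \<open>Positivity of \<open>q\<close> puts the index 0 into the range.\<close>
  have split: "{..<q\<^sup>2} = insert 0 {1..q\<^sup>2 - 1}" using q by auto
  have "mat_sum (q\<^sup>2) (\<lambda>j. kron (svd_U q \<sigma> j) (svd_V q \<sigma> j)) {..<q\<^sup>2} =
      dominant_term q \<sigma> + residual_term q \<sigma>"
    unfolding split residual_term_def dominant_term_def
    by (rule eq_matI) (auto simp: svd_U_def svd_V_def power2_eq_square)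
  then show ?thesis using kron_svd_sum[OF svd M] by simp
qed

text \<open>Dropping the dominant term amounts to replacing the leading singular value by 0 in the
  same decomposition, so the Frobenius norm of the residual can be read off a diagonal.\<close>

lemma tensor_permute_residual:
  assumes svd: "is_svd (q\<^sup>2) (tensor_permute q M) \<sigma>"
  shows "tensor_permute q (residual_term q \<sigma>) = left_vectors \<sigma> *
    mat_diag (q\<^sup>2) (\<lambda>j. if j = 0 then 0 else complex_of_real (sing_val \<sigma> j)) * mat_adjoint (right_vectors \<sigma>)"
    (is "?L = ?R")
proof (rule eq_matI)
  note S = is_svdD[OF svd] and SC = unitary_matD(1)[OF is_svdD(1)[OF svd]] unitary_matD(1)[OF is_svdD(2)[OF svd]]
  fix i k assume "i < dim_row ?R" "k < dim_col ?R"
  with SC have ik: "i < q * q" "k < q * q" by (auto simp: power2_eq_square)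
  define a c b e where "a = i div q" "c = i mod q" "b = k div q" "e = k mod q"
  with ik have le: "a < q" "b < q" "c < q" "e < q"
    by (auto simp: div_less_of_less_mult mod_less_of_less_mult)
  have i: "i = a * q + c" and k: "k = b * q + e" by (simp_all add: a_c_b_e_def)
  have "?R $$ (i, k) = (\<Sum>j<q\<^sup>2. (if j = 0 then 0 else complex_of_real (sing_val \<sigma> j)) *
      left_vectors \<sigma> $$ (i, j) * cnj (right_vectors \<sigma> $$ (k, j)))"
    using SC ik by (intro svd_form_index) (auto simp: power2_eq_square)
  also have "\<dots> = (\<Sum>j = 1..q\<^sup>2 - 1. complex_of_real (sing_val \<sigma> j) *
      left_vectors \<sigma> $$ (i, j) * cnj (right_vectors \<sigma> $$ (k, j)))"
    by (intro sum.mono_neutral_cong_right) auto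
  also have "\<dots> = ?L $$ (i, k)"
    unfolding i k tensor_permute_index[OF le] residual_term_def mat_sum_kron_svd_index[OF S(1,2) le] ..
  finally show "?L $$ (i, k) = ?R $$ (i, k)" ..
qed (use unitary_matD(1)[OF is_svdD(1)[OF svd]] unitary_matD(1)[OF is_svdD(2)[OF svd]]
    in \<open>auto simp: tensor_permute_def\<close>)

section \<open>Best rank-one approximation in the Frobenius norm\<close>

lemma frobenius_sq_mat_diag: "frobenius_sq (mat_diag m f) = (\<Sum>j<m. (cmod (f j))\<^sup>2)"
proof -
  have "frobenius_sq (mat_diag m f) = (\<Sum>i<m. \<Sum>j<m. if i = j then (cmod (f j))\<^sup>2 else 0)"
    unfolding frobenius_sq_def by (intro sum.cong) (auto simp: mat_diag_def)
  then show ?thesis by simp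
qed

text \<open>The Eckart-Young bound for approximations of rank one.\<close>

lemma frobenius_sq_diag_minus_rank_one:
  fixes d :: "nat \<Rightarrow> real"
  assumes d: "\<And>j. j < m \<Longrightarrow> 0 \<le> d j \<and> d j \<le> d 0"
    and x: "x \<in> carrier_vec m" and y: "y \<in> carrier_vec m" and m: "0 < m"
  shows "(\<Sum>j = 1..m - 1. (d j)\<^sup>2) \<le>
    frobenius_sq (mat_diag m (\<lambda>j. complex_of_real (d j)) - mat m m (\<lambda>(i, j). x $ i * cnj (y $ j)))"
proof -
  define X Y where "X = vec_norm2 x" and "Y = vec_norm2 y"
  have entry: "(cmod (complex_of_real r - z))\<^sup>2 = r\<^sup>2 - 2 * r * Re z + (cmod z)\<^sup>2" for r z
    unfolding cmod_power2 by (simp add: power2_eq_square algebra_simps)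
  \<comment> \<open>The diagonal matrix meets the rank-one matrix on the diagonal only, which gives
    a single cross term; the rank-one matrix by itself contributes the product of the two squared
    lengths.\<close>
  have F: "frobenius_sq (mat_diag m (\<lambda>j. complex_of_real (d j)) - mat m m (\<lambda>(i, j). x $ i * cnj (y $ j))) =
      (\<Sum>i<m. \<Sum>j<m. (if i = j then (d j)\<^sup>2 - 2 * d j * Re (x $ j * cnj (y $ j)) else 0) +
        (cmod (x $ i))\<^sup>2 * (cmod (y $ j))\<^sup>2)"
    unfolding frobenius_sq_def
    by (intro sum.cong refl) (auto simp: mat_diag_def entry norm_mult power_mult_distrib)
  also have "\<dots> = (\<Sum>j<m. (d j)\<^sup>2) - 2 * (\<Sum>j<m. d j * Re (x $ j * cnj (y $ j))) +
      (\<Sum>i<m. \<Sum>j<m. (cmod (x $ i))\<^sup>2 * (cmod (y $ j))\<^sup>2)"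
    by (simp add: sum.distrib sum_subtractf sum_distrib_left mult.assoc)
  also have "(\<Sum>i<m. \<Sum>j<m. (cmod (x $ i))\<^sup>2 * (cmod (y $ j))\<^sup>2) = X\<^sup>2 * Y\<^sup>2"
    unfolding X_def Y_def vec_norm2_sq using x y by (simp only: carrier_vecD sum_product)
  finally have F: "frobenius_sq (mat_diag m (\<lambda>j. complex_of_real (d j)) - mat m m (\<lambda>(i, j). x $ i * cnj (y $ j))) =
    (\<Sum>j<m. (d j)\<^sup>2) - 2 * (\<Sum>j<m. d j * Re (x $ j * cnj (y $ j))) + X\<^sup>2 * Y\<^sup>2" .
  \<comment> \<open>Maximality of \<open>d 0\<close> followed by Cauchy-Schwarz bounds the cross
    term.\<close>
  have "(\<Sum>j<m. d j * Re (x $ j * cnj (y $ j))) \<le> (\<Sum>j<m. d 0 * (\<bar>cmod (x $ j)\<bar> * \<bar>cmod (y $ j)\<bar>))"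
  proof (rule sum_mono)
    fix j assume "j \<in> {..<m}"
    then have j: "0 \<le> d j" "d j \<le> d 0" using d by auto
    have "Re (x $ j * cnj (y $ j)) \<le> \<bar>cmod (x $ j)\<bar> * \<bar>cmod (y $ j)\<bar>"
      using complex_Re_le_cmod[of "x $ j * cnj (y $ j)"] by (simp add: norm_mult)
    then have "d j * Re (x $ j * cnj (y $ j)) \<le> d j * (\<bar>cmod (x $ j)\<bar> * \<bar>cmod (y $ j)\<bar>)"
      using j(1) by (rule mult_left_mono)
    also have "\<dots> \<le> d 0 * (\<bar>cmod (x $ j)\<bar> * \<bar>cmod (y $ j)\<bar>)"
      using j(2) by (rule mult_right_mono) auto
    finally show "d j * Re (x $ j * cnj (y $ j)) \<le> d 0 * (\<bar>cmod (x $ j)\<bar> * \<bar>cmod (y $ j)\<bar>)" .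
  qed
  also have "\<dots> \<le> d 0 * (X * Y)"
    unfolding sum_distrib_left[symmetric] X_def Y_def vec_norm2_eq_L2_set
    using d[OF m] x y L2_set_mult_ineq[of "\<lambda>j. cmod (x $ j)" "\<lambda>j. cmod (y $ j)" "{..<m}"]
    by (intro mult_left_mono) auto
  finally have c: "(\<Sum>j<m. d j * Re (x $ j * cnj (y $ j))) \<le> d 0 * (X * Y)" .
  have "{..<m} = insert 0 {1..m - 1}" using m by auto
  then have "(\<Sum>j<m. (d j)\<^sup>2) = (d 0)\<^sup>2 + (\<Sum>j = 1..m - 1. (d j)\<^sup>2)" by simp
  \<comment> \<open>Completing the square: whatever the value of \<open>X * Y\<close>, the cross
    term and the last term together take away at most the square of \<open>d 0\<close>.\<close>
  moreover have "0 \<le> (d 0 - X * Y)\<^sup>2" by simp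
  then have "2 * (d 0 * (X * Y)) \<le> (d 0)\<^sup>2 + X\<^sup>2 * Y\<^sup>2"
    by (simp add: power2_eq_square algebra_simps)
  ultimately show ?thesis unfolding F using c by linarith
qed

text \<open>The identity matrix flattened to a vector, that is, the unnormalised maximally entangled
  vector.\<close>

definition identity_vec :: "nat \<Rightarrow> complex vec" where
  "identity_vec q = vec (q\<^sup>2) (\<lambda>i. if i div q = i mod q then 1 else 0)"

text \<open>An entry of the identity is the product of the deltas for \<open>a = c\<close> and
  \<open>b = e\<close>. The permutation collects one delta in the row index and the other in the
  column index, which leaves rank one.\<close>

lemma tensor_permute_one:
  "tensor_permute q (1\<^sub>m (q\<^sup>2)) = mat (q\<^sup>2) (q\<^sup>2) (\<lambda>(i, j). identity_vec q $ i * cnj (identity_vec q $ j))"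
proof (rule eq_matI)
  fix i j assume "i < dim_row (mat (q\<^sup>2) (q\<^sup>2) (\<lambda>(i, j). identity_vec q $ i * cnj (identity_vec q $ j)))"
    "j < dim_col (mat (q\<^sup>2) (q\<^sup>2) (\<lambda>(i, j). identity_vec q $ i * cnj (identity_vec q $ j)))"
  then have ij: "i < q * q" "j < q * q" by (auto simp: power2_eq_square)
  then have q: "0 < q" by (cases q) auto
  have lt: "i div q < q" "i mod q < q" "j div q < q" "j mod q < q"
    using ij q by (simp_all add: div_less_of_less_mult)
  have "(i div q) * q + j div q = (i mod q) * q + j mod q \<longleftrightarrow> i div q = i mod q \<and> j div q = j mod q"
    using pair_index_div_mod[OF lt(3), of "i div q"] pair_index_div_mod[OF lt(4), of "i mod q"] by metis
  moreover have "tensor_permute q (1\<^sub>m (q\<^sup>2)) $$ (i, j) =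
      (if (i div q) * q + j div q = (i mod q) * q + j mod q then 1 else 0)"
    using ij pair_index_less[OF lt(1,3)] pair_index_less[OF lt(2,4)]
    by (simp add: tensor_permute_def power2_eq_square)
  moreover have "mat (q\<^sup>2) (q\<^sup>2) (\<lambda>(i, j). identity_vec q $ i * cnj (identity_vec q $ j)) $$ (i, j) =
      (if i div q = i mod q \<and> j div q = j mod q then 1 else 0)"
    using ij by (simp add: identity_vec_def power2_eq_square)
  ultimately show "tensor_permute q (1\<^sub>m (q\<^sup>2)) $$ (i, j) =
      mat (q\<^sup>2) (q\<^sup>2) (\<lambda>(i, j). identity_vec q $ i * cnj (identity_vec q $ j)) $$ (i, j)"
    by presburger
qed (auto simp: tensor_permute_def)

text \<open>The permuted identity has rank one, so it can be no closer to the permuted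
  \<open>M\<close> than the truncated decomposition is. The unitary factors and the permutation
  leave all Frobenius norms in this comparison unchanged.\<close>

lemma frobenius_sq_residual_le:
  assumes svd: "is_svd (q\<^sup>2) (tensor_permute q M) \<sigma>" and M: "M \<in> carrier_mat (q\<^sup>2) (q\<^sup>2)" and q: "0 < q"
  shows "frobenius_sq (residual_term q \<sigma>) \<le> frobenius_sq (M - 1\<^sub>m (q\<^sup>2))"
proof -
  define m where "m = q\<^sup>2"
  define S T where "S = left_vectors \<sigma>" and "T = right_vectors \<sigma>"
  define d where "d = (\<lambda>j. complex_of_real (sing_val \<sigma> j))"
  have U: "unitary_mat m S" "unitary_mat m T" and dm: "\<And>j. j < m \<Longrightarrow> 0 \<le> sing_val \<sigma> j \<and> sing_val \<sigma> j \<le> sing_val \<sigma> 0"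
    and tM: "tensor_permute q M = S * mat_diag m d * mat_adjoint T"
    using is_svdD[OF svd] unfolding S_def T_def m_def d_def by blast+
  note S = unitary_matD[OF U(1)] and T = unitary_matD[OF U(2)]
  have m: "0 < m" using q by (simp add: m_def)
  define w where "w = identity_vec q"
  have w: "w \<in> carrier_vec m" by (simp add: w_def identity_vec_def m_def)
  \<comment> \<open>The coordinates of the identity vector in the two singular bases, chosen so that
    \<open>S\<close> and \<open>T\<close> carry the rank-one matrix \<open>R\<close> to the permuted
    identity.\<close>
  define x y where "x = mat_adjoint S *\<^sub>v w" and "y = mat_adjoint T *\<^sub>v w"
  have xy: "x \<in> carrier_vec m" "y \<in> carrier_vec m"
    unfolding x_def y_def using S(1) T(1) w
    by (intro mult_mat_vec_carrier[of _ m m] mat_adjoint_carrier; simp)+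
  define R where "R = mat m m (\<lambda>(i, j). x $ i * cnj (y $ j))"
  have "S *\<^sub>v x = (S * mat_adjoint S) *\<^sub>v w" "T *\<^sub>v y = (T * mat_adjoint T) *\<^sub>v w"
    unfolding x_def y_def using S(1) T(1) w
    by (intro assoc_mult_mat_vec[of _ m m _ m, symmetric] mat_adjoint_carrier; simp)+
  then have Sx: "S *\<^sub>v x = w" and Ty: "T *\<^sub>v y = w"
    using S(3) T(3) w by simp_all
  have R: "S * R * mat_adjoint T = tensor_permute q (1\<^sub>m (q\<^sup>2))"
  proof (rule eq_matI)
    fix i k assume "i < dim_row (tensor_permute q (1\<^sub>m (q\<^sup>2)))" "k < dim_col (tensor_permute q (1\<^sub>m (q\<^sup>2)))"
    then have ik: "i < m" "k < m" by (auto simp: tensor_permute_def m_def)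
    have SR: "S * R \<in> carrier_mat m m" using S by (simp add: R_def)
    have "(S * R * mat_adjoint T) $$ (i, k) = (\<Sum>j<m. (S * R) $$ (i, j) * mat_adjoint T $$ (j, k))"
      using ik T by (intro mult_mat_index[OF SR]) auto
    also have "\<dots> = (\<Sum>j<m. (\<Sum>l<m. S $$ (i, l) * x $ l) * (cnj (y $ j) * cnj (T $$ (k, j))))"
    proof (intro sum.cong refl)
      fix j assume "j \<in> {..<m}"
      then have j: "j < m" by simp
      have "(S * R) $$ (i, j) = (\<Sum>l<m. S $$ (i, l) * R $$ (l, j))"
        using ik j S by (intro mult_mat_index[of _ m m _ m]) (auto simp: R_def)
      also have "\<dots> = (\<Sum>l<m. S $$ (i, l) * x $ l) * cnj (y $ j)"
        using j by (simp add: R_def sum_distrib_right mult.assoc)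
      finally show "(S * R) $$ (i, j) * mat_adjoint T $$ (j, k) =
          (\<Sum>l<m. S $$ (i, l) * x $ l) * (cnj (y $ j) * cnj (T $$ (k, j)))"
        using j ik T(1) by (simp add: mult.assoc)
    qed
    also have "\<dots> = (\<Sum>l<m. S $$ (i, l) * x $ l) * (\<Sum>j<m. cnj (y $ j) * cnj (T $$ (k, j)))"
      by (rule sum_distrib_left[symmetric])
    also have "\<dots> = (S *\<^sub>v x) $ i * cnj ((T *\<^sub>v y) $ k)"
      using ik S T xy
      by (simp add: mult_mat_vec_index[of _ m m] mult.commute del: index_mult_mat_vec)
    also have "\<dots> = tensor_permute q (1\<^sub>m (q\<^sup>2)) $$ (i, k)"
      unfolding Sx Ty tensor_permute_one using ik by (simp add: w_def m_def)
    finally show "(S * R * mat_adjoint T) $$ (i, k) = tensor_permute q (1\<^sub>m (q\<^sup>2)) $$ (i, k)" .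
  qed (use S T in \<open>auto simp: tensor_permute_def m_def\<close>)
  have Rc: "R \<in> carrier_mat m m" by (simp add: R_def)
  have "tensor_permute q (residual_term q \<sigma>) =
      S * mat_diag m (\<lambda>j. if j = 0 then 0 else d j) * mat_adjoint T"
    unfolding S_def T_def m_def d_def by (rule tensor_permute_residual[OF svd])
  then have "frobenius_sq (residual_term q \<sigma>) =
      frobenius_sq (mat_diag m (\<lambda>j. if j = 0 then 0 else d j))"
    using frobenius_sq_unitary_conj[OF U, of "mat_diag m (\<lambda>j. if j = 0 then 0 else d j)"]
      frobenius_sq_tensor_permute[of "residual_term q \<sigma>" q]
    by simp
  also have "\<dots> = (\<Sum>j = 1..m - 1. (sing_val \<sigma> j)\<^sup>2)"
    unfolding frobenius_sq_mat_diag by (intro sum.mono_neutral_cong_right) (auto simp: d_def)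
  \<comment> \<open>Eckart-Young in singular coordinates, with \<open>R\<close> as the
    competitor.\<close>
  also have "\<dots> \<le> frobenius_sq (mat_diag m d - R)"
    unfolding d_def R_def using dm xy m by (rule frobenius_sq_diag_minus_rank_one)
  also have "\<dots> = frobenius_sq (S * (mat_diag m d - R) * mat_adjoint T)"
    using Rc by (intro frobenius_sq_unitary_conj[OF U, symmetric]) auto
  also have "S * (mat_diag m d - R) * mat_adjoint T = tensor_permute q M - tensor_permute q (1\<^sub>m (q\<^sup>2))"
  proof -
    have "S * (mat_diag m d - R) * mat_adjoint T = (S * mat_diag m d - S * R) * mat_adjoint T"
      using S Rc by (simp add: mult_minus_distrib_mat[of _ m m _ m])
    also have "\<dots> = S * mat_diag m d * mat_adjoint T - S * R * mat_adjoint T"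
      using S(1) T(1) Rc by (intro minus_mult_distrib_mat[of _ m m _ _ m]) auto
    finally show ?thesis using tM R by simp
  qed
  also have "frobenius_sq \<dots> = frobenius_sq (M - 1\<^sub>m (q\<^sup>2))"
    unfolding tensor_permute_diff[OF M one_carrier_mat, symmetric]
    by (intro frobenius_sq_tensor_permute minus_carrier_mat one_carrier_mat)
  finally show ?thesis .
qed

text \<open>The two norms are exchanged twice: the deviation from the identity enters with its
  operator norm, at the price of \<open>q\<close>, while the Frobenius norm of the residual bounds
  its operator norm for free.\<close>

lemma op_bound_residual:
  assumes svd: "is_svd (q\<^sup>2) (tensor_permute q M) \<sigma>" and M: "M \<in> carrier_mat (q\<^sup>2) (q\<^sup>2)" and q: "0 < q"
    and p: "op_bound (M - 1\<^sub>m (q\<^sup>2)) p" "0 \<le> p"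
  shows "op_bound (residual_term q \<sigma>) (real q * p)"
proof -
  have "frobenius_sq (residual_term q \<sigma>) \<le> real (q\<^sup>2) * p\<^sup>2"
    using frobenius_sq_residual_le[OF svd M q] frobenius_sq_le[OF minus_carrier_mat[OF one_carrier_mat] p(1)]
    by simp
  also have "\<dots> = (real q * p)\<^sup>2" by (simp add: power_mult_distrib)
  finally have "sqrt (frobenius_sq (residual_term q \<sigma>)) \<le> real q * p"
    using p(2) by (intro real_le_lsqrt) auto
  then show ?thesis using op_bound_frobenius op_bound_mono by blast
qed

text \<open>The triangle inequality for the identity, plus the deviation of the noise from it, minus
  the residual.\<close>

lemma op_bound_dominant:
  assumes svd: "is_svd (q\<^sup>2) (tensor_permute q M) \<sigma>" and M: "M \<in> carrier_mat (q\<^sup>2) (q\<^sup>2)" and q: "0 < q"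
    and p: "op_bound (M - 1\<^sub>m (q\<^sup>2)) p" "0 \<le> p"
  shows "op_bound (dominant_term q \<sigma>) (1 + (p + real q * p))"
proof -
  let ?R = "residual_term q \<sigma>"
  have "dominant_term q \<sigma> = 1\<^sub>m (q\<^sup>2) + ((M - 1\<^sub>m (q\<^sup>2)) + - ?R)"
    unfolding dominant_plus_residual[OF svd M q, symmetric]
    by (rule eq_matI) (auto simp: dominant_term_def residual_term_def svd_U_def svd_V_def power2_eq_square)
  moreover have "op_bound (1\<^sub>m (q\<^sup>2) + ((M - 1\<^sub>m (q\<^sup>2)) + - ?R)) (1 + (p + real q * p))"
    using p op_bound_residual[OF svd M q p]
    by (intro op_bound_add[of _ "q\<^sup>2" "q\<^sup>2"] op_bound_one op_bound_uminus[of _ "q\<^sup>2" "q\<^sup>2"]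
        minus_carrier_mat one_carrier_mat add_carrier_mat uminus_carrier_mat residual_term_carrier)
  ultimately show ?thesis by simp
qed

section \<open>Embedding local operators\<close>

lemma embed_carrier [simp]: "embed n qs A \<in> carrier_mat (2 ^ n) (2 ^ n)"
  by (simp add: embed_def)

lemma embed_dim [simp]: "dim_row (embed n qs A) = 2 ^ n" "dim_col (embed n qs A) = 2 ^ n"
  by (simp_all add: embed_def)

lemma embed_index:
  "i < 2 ^ n \<Longrightarrow> j < 2 ^ n \<Longrightarrow> embed n qs A $$ (i, j) =
    (if \<forall>k<n. k \<notin> set qs \<longrightarrow> bit i k = bit j k then A $$ (local_index qs i, local_index qs j) else 0)"
  by (simp add: embed_def)

lemma embed_doubled_carrier [simp]: "embed_doubled n qs M \<in> carrier_mat (2 ^ (2 * n)) (2 ^ (2 * n))"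
  by (simp add: embed_doubled_def)

lemma local_index_less: "local_index qs i < 2 ^ length qs"
  using horner_sum_of_bool_2_less[of "map (bit i) (rev qs)"] by (simp add: local_index_def)

lemma bit_local_index: "bit (local_index qs i) k \<longleftrightarrow> k < length qs \<and> bit i (rev qs ! k)"
  by (auto simp: local_index_def bit_horner_sum_bit_iff)

lemma not_bit_of_less_power: "i < 2 ^ n \<Longrightarrow> n \<le> k \<Longrightarrow> \<not> bit (i :: nat) k"
  by (metis bit_take_bit_iff not_less take_bit_nat_eq_self)

text \<open>The label of the block to which an index belongs: \<open>embed\<close> has nonzero
  entries only between indices with equal labels.\<close>

definition other_bits :: "nat \<Rightarrow> nat list \<Rightarrow> nat \<Rightarrow> nat set" where
  "other_bits n qs i = {k. k < n \<and> k \<notin> set qs \<and> bit i k}"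

lemma other_bits_eq_iff:
  "other_bits n qs i = other_bits n qs j \<longleftrightarrow> (\<forall>k<n. k \<notin> set qs \<longrightarrow> bit i k = bit j k)"
  by (auto simp: other_bits_def)

text \<open>The bits outside \<open>qs\<close> and the local digits together fix every bit, hence
  injectivity; surjectivity follows by counting, since both sides have 2^n elements.\<close>

lemma bij_betw_other_bits_local_index:
  assumes "distinct qs" "set qs \<subseteq> {..<n}"
  shows "bij_betw (\<lambda>i. (other_bits n qs i, local_index qs i)) {..<2 ^ n}
    (Pow ({..<n} - set qs) \<times> {..<2 ^ length qs})"
proof -
  let ?f = "\<lambda>i. (other_bits n qs i, local_index qs i)"
  let ?T = "Pow ({..<n} - set qs) \<times> {..<(2::nat) ^ length qs}"
  have inj: "inj_on ?f {..<2 ^ n}"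
  proof (rule inj_onI)
    fix i j :: nat assume ij: "i \<in> {..<2 ^ n}" "j \<in> {..<2 ^ n}" and eq: "?f i = ?f j"
    show "i = j"
    proof (rule bit_eqI)
      fix k
      consider "n \<le> k" | "k < n" "k \<notin> set qs" | "k \<in> set qs" by fastforce
      then show "bit i k = bit j k"
      proof cases
        case 1
        then show ?thesis using ij not_bit_of_less_power by simp
      next
        case 2
        then show ?thesis using eq by (simp add: other_bits_eq_iff)
      next
        case 3
        \<comment> \<open>Bit \<open>l\<close> of the local index is the qubit
          \<open>rev qs ! l\<close>, because \<open>horner_sum\<close> starts at the least
          significant digit.\<close>
        then have "k \<in> set (rev qs)" by simp
        then obtain l where l: "l < length (rev qs)" "rev qs ! l = k"
          by (auto simp only: in_set_conv_nth)
        then have "bit (local_index qs i) l = bit (local_index qs j) l" using eq by simp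
        then show ?thesis using l by (simp add: bit_local_index)
      qed
    qed
  qed
  have sub: "?f ` {..<2 ^ n} \<subseteq> ?T"
    by (auto simp: other_bits_def local_index_less)
  have len: "card (set qs) = length qs" using assms(1) by (rule distinct_card)
  then have "length qs \<le> n" using card_mono[OF _ assms(2)] by simp
  then have "card ?T = 2 ^ n"
    using assms len by (simp add: card_cartesian_product card_Pow card_Diff_subset power_add[symmetric])
  then have "?f ` {..<2 ^ n} = ?T"
    using inj by (intro card_subset_eq[OF _ sub]) (auto simp: card_image)
  with inj show ?thesis by (simp add: bij_betw_def)
qed

text \<open>Sorted by the outside bits, the embedded operator is block diagonal with a copy of
  \<open>A\<close> in every block, and squared lengths add over the blocks.\<close>

lemma op_bound_embed:
  assumes qs: "distinct qs" "set qs \<subseteq> {..<n}"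
    and A: "A \<in> carrier_mat (2 ^ length qs) (2 ^ length qs)" "op_bound A c" "0 \<le> c"
  shows "op_bound (embed n qs A) c"
proof (rule op_boundI[OF embed_carrier])
  fix v :: "complex vec" assume v: "v \<in> carrier_vec (2 ^ n)"
  define q :: nat where "q = 2 ^ length qs"
  define R where "R = Pow ({..<n} - set qs)"
  let ?f = "\<lambda>i. (other_bits n qs i, local_index qs i)"
  \<comment> \<open>\<open>g (r, a)\<close> is the index with outside bits \<open>r\<close> and
    local index \<open>a\<close>; the block of \<open>v\<close> labelled \<open>r\<close> will be
    \<open>w r\<close>.\<close>
  define g where "g = inv_into {..<2 ^ n} ?f"
  have bij: "bij_betw ?f {..<2 ^ n} (R \<times> {..<q})"
    unfolding R_def q_def by (rule bij_betw_other_bits_local_index[OF qs])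
  have bij_g: "bij_betw g (R \<times> {..<q}) {..<2 ^ n}"
    unfolding g_def by (rule bij_betw_inv_into[OF bij])
  have g: "g (r, a) < 2 ^ n" "other_bits n qs (g (r, a)) = r" "local_index qs (g (r, a)) = a"
    if "r \<in> R" "a < q" for r a
    using bij_betwE[OF bij_g] bij_betw_inv_into_right[OF bij, of "(r, a)"] that by (auto simp: g_def)
  have sum_g: "(\<Sum>i<2 ^ n. h i) = (\<Sum>r\<in>R. \<Sum>a<q. h (g (r, a)))" for h :: "nat \<Rightarrow> 'b :: comm_monoid_add"
    unfolding sum.cartesian_product sum.reindex_bij_betw[OF bij_g, symmetric] by (simp add: split_def)
  have fin: "finite R" by (simp add: R_def)
  define w where "w r = vec q (\<lambda>b. v $ g (r, b))" for r
  have w: "w r \<in> carrier_vec q" for r by (simp add: w_def)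
  have entry: "(embed n qs A *\<^sub>v v) $ g (r, a) = (A *\<^sub>v w r) $ a" if ra: "r \<in> R" "a < q" for r a
  proof -
    have "(embed n qs A *\<^sub>v v) $ g (r, a) = (\<Sum>j<2 ^ n. embed n qs A $$ (g (r, a), j) * v $ j)"
      using v g(1)[OF ra] by (intro mult_mat_vec_index[of _ "2 ^ n"]) auto
    also have "\<dots> = (\<Sum>r'\<in>R. \<Sum>b<q. if r' = r then A $$ (a, b) * v $ g (r', b) else 0)"
      unfolding sum_g using ra
      by (intro sum.cong refl) (auto simp: embed_index g other_bits_eq_iff[symmetric])
    also have "\<dots> = (\<Sum>r'\<in>R. if r' = r then \<Sum>b<q. A $$ (a, b) * v $ g (r', b) else 0)"
      by (intro sum.cong refl) auto
    also have "\<dots> = (\<Sum>b<q. A $$ (a, b) * w r $ b)"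
      using fin ra by (simp add: w_def)
    also have "\<dots> = (A *\<^sub>v w r) $ a"
      using A(1) w ra unfolding q_def[symmetric] by (intro mult_mat_vec_index[symmetric]) auto
    finally show ?thesis .
  qed
  have "(vec_norm2 (embed n qs A *\<^sub>v v))\<^sup>2 = (\<Sum>r\<in>R. \<Sum>a<q. (cmod ((embed n qs A *\<^sub>v v) $ g (r, a)))\<^sup>2)"
    by (simp add: vec_norm2_sq sum_g del: index_mult_mat_vec)
  also have "\<dots> = (\<Sum>r\<in>R. (vec_norm2 (A *\<^sub>v w r))\<^sup>2)"
    unfolding vec_norm2_sq using A(1) by (intro sum.cong) (auto simp: entry q_def[symmetric] simp del: index_mult_mat_vec)
  also have "\<dots> \<le> (\<Sum>r\<in>R. (c * vec_norm2 (w r))\<^sup>2)"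
    using A w unfolding q_def[symmetric] by (intro sum_mono power_mono op_boundD[of A c q q]) auto
  also have "\<dots> = (c * vec_norm2 v)\<^sup>2"
    using v by (simp add: power_mult_distrib vec_norm2_sq sum_g w_def sum_distrib_left)
  finally show "vec_norm2 (embed n qs A *\<^sub>v v) \<le> c * vec_norm2 v"
    by (rule power2_le_imp_le) (simp add: A(3))
qed

lemma op_bound_embed_doubled:
  assumes "distinct qs" "set qs \<subseteq> {..<n}" "M \<in> carrier_mat ((2 ^ length qs)\<^sup>2) ((2 ^ length qs)\<^sup>2)"
    "op_bound M c" "0 \<le> c"
  shows "op_bound (embed_doubled n qs M) c"
  unfolding embed_doubled_def using assms
  by (intro op_bound_embed) (auto simp: distinct_map power_add power2_eq_square)

section \<open>The doubled embedding and Kronecker products\<close>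

lemma bit_div_power: "bit (i div 2 ^ n) k = bit (i :: nat) (n + k)"
  by (metis bit_drop_bit_eq comp_apply drop_bit_eq_div)

lemma bit_mod_power: "bit (i mod 2 ^ n) k \<longleftrightarrow> k < n \<and> bit (i :: nat) k"
  by (metis bit_take_bit_iff take_bit_eq_mod)

lemma local_index_cong:
  "(\<And>k. k \<in> set qs \<Longrightarrow> bit i k = bit j k) \<Longrightarrow> local_index qs i = local_index qs j"
  unfolding local_index_def by (intro arg_cong[of _ _ "horner_sum of_bool 2"]) auto

text \<open>The qubits of the first copy head the list and so give the high digits; they are the
  bits from \<open>n\<close> upwards, which is what the quotient by 2^n reads.\<close>

lemma local_index_doubled:
  assumes "set qs \<subseteq> {..<n}"
  shows "local_index (map ((+) n) qs @ qs) i =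
    local_index qs (i div 2 ^ n) * 2 ^ length qs + local_index qs (i mod 2 ^ n)"
proof -
  have "map (bit i) (rev (map ((+) n) qs)) = map (bit (i div 2 ^ n)) (rev qs)"
    by (simp add: rev_map bit_div_power)
  moreover have "local_index qs (i mod 2 ^ n) = local_index qs i"
    using assms by (intro local_index_cong) (auto simp: bit_mod_power)
  ultimately show ?thesis
    by (simp add: local_index_def horner_sum_append)
qed

text \<open>Bits below \<open>n\<close> belong to the second copy and those from \<open>n\<close> on
  to the first, so agreement outside the doubled support splits copy by copy.\<close>

lemma other_bits_doubled:
  fixes i j :: nat
  assumes "set qs \<subseteq> {..<n}"
  shows "(\<forall>k<2 * n. k \<notin> set (map ((+) n) qs @ qs) \<longrightarrow> bit i k = bit j k) \<longleftrightarrow>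
    (\<forall>k<n. k \<notin> set qs \<longrightarrow> bit (i div 2 ^ n) k = bit (j div 2 ^ n) k) \<and>
    (\<forall>k<n. k \<notin> set qs \<longrightarrow> bit (i mod 2 ^ n) k = bit (j mod 2 ^ n) k)"
    (is "?L \<longleftrightarrow> ?R")
proof
  assume L: ?L
  have "bit i (n + k) = bit j (n + k)" if "k < n" "k \<notin> set qs" for k
  proof -
    \<comment> \<open>As \<open>qs\<close> lies below \<open>n\<close>, a qubit of the first copy
      cannot be mistaken for one of the second.\<close>
    have "n + k \<notin> set (map ((+) n) qs @ qs)" using that assms by (auto dest!: subsetD)
    then show ?thesis using L that by (simp add: mult_2)
  qed
  moreover have "bit i k = bit j k" if "k < n" "k \<notin> set qs" for k
    using L[rule_format, of k] that by auto
  ultimately show ?R by (simp add: bit_div_power bit_mod_power)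
next
  assume R: ?R
  show ?L
  proof (intro allI impI)
    fix k assume k: "k < 2 * n" "k \<notin> set (map ((+) n) qs @ qs)"
    show "bit i k = bit j k"
    proof (cases "k < n")
      case True
      then show ?thesis using R k by (simp add: bit_mod_power)
    next
      case False
      then obtain l where l: "k = n + l" using le_Suc_ex not_less by blast
      with k have "l < n" "l \<notin> set qs" by auto
      then show ?thesis using R l by (simp add: bit_div_power)
    qed
  qed
qed

text \<open>This is what separates the two copies, both for Kraus operators paired with their
  conjugates and for the networks of the algorithm.\<close>

lemma embed_doubled_kron:
  assumes qs: "set qs \<subseteq> {..<n}"
    and A: "A \<in> carrier_mat (2 ^ length qs) (2 ^ length qs)"
    and B: "B \<in> carrier_mat (2 ^ length qs) (2 ^ length qs)"
  shows "embed_doubled n qs (kron A B) = kron (embed n qs A) (embed n qs B)"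
proof (rule eq_matI)
  fix i j assume "i < dim_row (kron (embed n qs A) (embed n qs B))"
    "j < dim_col (kron (embed n qs A) (embed n qs B))"
  then have ij: "i < 2 ^ n * 2 ^ n" "j < 2 ^ n * 2 ^ n" by auto
  then have d: "i div 2 ^ n < 2 ^ n" "j div 2 ^ n < 2 ^ n" by (simp_all add: div_less_of_less_mult)
  have d': "i mod 2 ^ n < 2 ^ n" "j mod 2 ^ n < 2 ^ n" by simp_all
  have if_times: "(if P \<and> Q then x * y else 0) = (if P then x else 0) * (if Q then y else 0)"
    for P Q and x y :: complex
    by simp
  have ij': "i < 2 ^ (2 * n)" "j < 2 ^ (2 * n)" using ij by (simp_all add: mult_2 power_add)
  let ?c = "\<lambda>i j. \<forall>k<n. k \<notin> set qs \<longrightarrow> bit i k = bit j k"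
  have "embed_doubled n qs (kron A B) $$ (i, j) =
      (if ?c (i div 2 ^ n) (j div 2 ^ n) \<and> ?c (i mod 2 ^ n) (j mod 2 ^ n)
       then A $$ (local_index qs (i div 2 ^ n), local_index qs (j div 2 ^ n)) *
         B $$ (local_index qs (i mod 2 ^ n), local_index qs (j mod 2 ^ n)) else 0)"
    unfolding embed_doubled_def embed_index[OF ij'] other_bits_doubled[OF qs] local_index_doubled[OF qs]
      kron_index_pair[OF A B local_index_less local_index_less local_index_less local_index_less] ..
  also have "\<dots> = embed n qs A $$ (i div 2 ^ n, j div 2 ^ n) * embed n qs B $$ (i mod 2 ^ n, j mod 2 ^ n)"
    unfolding embed_index[OF d] embed_index[OF d'] by (rule if_times)
  also have "\<dots> = kron (embed n qs A) (embed n qs B) $$ (i, j)"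
    using ij by simp
  finally show "embed_doubled n qs (kron A B) $$ (i, j) = kron (embed n qs A) (embed n qs B) $$ (i, j)" .
qed (auto simp: embed_doubled_def mult_2 power_add)

text \<open>Whether an entry survives depends on the two indices alone, so embedding is
  linear.\<close>

lemma embed_mat_sum:
  "embed n qs (mat_sum (2 ^ length qs) f I) = mat_sum (2 ^ n) (\<lambda>x. embed n qs (f x)) I"
proof (rule eq_matI)
  fix i j assume ij: "i < dim_row (mat_sum (2 ^ n) (\<lambda>x. embed n qs (f x)) I)"
    "j < dim_col (mat_sum (2 ^ n) (\<lambda>x. embed n qs (f x)) I)"
  define c where "c \<longleftrightarrow> (\<forall>k<n. k \<notin> set qs \<longrightarrow> bit i k = bit j k)"
  have "embed n qs B $$ (i, j) = (if c then B $$ (local_index qs i, local_index qs j) else 0)" for B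
    unfolding c_def using ij by (intro embed_index) auto
  then show "embed n qs (mat_sum (2 ^ length qs) f I) $$ (i, j) =
      mat_sum (2 ^ n) (\<lambda>x. embed n qs (f x)) I $$ (i, j)"
    using ij by (cases c) (simp_all add: local_index_less)
qed auto

lemma embed_doubled_mat_sum:
  "embed_doubled n qs (mat_sum ((2 ^ length qs)\<^sup>2) f I) =
    mat_sum (2 ^ (2 * n)) (\<lambda>x. embed_doubled n qs (f x)) I"
proof -
  have "(2 ^ length qs)\<^sup>2 = (2 :: nat) ^ length (map ((+) n) qs @ qs)"
    by (simp add: power2_eq_square power_add)
  then show ?thesis unfolding embed_doubled_def by (simp only: embed_mat_sum)
qed

lemma embed_cnj:
  assumes "A \<in> carrier_mat (2 ^ length qs) (2 ^ length qs)"
  shows "embed n qs (mat_cnj A) = mat_cnj (embed n qs A)"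
  by (rule eq_matI) (use assms in \<open>auto simp: embed_index local_index_less\<close>)

section \<open>The expansion of a noisy circuit\<close>

text \<open>One summand of \<open>level_term\<close>, isolated so that it can also be summed over
  all sets of noises.\<close>

definition expansion_term :: "nat \<Rightarrow> circuit_element list \<Rightarrow> (nat \<Rightarrow> svd) \<Rightarrow> nat set \<Rightarrow> complex mat" where
  "expansion_term n C \<sigma> P = time_ordered_prod (2 ^ (2 * n))
     (\<lambda>s. embed_doubled n (support (C ! s)) (approx_factor C \<sigma> P s)) (length C)"

text \<open>The matrix representation of the noisy circuit, assembled from the local ones;
  \<open>circuit_kraus\<close> connects it with \<open>circuit_channel\<close>.\<close>

definition circuit_matrix :: "nat \<Rightarrow> circuit_element list \<Rightarrow> complex mat" where
  "circuit_matrix n C = time_ordered_prod (2 ^ (2 * n))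
     (\<lambda>s. embed_doubled n (support (C ! s)) (element_matrix (C ! s))) (length C)"

lemma expansion_term_carrier [simp]:
  "expansion_term n C \<sigma> P \<in> carrier_mat (2 ^ (2 * n)) (2 ^ (2 * n))"
  by (simp add: expansion_term_def)

lemma finite_noises [simp]: "finite (noises C)"
  by (simp add: noises_def)

lemma noises_subset: "noises C \<subseteq> {..<length C}"
  by (auto simp: noises_def)

lemma finite_noise_subsets [simp]: "finite (noise_subsets C u)"
  by (rule finite_subset[of _ "Pow (noises C)"]) (auto simp: noise_subsets_def)

lemma card_noise_subsets: "card (noise_subsets C u) = card (noises C) choose u"
  unfolding noise_subsets_def by (rule n_subsets) simp

text \<open>Grading the sets of noises by cardinality turns the full expansion into the sum of all
  levels.\<close>

lemma sum_Pow_noises: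
  "(\<Sum>P\<in>Pow (noises C). f P) = (\<Sum>u\<in>{0..card (noises C)}. \<Sum>P\<in>noise_subsets C u. f P)"
proof -
  have "(\<Sum>P\<in>Pow (noises C). f P) =
      (\<Sum>(u, P)\<in>(SIGMA u:{0..card (noises C)}. noise_subsets C u). f P)"
    by (rule sum.reindex_bij_witness[of _ snd "\<lambda>P. (card P, P)"])
      (auto simp: noise_subsets_def card_mono)
  then show ?thesis by (simp add: sum.Sigma)
qed

lemma valid_elementD:
  assumes "noisy_circuit n C" "s < length C"
  shows "distinct (support (C ! s))" "set (support (C ! s)) \<subseteq> {..<n}"
    "length (support (C ! s)) \<in> {1, 2}"
    "case C ! s of Gate qs A \<Rightarrow> unitary_mat (local_dim (C ! s)) A
       | Noise qs Ks \<Rightarrow> is_kraus (local_dim (C ! s)) Ks"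
  using assms nth_mem[of s C] by (auto simp: noisy_circuit_def valid_element_def)

lemma card_noises:
  assumes "noisy_circuit n C"
  shows "card (noises C) = num_noises 1 C + num_noises 2 C"
proof -
  have "noises C = {s \<in> noises C. length (support (C ! s)) = 1} \<union> {s \<in> noises C. length (support (C ! s)) = 2}"
    using valid_elementD(3)[OF assms] noises_subset[of C] by auto
  then have "card (noises C) =
      card ({s \<in> noises C. length (support (C ! s)) = 1} \<union> {s \<in> noises C. length (support (C ! s)) = 2})"
    by simp
  also have "\<dots> = num_noises 1 C + num_noises 2 C"
    unfolding num_noises_def by (rule card_Un_disjoint) auto
  finally show ?thesis .
qed

lemma local_dim_le:
  assumes "noisy_circuit n C" "s < length C"
  shows "local_dim (C ! s) \<le> 4"
  using valid_elementD(3)[OF assms] by (auto simp: local_dim_def)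

lemma local_dim_pos: "0 < local_dim c"
  by (simp add: local_dim_def)

lemma kraus_matrix_carrier [simp]: "kraus_matrix D Ks \<in> carrier_mat (D\<^sup>2) (D\<^sup>2)"
  by (simp add: kraus_matrix_def)

lemma element_matrix_carrier [simp]:
  "element_matrix c \<in> carrier_mat ((local_dim c)\<^sup>2) ((local_dim c)\<^sup>2)"
  by (cases c) (simp_all add: local_dim_def)

lemma kraus_matrix_single:
  assumes "A \<in> carrier_mat D D"
  shows "kraus_matrix D [A] = kron A (mat_cnj A)"
proof -
  have "kron A (mat_cnj A) \<in> carrier_mat (D\<^sup>2) (D\<^sup>2)"
    unfolding power2_eq_square using assms by (intro kron_carrier) auto
  then show ?thesis unfolding kraus_matrix_def
    by (simp add: lessThan_Suc mat_sum_singleton)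
qed

lemma noise_svdsD:
  "noise_svds C \<sigma> \<Longrightarrow> s \<in> noises C \<Longrightarrow>
    is_svd ((local_dim (C ! s))\<^sup>2) (tensor_permute (local_dim (C ! s)) (element_matrix (C ! s))) (\<sigma> s)"
  by (simp add: noise_svds_def)

lemma mat_sum_bool:
  assumes "f True \<in> carrier_mat D D" "f False \<in> carrier_mat D D"
  shows "mat_sum D f UNIV = f False + f True"
  by (rule eq_matI) (use assms in \<open>auto simp: UNIV_bool\<close>)

text \<open>Boolean choice functions on \<open>S\<close> are the characteristic functions of its
  subsets.\<close>

lemma mat_sum_PiE_bool:
  "mat_sum D (\<lambda>b. F {s \<in> S. b s}) (PiE S (\<lambda>_. UNIV)) = mat_sum D F (Pow S)"
proof -
  have "(\<Sum>b\<in>PiE S (\<lambda>_. UNIV). F {s \<in> S. b s} $$ ij) = (\<Sum>P\<in>Pow S. F P $$ ij)" for ij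
    by (rule sum.reindex_bij_witness[of _ "\<lambda>P. restrict (\<lambda>s. s \<in> P) S" "\<lambda>b. {s \<in> S. b s}"])
      (auto simp: restrict_def PiE_def extensional_def fun_eq_iff)
  then show ?thesis by (simp add: mat_sum_def)
qed

text \<open>Every noise factor is a sum over a Boolean, with \<open>True\<close> selecting the
  residual; multiplying out leaves one product for each set of noises.\<close>

lemma circuit_matrix_expansion:
  assumes C: "noisy_circuit n C" and \<sigma>: "noise_svds C \<sigma>"
  shows "circuit_matrix n C = mat_sum (2 ^ (2 * n)) (expansion_term n C \<sigma>) (Pow (noises C))"
proof -
  define D :: nat where "D = 2 ^ (2 * n)"
  define f where "f s b = embed_doubled n (support (C ! s)) (if b
    then residual_term (local_dim (C ! s)) (\<sigma> s) else dominant_term (local_dim (C ! s)) (\<sigma> s))" for s b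
  define g where "g s = embed_doubled n (support (C ! s)) (element_matrix (C ! s))" for s
  have f: "f s b \<in> carrier_mat D D" and g: "g s \<in> carrier_mat D D" for s b
    by (simp_all add: f_def g_def D_def)
  have eq: "g s = (if s \<in> noises C then mat_sum D (f s) UNIV else g s)" for s
  proof (cases "s \<in> noises C")
    case True
    let ?q = "local_dim (C ! s)"
    let ?h = "\<lambda>b. if b then residual_term ?q (\<sigma> s) else dominant_term ?q (\<sigma> s)"
    have "element_matrix (C ! s) = dominant_term ?q (\<sigma> s) + residual_term ?q (\<sigma> s)"
      by (rule dominant_plus_residual[symmetric, OF noise_svdsD[OF \<sigma> True] element_matrix_carrier local_dim_pos])
    also have "\<dots> = mat_sum (?q\<^sup>2) ?h UNIV"
      by (subst mat_sum_bool) simp_all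
    finally have "g s = embed_doubled n (support (C ! s)) (mat_sum (?q\<^sup>2) ?h UNIV)"
      by (simp add: g_def)
    also have "\<dots> = mat_sum D (f s) UNIV"
      unfolding f_def D_def local_dim_def by (rule embed_doubled_mat_sum)
    finally show ?thesis using True by simp
  qed simp
  have "circuit_matrix n C = time_ordered_prod D (\<lambda>s. if s \<in> noises C then mat_sum D (f s) UNIV else g s) (length C)"
    unfolding circuit_matrix_def D_def[symmetric] g_def[symmetric]
    by (rule time_ordered_prod_cong) (rule eq)
  also have "\<dots> = mat_sum D (\<lambda>b. time_ordered_prod D (\<lambda>s. if s \<in> noises C then f s (b s) else g s) (length C))
      (PiE (noises C \<inter> {..<length C}) (\<lambda>_. UNIV))"
    using f g by (intro time_ordered_prod_mat_sum) auto
  also have "noises C \<inter> {..<length C} = noises C"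
    using noises_subset by auto
  also have "mat_sum D (\<lambda>b. time_ordered_prod D (\<lambda>s. if s \<in> noises C then f s (b s) else g s) (length C))
      (PiE (noises C) (\<lambda>_. UNIV)) =
      mat_sum D (\<lambda>b. expansion_term n C \<sigma> {s \<in> noises C. b s}) (PiE (noises C) (\<lambda>_. UNIV))"
    unfolding expansion_term_def D_def[symmetric]
    by (intro mat_sum_cong refl time_ordered_prod_cong) (auto simp: approx_factor_def f_def g_def)
  also have "\<dots> = mat_sum D (expansion_term n C \<sigma>) (Pow (noises C))"
    by (rule mat_sum_PiE_bool)
  finally show ?thesis by (simp add: D_def)
qed

text \<open>Submultiplicativity: a residual contributes 16p, a dominant term 1 + 16p, and a gate,
  being unitary, contributes 1.\<close>

lemma op_bound_expansion_term:
  assumes C: "noisy_circuit n C" and \<sigma>: "noise_svds C \<sigma>"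
    and p: "\<And>s. s \<in> noises C \<Longrightarrow> noise_rate (C ! s) \<le> p"
    and P: "P \<subseteq> noises C"
  shows "op_bound (expansion_term n C \<sigma> P) ((16 * p) ^ card P * (1 + 16 * p) ^ (card (noises C) - card P))"
proof -
  \<comment> \<open>The sign of \<open>p\<close> comes from the existence of a noise: in a noiseless
    circuit the condition on the rates is vacuous and \<open>p\<close> may be negative.\<close>
  have p0: "0 \<le> p" if "s \<in> noises C" for s
    using p[OF that] spectral_norm_nonneg unfolding noise_rate_def by (rule order_trans[rotated])
  define c where "c s = (if s \<in> noises C then if s \<in> P then 16 * p else 1 + 16 * p else 1)" for s
  have c0: "0 \<le> c s" for s using p0 by (auto simp: c_def)
  have bound: "op_bound (embed_doubled n (support (C ! s)) (approx_factor C \<sigma> P s)) (c s)" if s: "s < length C" for s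
  proof (intro op_bound_embed_doubled valid_elementD[OF C s] c0)
    let ?q = "local_dim (C ! s)"
    show "approx_factor C \<sigma> P s \<in> carrier_mat ((2 ^ length (support (C ! s)))\<^sup>2) ((2 ^ length (support (C ! s)))\<^sup>2)"
      unfolding local_dim_def[symmetric] by (simp add: approx_factor_def)
    show "op_bound (approx_factor C \<sigma> P s) (c s)"
    proof (cases "s \<in> noises C")
      case True
      have "op_bound (element_matrix (C ! s) - 1\<^sub>m (?q\<^sup>2)) p"
        using op_bound_spectral_norm p[OF True] unfolding noise_rate_def by (rule op_bound_mono)
      note hyps = noise_svdsD[OF \<sigma> True] element_matrix_carrier local_dim_pos this p0[OF True]
      \<comment> \<open>A noise acts on at most two qubits, so \<open>q\<close> is at most 4; the
        bounds 4p and 1 + 5p are then relaxed to the constants of the theorem.\<close>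
      have "real ?q * p \<le> 4 * p"
        using local_dim_le[OF C s] p0[OF True] by (intro mult_right_mono) auto
      then have le: "real ?q * p \<le> 16 * p" "1 + (p + real ?q * p) \<le> 1 + 16 * p"
        using p0[OF True] by auto
      show ?thesis
        using op_bound_mono[OF op_bound_residual[OF hyps] le(1)]
          op_bound_mono[OF op_bound_dominant[OF hyps] le(2)] True
        by (simp add: approx_factor_def c_def)
    next
      case False
      then obtain qs A where A: "C ! s = Gate qs A"
        using s by (cases "C ! s") (auto simp: noises_def)
      then have U: "unitary_mat (2 ^ length qs) A"
        using valid_elementD(4)[OF C s] by (simp add: local_dim_def)
      have "op_bound (kron A (mat_cnj A)) 1"
        by (rule op_bound_unitary[OF unitary_mat_kron[OF U unitary_mat_cnj[OF U]]])
      then show ?thesis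
        using False A unitary_matD(1)[OF U] by (simp add: approx_factor_def c_def kraus_matrix_single)
    qed
  qed
  have "(\<Prod>s<length C. c s) = (\<Prod>s\<in>noises C. c s)"
    using noises_subset by (intro prod.mono_neutral_right) (auto simp: c_def)
  also have "\<dots> = (\<Prod>s\<in>P. c s) * (\<Prod>s\<in>noises C - P. c s)"
    using P by (subst mult.commute) (simp add: prod.subset_diff)
  also have "(\<Prod>s\<in>P. c s) = (\<Prod>s\<in>P. 16 * p)"
    using P by (intro prod.cong) (auto simp: c_def)
  also have "(\<Prod>s\<in>noises C - P. c s) = (\<Prod>s\<in>noises C - P. 1 + 16 * p)"
    using P by (intro prod.cong) (auto simp: c_def)
  also have "(\<Prod>s\<in>P. 16 * p) * (\<Prod>s\<in>noises C - P. 1 + 16 * p) =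
      (16 * p) ^ card P * (1 + 16 * p) ^ (card (noises C) - card P)"
    using P finite_subset[OF P] by (simp add: card_Diff_subset)
  finally have "(\<Prod>s<length C. c s) = (16 * p) ^ card P * (1 + 16 * p) ^ (card (noises C) - card P)" .
  moreover have "op_bound (expansion_term n C \<sigma> P) (\<Prod>s<length C. c s)"
    unfolding expansion_term_def using bound c0 by (intro op_bound_time_ordered_prod) auto
  ultimately show ?thesis by simp
qed

text \<open>The transpose is the entrywise conjugate of the adjoint, hence unitary as well.\<close>

lemma unitary_adjoint_kron_transpose:
  assumes "unitary_mat (2 ^ n) U"
  shows "unitary_mat (2 ^ (2 * n)) (kron (mat_adjoint U) (transpose_mat U))"
proof -
  have "transpose_mat U = mat_cnj (mat_adjoint U)"
    by (rule eq_matI) auto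
  then show ?thesis
    using unitary_mat_kron[OF unitary_mat_adjoint[OF assms] unitary_mat_cnj[OF unitary_mat_adjoint[OF assms]]]
    by (simp add: mult_2 power_add)
qed

lemma approx_fidelity_eq_sum:
  assumes "unitary_mat (2 ^ n) U"
  shows "approx_fidelity n U C \<sigma> l = 1 / 2 ^ (2 * n) * (\<Sum>u\<in>{0..l}. \<Sum>P\<in>noise_subsets C u.
    mat_trace (kron (mat_adjoint U) (transpose_mat U) * expansion_term n C \<sigma> P))"
proof -
  have W: "kron (mat_adjoint U) (transpose_mat U) \<in> carrier_mat (2 ^ (2 * n)) (2 ^ (2 * n))"
    by (rule unitary_matD(1)[OF unitary_adjoint_kron_transpose[OF assms]])
  have level: "level_term n C \<sigma> u = mat_sum (2 ^ (2 * n)) (expansion_term n C \<sigma>) (noise_subsets C u)" for u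
    by (simp add: level_term_def expansion_term_def[abs_def])
  have "mat_trace (kron (mat_adjoint U) (transpose_mat U) * approx_matrix n C \<sigma> l) =
      (\<Sum>u\<in>{0..l}. mat_trace (kron (mat_adjoint U) (transpose_mat U) * level_term n C \<sigma> u))"
    unfolding approx_matrix_def using W by (intro mat_trace_mult_mat_sum) (auto simp: level)
  also have "\<dots> = (\<Sum>u\<in>{0..l}. \<Sum>P\<in>noise_subsets C u.
      mat_trace (kron (mat_adjoint U) (transpose_mat U) * expansion_term n C \<sigma> P))"
    unfolding level using W by (intro sum.cong refl mat_trace_mult_mat_sum) auto
  finally show ?thesis by (simp add: approx_fidelity_def)
qed

text \<open>The levels up to \<open>l\<close> cancel. Each remaining level contributes one trace for
  every set of its size, and the normalisation absorbs the dimension from the trace bound.\<close>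

lemma approx_fidelity_error:
  assumes C: "noisy_circuit n C" and \<sigma>: "noise_svds C \<sigma>" and U: "unitary_mat (2 ^ n) U"
    and p: "\<And>s. s \<in> noises C \<Longrightarrow> noise_rate (C ! s) \<le> p"
    and l: "l \<le> card (noises C)"
  shows "cmod (1 / 2 ^ (2 * n) * mat_trace (kron (mat_adjoint U) (transpose_mat U) * circuit_matrix n C)
      - approx_fidelity n U C \<sigma> l)
    \<le> (\<Sum>u = l + 1..card (noises C). real (card (noises C) choose u) * (16 * p) ^ u *
      (1 + 16 * p) ^ (card (noises C) - u))"
proof -
  let ?N = "card (noises C)"
  define W where "W = kron (mat_adjoint U) (transpose_mat U)"
  define t where "t P = mat_trace (W * expansion_term n C \<sigma> P)" for P
  have W: "unitary_mat (2 ^ (2 * n)) W"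
    unfolding W_def by (rule unitary_adjoint_kron_transpose[OF U])
  have "mat_trace (W * circuit_matrix n C) = (\<Sum>P\<in>Pow (noises C). t P)"
    unfolding circuit_matrix_expansion[OF C \<sigma>] t_def
    using unitary_matD(1)[OF W] by (intro mat_trace_mult_mat_sum) auto
  also have "\<dots> = (\<Sum>u\<in>{0..?N}. \<Sum>P\<in>noise_subsets C u. t P)"
    by (rule sum_Pow_noises)
  also have "{0..?N} = {0..l} \<union> {l + 1..?N}" using l by auto
  also have "(\<Sum>u\<in>{0..l} \<union> {l + 1..?N}. \<Sum>P\<in>noise_subsets C u. t P) =
      (\<Sum>u\<in>{0..l}. \<Sum>P\<in>noise_subsets C u. t P) + (\<Sum>u\<in>{l + 1..?N}. \<Sum>P\<in>noise_subsets C u. t P)"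
    by (rule sum.union_disjoint) auto
  finally have diff: "1 / 2 ^ (2 * n) * mat_trace (W * circuit_matrix n C) - approx_fidelity n U C \<sigma> l =
      1 / 2 ^ (2 * n) * (\<Sum>u\<in>{l + 1..?N}. \<Sum>P\<in>noise_subsets C u. t P)"
    unfolding approx_fidelity_eq_sum[OF U] W_def[symmetric] t_def[symmetric] by (simp add: algebra_simps)
  have t: "cmod (t P) \<le> 2 ^ (2 * n) * ((16 * p) ^ u * (1 + 16 * p) ^ (?N - u))" if "P \<in> noise_subsets C u" for u P
  proof -
    have P: "P \<subseteq> noises C" "card P = u" using that by (auto simp: noise_subsets_def)
    have "op_bound (W * expansion_term n C \<sigma> P) (1 * ((16 * p) ^ u * (1 + 16 * p) ^ (?N - u)))"
      using op_bound_expansion_term[OF C \<sigma> p P(1)] P(2) op_bound_unitary[OF W] unitary_matD(1)[OF W]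
      by (intro op_bound_mult[OF _ expansion_term_carrier]) auto
    moreover have "W * expansion_term n C \<sigma> P \<in> carrier_mat (2 ^ (2 * n)) (2 ^ (2 * n))"
      using unitary_matD(1)[OF W] by (rule mult_carrier_mat) simp
    ultimately show ?thesis
      using cmod_trace_le[of "W * expansion_term n C \<sigma> P" "2 ^ (2 * n)"] by (simp add: t_def)
  qed
  have "cmod (\<Sum>u\<in>{l + 1..?N}. \<Sum>P\<in>noise_subsets C u. t P) \<le>
      (\<Sum>u\<in>{l + 1..?N}. \<Sum>P\<in>noise_subsets C u. cmod (t P))"
    by (rule order_trans[OF norm_sum sum_mono]) (rule norm_sum)
  also have "\<dots> \<le> (\<Sum>u\<in>{l + 1..?N}. \<Sum>P\<in>noise_subsets C u.
      2 ^ (2 * n) * ((16 * p) ^ u * (1 + 16 * p) ^ (?N - u)))"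
    by (intro sum_mono t)
  also have "\<dots> = 2 ^ (2 * n) * (\<Sum>u = l + 1..?N. real (?N choose u) * (16 * p) ^ u * (1 + 16 * p) ^ (?N - u))"
    by (simp add: card_noise_subsets sum_distrib_left mult_ac)
  finally show ?thesis
    unfolding W_def[symmetric] diff by (simp add: norm_mult norm_divide norm_power field_simps)
qed

section \<open>The contraction algorithm\<close>

lemma network_factor_carrier:
  assumes "noisy_circuit n C" "s < length C"
  shows "network_factor C \<sigma> w s \<in> carrier_mat (2 ^ length (support (C ! s))) (2 ^ length (support (C ! s)))"
proof -
  obtain u P j c where w: "w = ((u, P, j), c)" by (metis prod.collapse)
  show ?thesis
    unfolding w using valid_elementD(4)[OF assms]
    by (cases c; cases "C ! s") (auto simp: local_dim_def unitary_mat_def)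
qed

text \<open>Only the residuals are multiplied out, since gates and dominant terms already are single
  Kronecker products. Each resulting product is a Kronecker product over the two copies, whose trace
  is the product of two contractions.\<close>

lemma trace_expansion_term:
  assumes C: "noisy_circuit n C" and U: "unitary_mat (2 ^ n) U" and P: "P \<subseteq> noises C"
  shows "mat_trace (kron (mat_adjoint U) (transpose_mat U) * expansion_term n C \<sigma> P) =
    (\<Sum>j\<in>PiE P (\<lambda>s. {1..(local_dim (C ! s))\<^sup>2 - 1}).
      contract_network n U C \<sigma> ((u, P, j), First) * contract_network n U C \<sigma> ((u, P, j), Second))"
proof -
  define D :: nat where "D = 2 ^ (2 * n)"
  define J where "J s = {1..(local_dim (C ! s))\<^sup>2 - 1}" for s
  define f where "f s j = embed_doubled n (support (C ! s))
    (kron (svd_U (local_dim (C ! s)) (\<sigma> s) j) (svd_V (local_dim (C ! s)) (\<sigma> s) j))" for s j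
  define g where "g s = embed_doubled n (support (C ! s)) (approx_factor C \<sigma> P s)" for s
  let ?F = "\<lambda>c j s. embed n (support (C ! s)) (network_factor C \<sigma> ((u, P, j), c) s)"
  have fg: "f s j \<in> carrier_mat D D" "g s \<in> carrier_mat D D" for s j
    by (simp_all add: f_def g_def D_def)
  have g: "g s = (if s \<in> P then mat_sum D (f s) (J s) else g s)" for s
  proof (cases "s \<in> P")
    case True
    then have "g s = embed_doubled n (support (C ! s)) (residual_term (local_dim (C ! s)) (\<sigma> s))"
      using P by (auto simp: g_def approx_factor_def)
    also have "\<dots> = mat_sum D (f s) (J s)"
      unfolding residual_term_def f_def J_def D_def local_dim_def by (rule embed_doubled_mat_sum)
    finally show ?thesis using True by simp
  qed simp
  have factor: "(if s \<in> P then f s (j s) else g s) = kron (?F First j s) (?F Second j s)"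
    if s: "s < length C" for s j
  proof -
    have k: "embed_doubled n (support (C ! s)) (kron (network_factor C \<sigma> ((u, P, j), First) s)
        (network_factor C \<sigma> ((u, P, j), Second) s)) = kron (?F First j s) (?F Second j s)"
      by (intro embed_doubled_kron valid_elementD(2)[OF C s] network_factor_carrier[OF C s])
    show ?thesis
    proof (cases "C ! s")
      case (Gate qs A)
      then have "s \<notin> noises C" "A \<in> carrier_mat (2 ^ length qs) (2 ^ length qs)"
        using valid_elementD(4)[OF C s] by (auto simp: noises_def local_dim_def unitary_mat_def)
      then show ?thesis unfolding k[symmetric] using P Gate
        by (auto simp: g_def approx_factor_def kraus_matrix_single)
    next
      case (Noise qs Ks)
      then have "s \<in> noises C" using s by (simp add: noises_def)
      then show ?thesis unfolding k[symmetric] using Noise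
        by (auto simp: f_def g_def approx_factor_def dominant_term_def)
    qed
  qed
  have "expansion_term n C \<sigma> P =
      time_ordered_prod D (\<lambda>s. if s \<in> P then mat_sum D (f s) (J s) else g s) (length C)"
    unfolding expansion_term_def D_def[symmetric] g_def[symmetric]
    by (rule time_ordered_prod_cong) (rule g)
  also have "\<dots> = mat_sum D (\<lambda>j. time_ordered_prod D (\<lambda>s. if s \<in> P then f s (j s) else g s) (length C))
      (PiE (P \<inter> {..<length C}) J)"
    using fg by (intro time_ordered_prod_mat_sum) auto
  also have "P \<inter> {..<length C} = P" using P noises_subset by auto
  finally have exp: "expansion_term n C \<sigma> P =
      mat_sum D (\<lambda>j. time_ordered_prod D (\<lambda>s. if s \<in> P then f s (j s) else g s) (length C)) (PiE P J)" .
  have D: "D = 2 ^ n * 2 ^ n" by (simp add: D_def mult_2 power_add)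
  have Uc: "mat_adjoint U \<in> carrier_mat (2 ^ n) (2 ^ n)" "transpose_mat U \<in> carrier_mat (2 ^ n) (2 ^ n)"
    using unitary_matD(1)[OF U] by auto
  have "mat_trace (kron (mat_adjoint U) (transpose_mat U) * expansion_term n C \<sigma> P) =
      (\<Sum>j\<in>PiE P J. mat_trace (kron (mat_adjoint U) (transpose_mat U) *
        time_ordered_prod D (\<lambda>s. if s \<in> P then f s (j s) else g s) (length C)))"
    unfolding exp using kron_carrier[OF Uc] fg
    by (intro mat_trace_mult_mat_sum time_ordered_prod_carrier) (auto simp: D)
  also have "\<dots> = (\<Sum>j\<in>PiE P J.
      contract_network n U C \<sigma> ((u, P, j), First) * contract_network n U C \<sigma> ((u, P, j), Second))"
  proof (rule sum.cong[OF refl])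
    fix j assume "j \<in> PiE P J"
    let ?T = "\<lambda>c. time_ordered_prod (2 ^ n) (?F c j) (length C)"
    have T: "?T c \<in> carrier_mat (2 ^ n) (2 ^ n)" for c by simp
    have "time_ordered_prod D (\<lambda>s. if s \<in> P then f s (j s) else g s) (length C) =
        time_ordered_prod D (\<lambda>s. kron (?F First j s) (?F Second j s)) (length C)"
      by (rule time_ordered_prod_cong) (rule factor)
    also have "\<dots> = kron (?T First) (?T Second)"
      unfolding D by (rule time_ordered_prod_kron) simp_all
    finally have "kron (mat_adjoint U) (transpose_mat U) *
        time_ordered_prod D (\<lambda>s. if s \<in> P then f s (j s) else g s) (length C) =
        kron (mat_adjoint U * ?T First) (transpose_mat U * ?T Second)"
      by (simp only: kron_mult[OF Uc T T])
    then show "mat_trace (kron (mat_adjoint U) (transpose_mat U) *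
        time_ordered_prod D (\<lambda>s. if s \<in> P then f s (j s) else g s) (length C)) =
        contract_network n U C \<sigma> ((u, P, j), First) * contract_network n U C \<sigma> ((u, P, j), Second)"
      by (simp only: contract_network_def snd_conv copy.case
          mat_trace_kron[OF mult_carrier_mat[OF Uc(1) T] mult_carrier_mat[OF Uc(2) T]])
  qed
  finally show ?thesis unfolding J_def .
qed

text \<open>Correctness of the algorithm, which makes the contraction count a statement about
  computing F(l).\<close>

lemma alg_output_eq_approx_fidelity:
  assumes C: "noisy_circuit n C" and U: "unitary_mat (2 ^ n) U"
  shows "alg_output n U C \<sigma> l = approx_fidelity n U C \<sigma> l"
proof -
  let ?J = "\<lambda>P. PiE P (\<lambda>s. {1..(local_dim (C ! s))\<^sup>2 - 1})"
  let ?h = "\<lambda>t. contract_network n U C \<sigma> (t, First) * contract_network n U C \<sigma> (t, Second)"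
  have fin: "finite (?J P)" if "P \<in> noise_subsets C u" for u P
    using that finite_subset[OF _ finite_noises] by (intro finite_PiE) (auto simp: noise_subsets_def)
  have "(\<Sum>t\<in>alg_choices C l. ?h t) =
      (\<Sum>u\<in>{0..l}. \<Sum>(P, j)\<in>(SIGMA P:noise_subsets C u. ?J P). ?h (u, P, j))"
    unfolding alg_choices_def using fin by (subst sum.Sigma) (auto intro!: sum.cong)
  also have "\<dots> = (\<Sum>u\<in>{0..l}. \<Sum>P\<in>noise_subsets C u. \<Sum>j\<in>?J P. ?h (u, P, j))"
    using fin by (intro sum.cong refl) (subst sum.Sigma, auto)
  also have "\<dots> = (\<Sum>u\<in>{0..l}. \<Sum>P\<in>noise_subsets C u.
      mat_trace (kron (mat_adjoint U) (transpose_mat U) * expansion_term n C \<sigma> P))"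
    by (intro sum.cong refl trace_expansion_term[symmetric] C U) (auto simp: noise_subsets_def)
  finally show ?thesis by (simp add: alg_output_def approx_fidelity_eq_sum[OF U])
qed

section \<open>Counting the contractions\<close>

lemma card_alg_choices_le:
  assumes C: "noisy_circuit n C"
  shows "card (alg_choices C l) \<le> (\<Sum>u\<in>{0..l}. (card (noises C) choose u) * 15 ^ u)"
proof -
  let ?J = "\<lambda>P. PiE P (\<lambda>s. {1..(local_dim (C ! s))\<^sup>2 - 1})"
  have fin: "finite (?J P)" and card: "card (?J P) \<le> 15 ^ u" if P: "P \<in> noise_subsets C u" for u P
  proof -
    have P': "P \<subseteq> noises C" "card P = u" "finite P"
      using P finite_subset[OF _ finite_noises] by (auto simp: noise_subsets_def)
    then show "finite (?J P)" by (intro finite_PiE) auto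
    \<comment> \<open>The 15 is 16 - 1: a two-qubit noise has 16 Kronecker terms, one of which is
      dominant.\<close>
    have "(local_dim (C ! s))\<^sup>2 - 1 \<le> 15" if "s \<in> P" for s
    proof -
      have "s < length C" using that P'(1) noises_subset by blast
      from power_mono[OF local_dim_le[OF C this], of 2] show ?thesis by simp
    qed
    then have "(\<Prod>s\<in>P. (local_dim (C ! s))\<^sup>2 - 1) \<le> (\<Prod>s\<in>P. 15)"
      by (intro prod_mono) auto
    then show "card (?J P) \<le> 15 ^ u"
      using P' by (simp add: card_PiE)
  qed
  have "card (alg_choices C l) = (\<Sum>u\<in>{0..l}. \<Sum>P\<in>noise_subsets C u. card (?J P))"
    unfolding alg_choices_def using fin by (subst card_SigmaI) (auto intro!: sum.cong card_SigmaI)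
  also have "\<dots> \<le> (\<Sum>u\<in>{0..l}. \<Sum>P\<in>noise_subsets C u. 15 ^ u)"
    by (intro sum_mono card)
  finally show ?thesis by (simp add: card_noise_subsets)
qed

text \<open>The falling factorial in the numerator has \<open>k\<close> factors, each at most
  \<open>m\<close>. Keeping the denominator is what makes the sum over levels bounded independently
  of their number.\<close>

lemma choose_le_power_div_fact: "real (m choose k) \<le> real m ^ k / fact k"
proof -
  have "fact k * (m choose k) \<le> m ^ k"
  proof (cases "k \<le> m")
    case True
    have "fact k * (m choose k) = fact m div fact (m - k)"
      using True binomial_fact_lemma[OF True]
      by (metis div_mult_self_is_m fact_gt_zero mult.commute mult.left_commute)
    also have "\<dots> \<le> m ^ k" by (rule fact_div_fact_le_pow[OF True])
    finally show ?thesis .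
  qed (simp add: binomial_eq_0)
  then have "fact k * real (m choose k) \<le> real m ^ k"
    by (metis of_nat_fact of_nat_le_iff of_nat_mult of_nat_power)
  then show ?thesis by (simp add: field_simps)
qed

text \<open>The 2 counts the two copies, and \<open>exp 1\<close> bounds the sum of
  \<open>1 / fact u\<close> left after all powers are raised to the top level.\<close>

lemma num_contractions_le:
  assumes C: "noisy_circuit n C" and l: "l \<le> card (noises C)"
  shows "real (num_contractions C l) \<le> 2 * exp 1 * (15 ^ l * real (card (noises C)) ^ l)"
proof -
  let ?N = "card (noises C)"
  have copies: "card {First, Second} = 2" by simp
  have "real (num_contractions C l) = 2 * real (card (alg_choices C l))"
    by (simp add: num_contractions_def alg_networks_def card_cartesian_product copies)
  also have "real (card (alg_choices C l)) \<le> real (\<Sum>u\<in>{0..l}. (?N choose u) * 15 ^ u)"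
    by (rule of_nat_mono[OF card_alg_choices_le[OF C]])
  also have "\<dots> = (\<Sum>u\<in>{0..l}. real (?N choose u) * 15 ^ u)" by simp
  also have "\<dots> \<le> (\<Sum>u\<in>{0..l}. (15 ^ l * real ?N ^ l) * (1 / fact u))"
  proof (rule sum_mono)
    fix u assume u: "u \<in> {0..l}"
    have "real ?N ^ u \<le> real ?N ^ l"
    proof (cases "?N = 0")
      case True
      \<comment> \<open>Without noises \<open>l\<close> and \<open>u\<close> are 0, and both powers
        are 1.\<close>
      with l u show ?thesis by simp
    next
      case False
      then have "1 \<le> real ?N" by linarith
      with u show ?thesis by (intro power_increasing) auto
    qed
    moreover have "(15::real) ^ u \<le> 15 ^ l" using u by (intro power_increasing) auto
    ultimately have "15 ^ u * real ?N ^ u \<le> 15 ^ l * real ?N ^ l"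
      by (intro mult_mono) auto
    then have "15 ^ u * real ?N ^ u / fact u \<le> 15 ^ l * real ?N ^ l / fact u"
      by (intro divide_right_mono) auto
    moreover have "real (?N choose u) * 15 ^ u \<le> real ?N ^ u / fact u * 15 ^ u"
      by (intro mult_right_mono choose_le_power_div_fact) auto
    ultimately show "real (?N choose u) * 15 ^ u \<le> (15 ^ l * real ?N ^ l) * (1 / fact u)"
      by (simp add: mult_ac)
  qed
  also have "\<dots> = (15 ^ l * real ?N ^ l) * (\<Sum>u\<in>{0..l}. 1 / fact u)"
    by (simp add: sum_distrib_left)
  also have "\<dots> \<le> (15 ^ l * real ?N ^ l) * exp 1"
  proof (rule mult_left_mono)
    have "(\<Sum>u\<in>{0..l}. 1 / fact u) \<le> (\<Sum>u. 1 ^ u /\<^sub>R fact u :: real)"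
      using sum_le_suminf[OF summable_exp_generic[of "1::real"], of "{0..l}"]
      by (simp add: divide_inverse)
    then show "(\<Sum>u\<in>{0..l}. 1 / fact u) \<le> exp (1::real)" by (simp add: exp_def)
  qed auto
  finally show ?thesis by (simp add: mult_ac)
qed

section \<open>The Jamiolkowski fidelity\<close>

definition outer :: "nat \<Rightarrow> complex vec \<Rightarrow> complex mat" where
  "outer m x = mat m m (\<lambda>(i, j). x $ i * cnj (x $ j))"

lemma outer_carrier [simp]: "outer m x \<in> carrier_mat m m"
  by (simp add: outer_def)

lemma outer_dim [simp]: "dim_row (outer m x) = m" "dim_col (outer m x) = m"
  by (simp_all add: outer_def)

lemma outer_index [simp]: "i < m \<Longrightarrow> j < m \<Longrightarrow> outer m x $$ (i, j) = x $ i * cnj (x $ j)"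
  by (simp add: outer_def)

text \<open>The quadratic form at \<open>v\<close> is \<open>c\<close> times the squared modulus of
  the inner product of \<open>x\<close> and \<open>v\<close>.\<close>

lemma pos_semidef_smult_outer:
  assumes x: "x \<in> carrier_vec m" and c: "0 \<le> c"
  shows "pos_semidef m (complex_of_real c \<cdot>\<^sub>m outer m x)"
  unfolding pos_semidef_def
proof (intro conjI ballI)
  show "mat_adjoint (complex_of_real c \<cdot>\<^sub>m outer m x) = complex_of_real c \<cdot>\<^sub>m outer m x"
    by (rule eq_matI) (auto simp: mult.commute)
  fix v :: "complex vec" assume v: "v \<in> carrier_vec m"
  define z where "z = (\<Sum>i<m. cnj (x $ i) * v $ i)"
  have Av: "(complex_of_real c \<cdot>\<^sub>m outer m x *\<^sub>v v) $ i = complex_of_real c * x $ i * z" if "i < m" for i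
  proof -
    have "(complex_of_real c \<cdot>\<^sub>m outer m x *\<^sub>v v) $ i =
        (\<Sum>l<m. (complex_of_real c \<cdot>\<^sub>m outer m x) $$ (i, l) * v $ l)"
      using v that by (intro mult_mat_vec_index[of _ m]) auto
    also have "\<dots> = (\<Sum>l<m. complex_of_real c * x $ i * (cnj (x $ l) * v $ l))"
      using that by (intro sum.cong) auto
    finally show ?thesis by (simp add: z_def sum_distrib_left)
  qed
  have "(complex_of_real c \<cdot>\<^sub>m outer m x *\<^sub>v v) \<bullet>c v =
      (\<Sum>i<m. (complex_of_real c \<cdot>\<^sub>m outer m x *\<^sub>v v) $ i * cnj (v $ i))"
    using v by (auto simp: scalar_prod_def atLeast0LessThan simp del: index_mult_mat_vec intro!: sum.cong)
  also have "\<dots> = (\<Sum>i<m. complex_of_real c * z * cnj (cnj (x $ i) * v $ i))"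
    by (intro sum.cong refl) (auto simp: Av simp del: index_mult_mat_vec)
  also have "\<dots> = complex_of_real c * z * (\<Sum>i<m. cnj (cnj (x $ i) * v $ i))"
    by (rule sum_distrib_left[symmetric])
  also have "(\<Sum>i<m. cnj (cnj (x $ i) * v $ i)) = cnj z"
    by (simp add: z_def)
  also have "complex_of_real c * z * cnj z = complex_of_real c * (z * cnj z)"
    by (rule mult.assoc)
  also have "\<dots> = complex_of_real (c * (cmod z)\<^sup>2)"
    by (simp only: of_real_mult complex_norm_square)
  finally show "0 \<le> Re ((complex_of_real c \<cdot>\<^sub>m outer m x *\<^sub>v v) \<bullet>c v)"
    using c by simp
qed simp

lemma outer_mult_outer:
  assumes "x \<in> carrier_vec m" "vec_norm2 x = 1"
  shows "outer m x * outer m x = outer m x"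
proof (rule eq_matI)
  fix i j assume "i < dim_row (outer m x)" "j < dim_col (outer m x)"
  then have ij: "i < m" "j < m" by auto
  have "(outer m x * outer m x) $$ (i, j) = (\<Sum>l<m. x $ i * cnj (x $ j) * (x $ l * cnj (x $ l)))"
    using ij by (subst mult_mat_index[of _ m m _ m]) (auto intro!: sum.cong)
  also have "\<dots> = x $ i * cnj (x $ j) * complex_of_real ((vec_norm2 x)\<^sup>2)"
    unfolding vec_norm2_sq_complex using assms(1) by (simp add: sum_distrib_left)
  finally show "(outer m x * outer m x) $$ (i, j) = outer m x $$ (i, j)"
    using assms(2) ij by simp
qed auto

lemma vec_norm2_eq_0_iff: "vec_norm2 v = 0 \<longleftrightarrow> (\<forall>i<dim_vec v. v $ i = 0)"
  by (auto simp: vec_norm2_eq_L2_set L2_set_eq_0_iff)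

text \<open>A positive square root of a multiple of a rank-one projector vanishes on the kernel of the
  projector, hence it is itself a multiple of that projector.\<close>

lemma pos_semidef_sqrt_outer_unique:
  assumes x: "x \<in> carrier_vec m" "vec_norm2 x = 1" and c: "0 \<le> c"
    and B: "pos_semidef m B" "B * B = complex_of_real c \<cdot>\<^sub>m outer m x"
  shows "B = complex_of_real (sqrt c) \<cdot>\<^sub>m outer m x"
proof -
  let ?P = "outer m x"
  have Bc: "B \<in> carrier_mat m m" and Ba: "mat_adjoint B = B"
    and Bp: "\<And>v. v \<in> carrier_vec m \<Longrightarrow> 0 \<le> Re ((B *\<^sub>v v) \<bullet>c v)"
    using B(1) by (auto simp: pos_semidef_def)
  have herm: "cnj (B $$ (j, i)) = B $$ (i, j)" if "i < m" "j < m" for i j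
    using that Bc Ba mat_adjoint_index[of i B j] by auto
  have norm1: "(\<Sum>i<m. x $ i * cnj (x $ i)) = 1"
    using vec_norm2_sq_complex[of x] x by simp
  define y where "y = B *\<^sub>v x"
  have y: "y $ i = (\<Sum>l<m. B $$ (i, l) * x $ l)" if "i < m" for i
    unfolding y_def using Bc x that by (intro mult_mat_vec_index)
  have BP: "(B * ?P) $$ (i, j) = y $ i * cnj (x $ j)" if ij: "i < m" "j < m" for i j
  proof -
    have "(B * ?P) $$ (i, j) = (\<Sum>l<m. B $$ (i, l) * ?P $$ (l, j))"
      using Bc ij by (intro mult_mat_index) auto
    also have "\<dots> = y $ i * cnj (x $ j)"
      using ij by (simp add: y sum_distrib_right mult.assoc)
    finally show ?thesis .
  qed
  \<comment> \<open>\<open>E\<close> is \<open>B\<close> restricted to the complement of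
    \<open>x\<close>; its vanishing is the statement that \<open>B\<close> kills the kernel of the
    projector.\<close>
  define E where "E = B - B * ?P"
  have Ec: "E \<in> carrier_mat m m" using Bc unfolding E_def by (intro minus_carrier_mat mult_carrier_mat) auto
  have "E = B * (1\<^sub>m m - ?P)"
    unfolding E_def using Bc by (subst mult_minus_distrib_mat[of _ m m _ m]) auto
  \<comment> \<open>Since \<open>B\<close> is Hermitian, this Gram matrix contains
    \<open>B * B\<close>, a multiple of \<open>?P\<close>, next to the complementary projector, and
    their product is 0.\<close>
  have EE: "mat_adjoint E * E = 0\<^sub>m m m"
  proof -
    define Q where "Q = 1\<^sub>m m - ?P"
    have Q: "Q \<in> carrier_mat m m" unfolding Q_def by (intro minus_carrier_mat outer_carrier)
    have "mat_adjoint E * E = mat_adjoint Q * B * (B * Q)"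
      using Bc Q \<open>E = B * (1\<^sub>m m - ?P)\<close> Ba by (simp add: Q_def[symmetric] mat_adjoint_mult[of _ m m _ m])
    also have "\<dots> = mat_adjoint Q * (B * (B * Q))"
      using Bc Q by (intro assoc_mult_mat[of _ m m _ m _ m] mult_carrier_mat[of _ m m] mat_adjoint_carrier) auto
    also have "B * (B * Q) = B * B * Q"
      using Bc Q by (intro assoc_mult_mat[of _ m m _ m _ m, symmetric]) auto
    also have "B * B * Q = complex_of_real c \<cdot>\<^sub>m (?P * Q)"
      unfolding B(2) using Q by (intro mult_smult_assoc_mat[of _ m m _ m]) auto
    also have "?P * Q = 0\<^sub>m m m"
    proof -
      have "?P * Q = ?P * 1\<^sub>m m - ?P * ?P"
        unfolding Q_def by (intro mult_minus_distrib_mat[of _ m m _ m]) auto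
      also have "\<dots> = ?P - ?P"
        unfolding outer_mult_outer[OF x] by (simp add: right_mult_one_mat[of _ m m])
      also have "\<dots> = 0\<^sub>m m m" by (rule eq_matI) auto
      finally show ?thesis .
    qed
    finally show ?thesis using Q by (simp add: right_mult_zero_mat[of _ m m])
  qed
  \<comment> \<open>The diagonal of the Gram matrix holds the squared lengths of the columns of
    \<open>E\<close>.\<close>
  have E0: "E $$ (l, j) = 0" if lj: "l < m" "j < m" for l j
  proof -
    have "complex_of_real ((vec_norm2 (col E j))\<^sup>2) = (mat_adjoint E * E) $$ (j, j)"
      unfolding vec_norm2_sq_complex using Ec lj
      by (subst mult_mat_index[of _ m m _ m]) (auto intro!: sum.cong simp: mult.commute)
    then have "vec_norm2 (col E j) = 0" using EE lj by simp
    then show ?thesis using Ec lj by (auto simp: vec_norm2_eq_0_iff)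
  qed
  have B1: "B $$ (i, j) = y $ i * cnj (x $ j)" if "i < m" "j < m" for i j
    using E0[OF that] BP[OF that] Bc that unfolding E_def by simp
  define b where "b = (\<Sum>i<m. y $ i * cnj (x $ i))"
  \<comment> \<open>Now \<open>B\<close> is the rank-one matrix formed from \<open>y\<close> and
    \<open>x\<close>. Hermitian symmetry forces \<open>y\<close> to be a multiple of
    \<open>x\<close>, and the factor \<open>b\<close>, the value of the quadratic form at
    \<open>x\<close>, is real for the same reason.\<close>
  have yx: "y $ i = b * x $ i" if i: "i < m" for i
  proof -
    have "y $ i = (\<Sum>j<m. cnj (B $$ (j, i)) * x $ j)"
      using i by (simp add: y herm)
    also have "\<dots> = (\<Sum>j<m. x $ i * cnj (y $ j * cnj (x $ j)))"
      using i by (intro sum.cong refl) (simp add: B1)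
    finally have "y $ i = x $ i * cnj b" by (simp add: b_def sum_distrib_left)
    note yi = this
    show ?thesis
    proof -
      have "cnj b = b"
      proof -
        have "b = (\<Sum>i<m. \<Sum>l<m. B $$ (i, l) * x $ l * cnj (x $ i))"
          unfolding b_def by (intro sum.cong refl) (simp add: y sum_distrib_right)
        then have "cnj b = (\<Sum>i<m. \<Sum>l<m. B $$ (l, i) * cnj (x $ l) * x $ i)"
          by (simp add: herm)
        also have "\<dots> = (\<Sum>l<m. \<Sum>i<m. B $$ (l, i) * cnj (x $ l) * x $ i)"
          by (rule sum.swap)
        also have "\<dots> = b"
          unfolding b_def by (intro sum.cong refl) (simp add: y sum_distrib_left mult_ac)
        finally show ?thesis .
      qed
      with yi show ?thesis by (simp add: mult.commute)
    qed
  qed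
  have BbP: "B = b \<cdot>\<^sub>m ?P"
    by (rule eq_matI) (use Bc in \<open>auto simp: B1 yx\<close>)
  have b_re: "b = complex_of_real (Re b)" "0 \<le> Re b"
  proof -
    have eq: "(B *\<^sub>v x) \<bullet>c x = b"
      using x unfolding y_def[symmetric] b_def
      by (auto simp: scalar_prod_def atLeast0LessThan intro!: sum.cong)
    show "0 \<le> Re b" using Bp[OF x(1)] eq by simp
    have "m \<noteq> 0" using norm1 by (auto intro!: gr0I)
    obtain i where i: "i < m" "x $ i \<noteq> 0"
      using norm1 by (metis (no_types, lifting) lessThan_iff mult_zero_left sum.neutral zero_neq_one)
    have "b * (x $ i * cnj (x $ i)) = B $$ (i, i)" using BbP i by simp
    moreover have "cnj (B $$ (i, i)) = B $$ (i, i)" using herm i by blast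
    ultimately have "cnj b * (x $ i * cnj (x $ i)) = b * (x $ i * cnj (x $ i))"
      by (metis complex_cnj_cnj complex_cnj_mult mult.commute)
    with i have "cnj b = b" by simp
    then show "b = complex_of_real (Re b)" by (simp add: complex_eq_iff)
  qed
  have "b\<^sup>2 = complex_of_real c"
  proof -
    have "B * B = b \<cdot>\<^sub>m (b \<cdot>\<^sub>m (?P * ?P))"
      unfolding BbP by (simp add: mult_smult_assoc_mat[of _ m m _ m] mult_smult_distrib[of _ m m _ m])
    then have eq: "b \<cdot>\<^sub>m (b \<cdot>\<^sub>m ?P) = complex_of_real c \<cdot>\<^sub>m ?P"
      using B(2) by (simp add: outer_mult_outer[OF x])
    obtain i where i: "i < m" "x $ i \<noteq> 0"
      using norm1 by (metis (no_types, lifting) lessThan_iff mult_zero_left sum.neutral zero_neq_one)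
    have "(b \<cdot>\<^sub>m (b \<cdot>\<^sub>m ?P)) $$ (i, i) = (complex_of_real c \<cdot>\<^sub>m ?P) $$ (i, i)"
      by (simp only: eq)
    then show ?thesis using i by (simp add: power2_eq_square)
  qed
  then have "complex_of_real ((Re b)\<^sup>2) = complex_of_real c"
    using b_re(1) by (metis of_real_power)
  then have "(Re b)\<^sup>2 = c" using of_real_eq_iff by blast
  \<comment> \<open>Positivity of the quadratic form at \<open>x\<close> excludes the negative
    root.\<close>
  then have "sqrt c = Re b" using b_re(2) by (metis real_sqrt_abs abs_of_nonneg)
  then show ?thesis using BbP b_re(1) by simp
qed

text \<open>Evaluating the definite description needs the explicit root as well as its
  uniqueness.\<close>

lemma mat_sqrt_smult_outer:
  assumes x: "x \<in> carrier_vec m" "vec_norm2 x = 1" and c: "0 \<le> c"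
  shows "mat_sqrt (complex_of_real c \<cdot>\<^sub>m outer m x) = complex_of_real (sqrt c) \<cdot>\<^sub>m outer m x"
  unfolding mat_sqrt_def
proof (rule the_equality)
  let ?P = "outer m x" and ?r = "complex_of_real (sqrt c)"
  have "?r \<cdot>\<^sub>m ?P * (?r \<cdot>\<^sub>m ?P) = ?r \<cdot>\<^sub>m (?r \<cdot>\<^sub>m (?P * ?P))"
    by (simp add: mult_smult_assoc_mat[of _ m m _ m] mult_smult_distrib[of _ m m _ m])
  also have "\<dots> = complex_of_real c \<cdot>\<^sub>m ?P"
    unfolding outer_mult_outer[OF x]
    by (rule eq_matI) (use c in \<open>auto simp: mult.assoc[symmetric] simp flip: of_real_mult\<close>)
  finally show "pos_semidef (dim_row (complex_of_real c \<cdot>\<^sub>m ?P)) (?r \<cdot>\<^sub>m ?P) \<and>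
      ?r \<cdot>\<^sub>m ?P * (?r \<cdot>\<^sub>m ?P) = complex_of_real c \<cdot>\<^sub>m ?P"
    using pos_semidef_smult_outer[OF x(1), of "sqrt c"] c by simp
next
  fix B assume "pos_semidef (dim_row (complex_of_real c \<cdot>\<^sub>m outer m x)) B \<and>
    B * B = complex_of_real c \<cdot>\<^sub>m outer m x"
  then show "B = complex_of_real (sqrt c) \<cdot>\<^sub>m outer m x"
    using pos_semidef_sqrt_outer_unique[OF x c] by simp
qed

lemma mat_trace_smult_outer:
  assumes "x \<in> carrier_vec m" "vec_norm2 x = 1"
  shows "mat_trace (a \<cdot>\<^sub>m outer m x) = a"
proof -
  have "mat_trace (a \<cdot>\<^sub>m outer m x) = a * complex_of_real ((vec_norm2 x)\<^sup>2)"
    unfolding vec_norm2_sq_complex using assms(1) by (simp add: mat_trace_def sum_distrib_left)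
  then show ?thesis using assms(2) by simp
qed

text \<open>A rank-one projector is its own square root, and the sandwiched state is
  \<open>c\<close> times it; the trace of the remaining root is \<open>sqrt c\<close>, which the
  fidelity squares.\<close>

lemma state_fidelity_outer:
  assumes x: "x \<in> carrier_vec m" "vec_norm2 x = 1" and c: "0 \<le> c"
    and \<sigma>: "outer m x * \<sigma> * outer m x = complex_of_real c \<cdot>\<^sub>m outer m x"
  shows "state_fidelity (outer m x) \<sigma> = complex_of_real c"
proof -
  have "1 \<cdot>\<^sub>m outer m x = outer m x" by (rule eq_matI) auto
  then have "mat_sqrt (outer m x) = outer m x"
    using mat_sqrt_smult_outer[OF x, of 1] by simp
  then have "state_fidelity (outer m x) \<sigma> = (complex_of_real (sqrt c))\<^sup>2"
    unfolding state_fidelity_def \<sigma> by (simp only: \<sigma> mat_sqrt_smult_outer[OF x c] mat_trace_smult_outer[OF x])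
  also have "\<dots> = complex_of_real ((sqrt c)\<^sup>2)" by (rule of_real_power[symmetric])
  finally show ?thesis using c by simp
qed

text \<open>In bra-ket notation the middle collapses to the scalar <x|y><y|x>.\<close>

lemma outer_mult_outer_mult_outer:
  assumes "x \<in> carrier_vec m" "y \<in> carrier_vec m"
  shows "outer m x * outer m y * outer m x =
    complex_of_real ((cmod (\<Sum>i<m. cnj (x $ i) * y $ i))\<^sup>2) \<cdot>\<^sub>m outer m x"
proof (rule eq_matI)
  define z where "z = (\<Sum>i<m. cnj (x $ i) * y $ i)"
  have cz: "(\<Sum>l<m. cnj (y $ l) * x $ l) = cnj z" by (simp add: z_def mult.commute)
  fix i j assume "i < dim_row (complex_of_real ((cmod (\<Sum>i<m. cnj (x $ i) * y $ i))\<^sup>2) \<cdot>\<^sub>m outer m x)"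
    "j < dim_col (complex_of_real ((cmod (\<Sum>i<m. cnj (x $ i) * y $ i))\<^sup>2) \<cdot>\<^sub>m outer m x)"
  then have ij: "i < m" "j < m" by auto
  have xy: "(outer m x * outer m y) $$ (i, l) = x $ i * z * cnj (y $ l)" if "l < m" for l
  proof -
    have "(outer m x * outer m y) $$ (i, l) = (\<Sum>k<m. x $ i * cnj (y $ l) * (cnj (x $ k) * y $ k))"
      using ij that by (subst mult_mat_index[of _ m m _ m]) (auto intro!: sum.cong)
    also have "\<dots> = x $ i * cnj (y $ l) * z" unfolding z_def by (rule sum_distrib_left[symmetric])
    finally show ?thesis by (simp add: mult_ac)
  qed
  have "(outer m x * outer m y * outer m x) $$ (i, j) =
      (\<Sum>l<m. (outer m x * outer m y) $$ (i, l) * outer m x $$ (l, j))"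
    using ij by (intro mult_mat_index[of _ m m _ m] mult_carrier_mat[of _ m m]) auto
  also have "\<dots> = (\<Sum>l<m. x $ i * z * cnj (x $ j) * (cnj (y $ l) * x $ l))"
    using ij by (intro sum.cong refl) (simp add: xy mult_ac del: index_mult_mat(1))
  also have "\<dots> = x $ i * z * cnj (x $ j) * cnj z"
    unfolding cz[symmetric] by (rule sum_distrib_left[symmetric])
  also have "\<dots> = z * cnj z * (x $ i * cnj (x $ j))" by (simp only: mult_ac)
  also have "z * cnj z = complex_of_real ((cmod z)\<^sup>2)"
    by (rule complex_norm_square[symmetric])
  finally show "(outer m x * outer m y * outer m x) $$ (i, j) =
      (complex_of_real ((cmod (\<Sum>i<m. cnj (x $ i) * y $ i))\<^sup>2) \<cdot>\<^sub>m outer m x) $$ (i, j)"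
    using ij by (simp add: z_def)
qed auto

section \<open>Kraus lists of compositions\<close>

definition compose_kraus :: "complex mat list \<Rightarrow> complex mat list \<Rightarrow> complex mat list" where
  "compose_kraus Ls Ks = map (\<lambda>i. Ls ! (i div length Ks) * Ks ! (i mod length Ks)) [0..<length Ls * length Ks]"

lemma length_compose_kraus [simp]: "length (compose_kraus Ls Ks) = length Ls * length Ks"
  by (simp add: compose_kraus_def)

lemma compose_kraus_nth:
  "a < length Ls \<Longrightarrow> b < length Ks \<Longrightarrow> compose_kraus Ls Ks ! (a * length Ks + b) = Ls ! a * Ks ! b"
  by (simp add: compose_kraus_def pair_index_less pair_index_div_mod)

lemma compose_kraus_carrier:
  assumes "set Ls \<subseteq> carrier_mat D D" "set Ks \<subseteq> carrier_mat D D"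
  shows "set (compose_kraus Ls Ks) \<subseteq> carrier_mat D D"
proof -
  have "Ls ! (i div length Ks) * Ks ! (i mod length Ks) \<in> carrier_mat D D"
    if "i < length Ls * length Ks" for i
    using assms nth_mem[OF div_less_of_less_mult[OF that]] nth_mem[OF mod_less_of_less_mult[OF that]]
    by (intro mult_carrier_mat[of _ D D]) auto
  then show ?thesis by (auto simp: compose_kraus_def)
qed

text \<open>Entrywise conjugation is multiplicative, so the mixed-product rule applies to each pair
  of Kraus operators; the pair-encoded order of the list matches
  \<open>mat_sum_pair_index\<close>.\<close>

lemma kraus_matrix_compose:
  assumes "set Ls \<subseteq> carrier_mat D D" "set Ks \<subseteq> carrier_mat D D"
  shows "kraus_matrix D (compose_kraus Ls Ks) = kraus_matrix D Ls * kraus_matrix D Ks"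
proof -
  have L: "Ls ! a \<in> carrier_mat D D" if "a < length Ls" for a using assms(1) that by auto
  have K: "Ks ! b \<in> carrier_mat D D" if "b < length Ks" for b using assms(2) that by auto
  have kk: "kron A (mat_cnj A) \<in> carrier_mat (D\<^sup>2) (D\<^sup>2)" if "A \<in> carrier_mat D D" for A
    unfolding power2_eq_square using that by (intro kron_carrier) auto
  have cnj_mult: "mat_cnj (A * B) = mat_cnj A * mat_cnj B"
    if "A \<in> carrier_mat D D" "B \<in> carrier_mat D D" for A B
    by (rule eq_matI) (use that in \<open>auto simp: mult_mat_index[of _ D D _ D] simp del: index_mult_mat(1)\<close>)
  have "kraus_matrix D Ls * kraus_matrix D Ks = mat_sum (D\<^sup>2)
      (\<lambda>a. kron (Ls ! a) (mat_cnj (Ls ! a)) * kraus_matrix D Ks) {..<length Ls}"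
    unfolding kraus_matrix_def[of D Ls] using L kk by (intro mat_sum_mult_right) auto
  also have "\<dots> = mat_sum (D\<^sup>2) (\<lambda>a. mat_sum (D\<^sup>2) (\<lambda>b. kron (Ls ! a) (mat_cnj (Ls ! a)) *
      kron (Ks ! b) (mat_cnj (Ks ! b))) {..<length Ks}) {..<length Ls}"
    unfolding kraus_matrix_def using L K kk by (intro mat_sum_cong refl mat_sum_mult_left) auto
  also have "\<dots> = kraus_matrix D (compose_kraus Ls Ks)"
    unfolding kraus_matrix_def length_compose_kraus mat_sum_pair_index
    using L K by (intro mat_sum_cong refl)
      (simp add: compose_kraus_nth cnj_mult kron_mult[of _ D _ D])
  finally show ?thesis ..
qed

lemma kraus_channel_carrier [simp]: "kraus_channel D Ks \<rho> \<in> carrier_mat D D"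
  by (simp add: kraus_channel_def)

lemma kraus_channel_compose:
  assumes "set Ls \<subseteq> carrier_mat D D" "set Ks \<subseteq> carrier_mat D D" and \<rho>: "\<rho> \<in> carrier_mat D D"
  shows "kraus_channel D (compose_kraus Ls Ks) \<rho> = kraus_channel D Ls (kraus_channel D Ks \<rho>)"
proof -
  have L: "Ls ! a \<in> carrier_mat D D" if "a < length Ls" for a using assms(1) that by auto
  have K: "Ks ! b \<in> carrier_mat D D" if "b < length Ks" for b using assms(2) that by auto
  have m: "A * B \<in> carrier_mat D D" if "A \<in> carrier_mat D D" "B \<in> carrier_mat D D" for A B :: "complex mat"
    using that by (rule mult_carrier_mat)
  have "kraus_channel D Ls (kraus_channel D Ks \<rho>) = mat_sum D (\<lambda>a. mat_sum D (\<lambda>b.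
      Ls ! a * (Ks ! b * \<rho> * mat_adjoint (Ks ! b)) * mat_adjoint (Ls ! a)) {..<length Ks}) {..<length Ls}"
    unfolding kraus_channel_def[of D Ls]
  proof (intro mat_sum_cong refl)
    fix a assume "a \<in> {..<length Ls}"
    then have a: "Ls ! a \<in> carrier_mat D D" using L by simp
    have "Ls ! a * kraus_channel D Ks \<rho> =
        mat_sum D (\<lambda>b. Ls ! a * (Ks ! b * \<rho> * mat_adjoint (Ks ! b))) {..<length Ks}"
      unfolding kraus_channel_def using a K \<rho> by (intro mat_sum_mult_left m mat_adjoint_carrier) auto
    then show "Ls ! a * kraus_channel D Ks \<rho> * mat_adjoint (Ls ! a) = mat_sum D (\<lambda>b.
      Ls ! a * (Ks ! b * \<rho> * mat_adjoint (Ks ! b)) * mat_adjoint (Ls ! a)) {..<length Ks}"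
      using a K \<rho> by (simp only:) (intro mat_sum_mult_right m mat_adjoint_carrier, auto)
  qed
  also have "\<dots> = kraus_channel D (compose_kraus Ls Ks) \<rho>"
    unfolding kraus_channel_def length_compose_kraus mat_sum_pair_index
  proof (intro mat_sum_cong refl)
    fix a b assume "a \<in> {..<length Ls}" "b \<in> {..<length Ks}"
    then have ab: "a < length Ls" "b < length Ks" by auto
    note A = L[OF ab(1)] and B = K[OF ab(2)]
    note A' = mat_adjoint_carrier[OF A] and B' = mat_adjoint_carrier[OF B]
    have "Ls ! a * (Ks ! b * \<rho> * mat_adjoint (Ks ! b)) * mat_adjoint (Ls ! a) =
        Ls ! a * (Ks ! b * \<rho>) * mat_adjoint (Ks ! b) * mat_adjoint (Ls ! a)"
      by (simp only: assoc_mult_mat[OF A m[OF B \<rho>] B'])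
    also have "\<dots> = Ls ! a * Ks ! b * \<rho> * (mat_adjoint (Ks ! b) * mat_adjoint (Ls ! a))"
      by (simp only: assoc_mult_mat[OF A B \<rho>, symmetric] assoc_mult_mat[OF m[OF m[OF A B] \<rho>] B' A'])
    finally show "Ls ! a * (Ks ! b * \<rho> * mat_adjoint (Ks ! b)) * mat_adjoint (Ls ! a) =
        compose_kraus Ls Ks ! (a * length Ks + b) * \<rho> *
        mat_adjoint (compose_kraus Ls Ks ! (a * length Ks + b))"
      by (simp only: compose_kraus_nth[OF ab] mat_adjoint_mult[OF A B])
  qed
  finally show ?thesis ..
qed

text \<open>Kraus operators on the full space; a gate is a one-element list, so that gates and
  noises can be treated alike.\<close>

fun element_kraus :: "nat \<Rightarrow> circuit_element \<Rightarrow> complex mat list" where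
  "element_kraus n (Gate qs A) = [embed n qs A]"
| "element_kraus n (Noise qs Ks) = map (embed n qs) Ks"

lemma element_channel_eq: "element_channel n c = kraus_channel (2 ^ n) (element_kraus n c)"
  by (cases c) auto

lemma element_kraus_carrier: "set (element_kraus n c) \<subseteq> carrier_mat (2 ^ n) (2 ^ n)"
  by (cases c) auto

text \<open>Forming the matrix representation commutes with extension by the identity: embedding is
  linear, respects conjugation and separates the two copies.\<close>

lemma embed_doubled_kraus_matrix:
  assumes "set qs \<subseteq> {..<n}" "set Ks \<subseteq> carrier_mat (2 ^ length qs) (2 ^ length qs)"
  shows "embed_doubled n qs (kraus_matrix (2 ^ length qs) Ks) = kraus_matrix (2 ^ n) (map (embed n qs) Ks)"
proof -
  have D: "(2 ^ n)\<^sup>2 = (2::nat) ^ (2 * n)" by (simp add: power_mult[symmetric] mult.commute)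
  have "embed_doubled n qs (kron (Ks ! k) (mat_cnj (Ks ! k))) =
      kron (map (embed n qs) Ks ! k) (mat_cnj (map (embed n qs) Ks ! k))" if "k < length Ks" for k
  proof -
    have K: "Ks ! k \<in> carrier_mat (2 ^ length qs) (2 ^ length qs)" using assms(2) that by auto
    then show ?thesis
      using that embed_doubled_kron[OF assms(1) K mat_cnj_carrier[OF K]] by (simp add: embed_cnj)
  qed
  then show ?thesis
    unfolding kraus_matrix_def embed_doubled_mat_sum D by (intro mat_sum_cong) auto
qed

lemma embed_doubled_element_matrix:
  assumes "valid_element n c"
  shows "embed_doubled n (support c) (element_matrix c) = kraus_matrix (2 ^ n) (element_kraus n c)"
  using assms by (cases c)
    (auto simp: valid_element_def local_dim_def unitary_mat_def is_kraus_def embed_doubled_kraus_matrix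
      simp del: One_nat_def)

text \<open>The fidelity is defined through the channel and the approximation through matrices; one
  Kraus list for both joins them. The channels are compared on matrices of the right size, because
  the empty circuit returns its argument as it is, whereas a Kraus channel always returns a matrix
  of its own dimension.\<close>

lemma circuit_kraus:
  assumes "noisy_circuit n C"
  obtains Ks where "set Ks \<subseteq> carrier_mat (2 ^ n) (2 ^ n)"
    "\<And>\<rho>. \<rho> \<in> carrier_mat (2 ^ n) (2 ^ n) \<Longrightarrow> circuit_channel n C \<rho> = kraus_channel (2 ^ n) Ks \<rho>"
    "circuit_matrix n C = kraus_matrix (2 ^ n) Ks"
proof -
  let ?D = "2 ^ n :: nat"
  have "\<exists>Ks. set Ks \<subseteq> carrier_mat ?D ?D \<and>
      (\<forall>\<rho>\<in>carrier_mat ?D ?D. circuit_channel n C \<rho> = kraus_channel ?D Ks \<rho>) \<and>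
      circuit_matrix n C = kraus_matrix ?D Ks"
    using assms
  \<comment> \<open>The last element acts outermost, as a factor on the left, so the circuit is
    extended at its end.\<close>
  proof (induction C rule: rev_induct)
    case Nil
    have cnj1: "mat_cnj (1\<^sub>m ?D) = 1\<^sub>m ?D" and adj1: "mat_adjoint (1\<^sub>m ?D) = (1\<^sub>m ?D :: complex mat)"
      by (rule eq_matI; auto)+
    have "kraus_matrix ?D [1\<^sub>m ?D] = circuit_matrix n []"
      by (simp add: kraus_matrix_single circuit_matrix_def cnj1 kron_one mult_2 power_add)
    moreover have "kraus_channel ?D [1\<^sub>m ?D] \<rho> = circuit_channel n [] \<rho>" if "\<rho> \<in> carrier_mat ?D ?D" for \<rho>
      using that by (simp add: kraus_channel_def lessThan_Suc mat_sum_singleton circuit_channel_def adj1)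
    ultimately show ?case by (intro exI[of _ "[1\<^sub>m ?D]"]) auto
  next
    case (snoc c C)
    then have c: "valid_element n c" and C: "noisy_circuit n C"
      by (auto simp: noisy_circuit_def)
    from snoc.IH[OF C] obtain Ks where Ks: "set Ks \<subseteq> carrier_mat ?D ?D"
      "\<And>\<rho>. \<rho> \<in> carrier_mat ?D ?D \<Longrightarrow> circuit_channel n C \<rho> = kraus_channel ?D Ks \<rho>"
      "circuit_matrix n C = kraus_matrix ?D Ks" by blast
    note L = element_kraus_carrier[of n c]
    have "time_ordered_prod (2 ^ (2 * n)) (\<lambda>s. embed_doubled n (support ((C @ [c]) ! s))
        (element_matrix ((C @ [c]) ! s))) (length C) = circuit_matrix n C"
      unfolding circuit_matrix_def by (rule time_ordered_prod_cong) (simp add: nth_append)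
    then have "circuit_matrix n (C @ [c]) = kraus_matrix ?D (element_kraus n c) * kraus_matrix ?D Ks"
      by (simp add: circuit_matrix_def embed_doubled_element_matrix[OF c] Ks(3)[unfolded circuit_matrix_def])
    also have "\<dots> = kraus_matrix ?D (compose_kraus (element_kraus n c) Ks)"
      by (rule kraus_matrix_compose[OF L Ks(1), symmetric])
    finally have "circuit_matrix n (C @ [c]) = kraus_matrix ?D (compose_kraus (element_kraus n c) Ks)" .
    moreover have "circuit_channel n (C @ [c]) \<rho> = kraus_channel ?D (compose_kraus (element_kraus n c) Ks) \<rho>"
      if \<rho>: "\<rho> \<in> carrier_mat ?D ?D" for \<rho>
      unfolding kraus_channel_compose[OF L Ks(1) \<rho>] Ks(2)[OF \<rho>, symmetric]
      by (simp add: circuit_channel_def element_channel_eq)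
    ultimately show ?case
      using compose_kraus_carrier[OF L Ks(1)] by blast
  qed
  then show ?thesis using that by blast
qed

text \<open>The image of the normalised maximally entangled vector under the identity tensored with
  \<open>K\<close>. The digit \<open>r div D\<close> belongs to the untouched first factor and
  therefore selects a column of \<open>K\<close>.\<close>

definition kraus_vec :: "nat \<Rightarrow> complex mat \<Rightarrow> complex vec" where
  "kraus_vec D K = vec (D\<^sup>2) (\<lambda>r. K $$ (r mod D, r div D) / complex_of_real (sqrt (real D)))"

lemma kraus_vec_carrier [simp]: "kraus_vec D K \<in> carrier_vec (D\<^sup>2)"
  by (simp add: kraus_vec_def)

lemma choi_state_cong:
  assumes "\<And>\<rho>. \<rho> \<in> carrier_mat D D \<Longrightarrow> \<E> \<rho> = \<F> \<rho>"
  shows "choi_state D \<E> = choi_state D \<F>"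
  unfolding choi_state_def id_tensor_channel_def using assms by (intro cong_mat) auto

text \<open>Each block of the maximally entangled projector is a matrix unit divided by
  \<open>D\<close>, and conjugating a matrix unit by \<open>K\<close> gives the outer product of two
  columns of \<open>K\<close>.\<close>

lemma choi_state_kraus:
  assumes Ks: "set Ks \<subseteq> carrier_mat D D"
  shows "choi_state D (kraus_channel D Ks) =
    mat_sum (D\<^sup>2) (\<lambda>k. outer (D\<^sup>2) (kraus_vec D (Ks ! k))) {..<length Ks}"
proof (rule eq_matI)
  fix r c assume "r < dim_row (mat_sum (D\<^sup>2) (\<lambda>k. outer (D\<^sup>2) (kraus_vec D (Ks ! k))) {..<length Ks})"
    "c < dim_col (mat_sum (D\<^sup>2) (\<lambda>k. outer (D\<^sup>2) (kraus_vec D (Ks ! k))) {..<length Ks})"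
  then have rc: "r < D * D" "c < D * D" by (auto simp: power2_eq_square)
  then have lt: "r div D < D" "c div D < D" "r mod D < D" "c mod D < D"
    by (simp_all add: div_less_of_less_mult mod_less_of_less_mult)
  define X where "X = mat D D (\<lambda>(a, b). max_entangled D $$ ((r div D) * D + a, (c div D) * D + b))"
  have X: "X \<in> carrier_mat D D" by (simp add: X_def)
  have X_index: "X $$ (a, b) = (if a = r div D then if b = c div D then 1 / of_nat D else 0 else 0)"
    if "a < D" "b < D" for a b
    using that lt pair_index_less[of "r div D" D a D] pair_index_less[of "c div D" D b D]
    by (auto simp: X_def max_entangled_def power2_eq_square)
  have entry: "(K * X * mat_adjoint K) $$ (r mod D, c mod D) = outer (D\<^sup>2) (kraus_vec D K) $$ (r, c)"
    if K: "K \<in> carrier_mat D D" for K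
  proof -
    have KX: "(K * X) $$ (r mod D, b) = (if b = c div D then K $$ (r mod D, r div D) / of_nat D else 0)"
      if b: "b < D" for b
    proof -
      have "(K * X) $$ (r mod D, b) = (\<Sum>a<D. K $$ (r mod D, a) * X $$ (a, b))"
        using K X lt b by (intro mult_mat_index)
      also have "\<dots> = (\<Sum>a<D. if a = r div D then K $$ (r mod D, a) * (if b = c div D then 1 / of_nat D else 0) else 0)"
        using b by (intro sum.cong refl) (simp add: X_index)
      finally show ?thesis using lt by simp
    qed
    have "(K * X * mat_adjoint K) $$ (r mod D, c mod D) =
        (\<Sum>b<D. (K * X) $$ (r mod D, b) * mat_adjoint K $$ (b, c mod D))"
      using K X lt by (intro mult_mat_index[of _ D D _ D] mult_carrier_mat[of _ D D]) auto
    also have "\<dots> = (\<Sum>b<D. if b = c div D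
        then K $$ (r mod D, r div D) / of_nat D * cnj (K $$ (c mod D, b)) else 0)"
      using K lt by (intro sum.cong refl) (auto simp: KX simp del: index_mult_mat(1))
    also have "\<dots> = K $$ (r mod D, r div D) / of_nat D * cnj (K $$ (c mod D, c div D))"
      using lt by simp
    also have "\<dots> = kraus_vec D K $ r * cnj (kraus_vec D K $ c)"
    proof -
      have "complex_of_real (sqrt (real D)) * complex_of_real (sqrt (real D)) = of_nat D"
        by (simp flip: of_real_mult)
      then show ?thesis using rc by (simp add: kraus_vec_def power2_eq_square)
    qed
    finally show ?thesis using rc by (simp add: power2_eq_square)
  qed
  have "choi_state D (kraus_channel D Ks) $$ (r, c) = kraus_channel D Ks X $$ (r mod D, c mod D)"
    using rc by (simp add: choi_state_def id_tensor_channel_def X_def power2_eq_square)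
  also have "\<dots> = (\<Sum>k<length Ks. (Ks ! k * X * mat_adjoint (Ks ! k)) $$ (r mod D, c mod D))"
    unfolding kraus_channel_def using lt by (intro mat_sum_index)
  also have "\<dots> = (\<Sum>k<length Ks. outer (D\<^sup>2) (kraus_vec D (Ks ! k)) $$ (r, c))"
    using Ks by (intro sum.cong refl entry) auto
  also have "\<dots> = mat_sum (D\<^sup>2) (\<lambda>k. outer (D\<^sup>2) (kraus_vec D (Ks ! k))) {..<length Ks} $$ (r, c)"
    using rc by (intro mat_sum_index[symmetric]) (auto simp: power2_eq_square)
  finally show "choi_state D (kraus_channel D Ks) $$ (r, c) =
      mat_sum (D\<^sup>2) (\<lambda>k. outer (D\<^sup>2) (kraus_vec D (Ks ! k))) {..<length Ks} $$ (r, c)" .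
qed (auto simp: choi_state_def id_tensor_channel_def)

text \<open>Flattening turns the Hilbert-Schmidt inner product into the ordinary one, here
  normalised by the dimension.\<close>

lemma kraus_vec_inner:
  assumes A: "A \<in> carrier_mat D D" and B: "B \<in> carrier_mat D D"
  shows "(\<Sum>i<D\<^sup>2. cnj (kraus_vec D A $ i) * kraus_vec D B $ i) = mat_trace (mat_adjoint A * B) / of_nat D"
proof -
  have s: "complex_of_real (sqrt (real D)) * complex_of_real (sqrt (real D)) = of_nat D"
    by (simp flip: of_real_mult)
  have "(\<Sum>i<D\<^sup>2. cnj (kraus_vec D A $ i) * kraus_vec D B $ i) =
      (\<Sum>a<D. \<Sum>b<D. cnj (kraus_vec D A $ (a * D + b)) * kraus_vec D B $ (a * D + b))"
    unfolding power2_eq_square by (rule sum_pair_index)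
  also have "\<dots> = (\<Sum>a<D. \<Sum>b<D. mat_adjoint A $$ (a, b) * B $$ (b, a) / of_nat D)"
  proof (intro sum.cong refl)
    fix a b assume "a \<in> {..<D}" "b \<in> {..<D}"
    then have "a < D" "b < D" by auto
    then have "kraus_vec D M $ (a * D + b) = M $$ (b, a) / complex_of_real (sqrt (real D))" for M
      using pair_index_less[of a D b D] by (simp add: kraus_vec_def power2_eq_square)
    then show "cnj (kraus_vec D A $ (a * D + b)) * kraus_vec D B $ (a * D + b) =
        mat_adjoint A $$ (a, b) * B $$ (b, a) / of_nat D"
      using A \<open>a < D\<close> \<open>b < D\<close> s by simp
  qed
  also have "\<dots> = (\<Sum>a<D. (mat_adjoint A * B) $$ (a, a) / of_nat D)"
    using A B by (intro sum.cong refl) (simp add: mult_mat_index[of _ D D _ D] sum_divide_distrib del: index_mult_mat(1))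
  also have "\<dots> = mat_trace (mat_adjoint A * B) / of_nat D"
    using A by (simp add: mat_trace_def sum_divide_distrib del: index_mult_mat(1))
  finally show ?thesis .
qed

lemma vec_norm2_kraus_vec_unitary:
  assumes "unitary_mat D U" "0 < D"
  shows "vec_norm2 (kraus_vec D U) = 1"
proof -
  have "complex_of_real ((vec_norm2 (kraus_vec D U))\<^sup>2) =
      (\<Sum>i<D\<^sup>2. cnj (kraus_vec D U $ i) * kraus_vec D U $ i)"
    unfolding vec_norm2_sq_complex by (simp add: kraus_vec_def mult.commute)
  also have "\<dots> = mat_trace (1\<^sub>m D) / of_nat D"
    using kraus_vec_inner[of U D U] unitary_matD[OF assms(1)] by simp
  also have "\<dots> = 1" using assms(2) by (simp add: mat_trace_def)
  finally have "(vec_norm2 (kraus_vec D U))\<^sup>2 = 1"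
    using of_real_eq_1_iff by blast
  then show ?thesis using vec_norm2_nonneg[of "kraus_vec D U"] by (simp add: power2_eq_1_iff)
qed

text \<open>The second copy carries the conjugates of the factors in the first, so each Kraus
  operator contributes a trace times its complex conjugate.\<close>

lemma mat_trace_kron_kraus_matrix:
  assumes U: "U \<in> carrier_mat D D" and Ks: "set Ks \<subseteq> carrier_mat D D"
  shows "mat_trace (kron (mat_adjoint U) (transpose_mat U) * kraus_matrix D Ks) =
    complex_of_real (\<Sum>k<length Ks. (cmod (mat_trace (mat_adjoint U * Ks ! k)))\<^sup>2)"
proof -
  have Uc: "mat_adjoint U \<in> carrier_mat D D" "transpose_mat U \<in> carrier_mat D D"
    using U by auto
  have K: "Ks ! k \<in> carrier_mat D D" if "k < length Ks" for k using Ks that by auto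
  have "mat_trace (kron (mat_adjoint U) (transpose_mat U) * kraus_matrix D Ks) =
      (\<Sum>k<length Ks. mat_trace (kron (mat_adjoint U) (transpose_mat U) * kron (Ks ! k) (mat_cnj (Ks ! k))))"
    unfolding kraus_matrix_def power2_eq_square using Uc K
    by (intro mat_trace_mult_mat_sum kron_carrier) auto
  also have "\<dots> = (\<Sum>k<length Ks. complex_of_real ((cmod (mat_trace (mat_adjoint U * Ks ! k)))\<^sup>2))"
  proof (intro sum.cong refl)
    fix k assume "k \<in> {..<length Ks}"
    then have Kk: "Ks ! k \<in> carrier_mat D D" using K by simp
    define z where "z = mat_trace (mat_adjoint U * Ks ! k)"
    have "mat_trace (transpose_mat U * mat_cnj (Ks ! k)) = cnj z"
      using U Kk Uc by (simp add: z_def mat_trace_def mult_mat_index[of _ D D _ D] del: index_mult_mat(1))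
    then have "mat_trace (kron (mat_adjoint U) (transpose_mat U) * kron (Ks ! k) (mat_cnj (Ks ! k))) = z * cnj z"
      unfolding kron_mult[OF Uc Kk mat_cnj_carrier[OF Kk]]
        mat_trace_kron[OF mult_carrier_mat[OF Uc(1) Kk] mult_carrier_mat[OF Uc(2) mat_cnj_carrier[OF Kk]]]
      by (simp add: z_def)
    also have "\<dots> = complex_of_real ((cmod z)\<^sup>2)"
      by (rule complex_norm_square[symmetric])
    finally show "mat_trace (kron (mat_adjoint U) (transpose_mat U) * kron (Ks ! k) (mat_cnj (Ks ! k))) =
        complex_of_real ((cmod (mat_trace (mat_adjoint U * Ks ! k)))\<^sup>2)" by (simp only: z_def)
  qed
  finally show ?thesis by simp
qed

text \<open>The Choi state of a unitary is pure, so the fidelity is the sum of the squared overlaps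
  of its vector with the Kraus vectors of the other channel.\<close>

lemma jamiolkowski_fidelity_unitary_kraus:
  assumes U: "unitary_mat D U" and D: "0 < D" and Ks: "set Ks \<subseteq> carrier_mat D D"
  shows "jamiolkowski_fidelity D (kraus_channel D [U]) (kraus_channel D Ks) =
    1 / of_nat (D\<^sup>2) * mat_trace (kron (mat_adjoint U) (transpose_mat U) * kraus_matrix D Ks)"
proof -
  define x where "x = kraus_vec D U"
  define y where "y k = kraus_vec D (Ks ! k)" for k
  define c where "c = (\<Sum>k<length Ks. (cmod (\<Sum>i<D\<^sup>2. cnj (x $ i) * y k $ i))\<^sup>2)"
  note Uc = unitary_matD(1)[OF U]
  have x: "x \<in> carrier_vec (D\<^sup>2)" "vec_norm2 x = 1" and y: "y k \<in> carrier_vec (D\<^sup>2)" for k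
    using vec_norm2_kraus_vec_unitary[OF U D] by (simp_all add: x_def y_def)
  have "choi_state D (kraus_channel D [U]) = outer (D\<^sup>2) x"
    using choi_state_kraus[of "[U]" D] Uc by (simp add: lessThan_Suc mat_sum_singleton x_def)
  moreover have "outer (D\<^sup>2) x * mat_sum (D\<^sup>2) (\<lambda>k. outer (D\<^sup>2) (y k)) {..<length Ks} * outer (D\<^sup>2) x =
      complex_of_real c \<cdot>\<^sub>m outer (D\<^sup>2) x"
  proof -
    have "outer (D\<^sup>2) x * mat_sum (D\<^sup>2) (\<lambda>k. outer (D\<^sup>2) (y k)) {..<length Ks} * outer (D\<^sup>2) x =
        mat_sum (D\<^sup>2) (\<lambda>k. outer (D\<^sup>2) x * outer (D\<^sup>2) (y k)) {..<length Ks} * outer (D\<^sup>2) x"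
      by (subst mat_sum_mult_left) simp_all
    also have "\<dots> = mat_sum (D\<^sup>2) (\<lambda>k. outer (D\<^sup>2) x * outer (D\<^sup>2) (y k) * outer (D\<^sup>2) x) {..<length Ks}"
      by (intro mat_sum_mult_right mult_carrier_mat[of _ "D\<^sup>2" "D\<^sup>2"] outer_carrier)
    also have "\<dots> = mat_sum (D\<^sup>2) (\<lambda>k. complex_of_real ((cmod (\<Sum>i<D\<^sup>2. cnj (x $ i) * y k $ i))\<^sup>2) \<cdot>\<^sub>m
        outer (D\<^sup>2) x) {..<length Ks}"
      by (intro mat_sum_cong refl outer_mult_outer_mult_outer x y)
    also have "\<dots> = complex_of_real c \<cdot>\<^sub>m outer (D\<^sup>2) x"
      by (rule eq_matI) (simp_all add: c_def sum_distrib_right)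
    finally show ?thesis .
  qed
  then have "state_fidelity (outer (D\<^sup>2) x) (mat_sum (D\<^sup>2) (\<lambda>k. outer (D\<^sup>2) (y k)) {..<length Ks}) =
      complex_of_real c"
    by (intro state_fidelity_outer x) (simp_all add: c_def sum_nonneg)
  ultimately have "jamiolkowski_fidelity D (kraus_channel D [U]) (kraus_channel D Ks) = complex_of_real c"
    by (simp add: jamiolkowski_fidelity_def choi_state_kraus[OF Ks] y_def)
  also have "c = 1 / real (D\<^sup>2) * (\<Sum>k<length Ks. (cmod (mat_trace (mat_adjoint U * Ks ! k)))\<^sup>2)"
    unfolding c_def sum_distrib_left
  proof (intro sum.cong refl)
    fix k assume "k \<in> {..<length Ks}"
    then have "Ks ! k \<in> carrier_mat D D" using Ks by auto
    then show "(cmod (\<Sum>i<D\<^sup>2. cnj (x $ i) * y k $ i))\<^sup>2 =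
        1 / real (D\<^sup>2) * (cmod (mat_trace (mat_adjoint U * Ks ! k)))\<^sup>2"
      unfolding x_def y_def by (simp add: kraus_vec_inner[OF Uc] norm_divide power_divide)
  qed
  also have "complex_of_real \<dots> =
      1 / of_nat (D\<^sup>2) * mat_trace (kron (mat_adjoint U) (transpose_mat U) * kraus_matrix D Ks)"
    unfolding mat_trace_kron_kraus_matrix[OF Uc Ks] by simp
  finally show ?thesis .
qed

lemma jamiolkowski_fidelity_circuit:
  assumes U: "unitary_mat (2 ^ n) U" and C: "noisy_circuit n C"
  shows "jamiolkowski_fidelity (2 ^ n) (unitary_channel n U) (circuit_channel n C) =
    1 / 2 ^ (2 * n) * mat_trace (kron (mat_adjoint U) (transpose_mat U) * circuit_matrix n C)"
proof -
  obtain Ks where Ks: "set Ks \<subseteq> carrier_mat (2 ^ n) (2 ^ n)"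
    "\<And>\<rho>. \<rho> \<in> carrier_mat (2 ^ n) (2 ^ n) \<Longrightarrow> circuit_channel n C \<rho> = kraus_channel (2 ^ n) Ks \<rho>"
    "circuit_matrix n C = kraus_matrix (2 ^ n) Ks"
    using circuit_kraus[OF C] by blast
  have "choi_state (2 ^ n) (circuit_channel n C) = choi_state (2 ^ n) (kraus_channel (2 ^ n) Ks)"
    using Ks(2) by (rule choi_state_cong)
  then have "jamiolkowski_fidelity (2 ^ n) (unitary_channel n U) (circuit_channel n C) =
      jamiolkowski_fidelity (2 ^ n) (kraus_channel (2 ^ n) [U]) (kraus_channel (2 ^ n) Ks)"
    by (simp add: jamiolkowski_fidelity_def unitary_channel_def)
  also have "\<dots> = 1 / of_nat ((2 ^ n)\<^sup>2) *
      mat_trace (kron (mat_adjoint U) (transpose_mat U) * kraus_matrix (2 ^ n) Ks)"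
    by (rule jamiolkowski_fidelity_unitary_kraus[OF U _ Ks(1)]) simp
  finally show ?thesis by (simp add: Ks(3) power_mult[symmetric] mult.commute)
qed

lemma unitary_mat_circuit_unitary:
  "ideal_circuit n Us \<Longrightarrow> unitary_mat (2 ^ n) (circuit_unitary n Us)"
  unfolding circuit_unitary_def ideal_circuit_def by (intro unitary_mat_time_ordered_prod) auto

text \<open>The constant \<open>K\<close> is chosen before the circuit and the level, so the O-bound
  is uniform in all parameters. The equation for \<open>alg_output\<close> ties the counted
  contractions to the computation of F(l).\<close>

theorem theorem2:
  shows
    "(\<forall>(n::nat) Us C \<sigma> (p::real) (l::nat) N1 N2 N.
        ideal_circuit n Us \<and> noisy_circuit n C \<and> noise_svds C \<sigma> \<and>
        (\<forall>s\<in>noises C. noise_rate (C ! s) \<le> p) \<and>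
        N1 = num_noises 1 C \<and> N2 = num_noises 2 C \<and> N = N1 + N2 \<and> l \<le> N \<longrightarrow>
        cmod (jamiolkowski_fidelity (2 ^ n) (unitary_channel n (circuit_unitary n Us)) (circuit_channel n C)
              - approx_fidelity n (circuit_unitary n Us) C \<sigma> l)
          \<le> (\<Sum>u = l + 1..N. real (N choose u) * (16 * p) ^ u * (1 + 16 * p) ^ (N - u))) \<and>
     (\<exists>K::real. \<forall>(n::nat) Us C \<sigma> (l::nat) N1 N2 N.
        ideal_circuit n Us \<and> noisy_circuit n C \<and> noise_svds C \<sigma> \<and>
        N1 = num_noises 1 C \<and> N2 = num_noises 2 C \<and> N = N1 + N2 \<and> l \<le> N \<longrightarrow>
        alg_output n (circuit_unitary n Us) C \<sigma> l = approx_fidelity n (circuit_unitary n Us) C \<sigma> l \<and>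
        real (num_contractions C l) \<le> K * (15 ^ l * real N ^ l))"
proof (intro conjI exI[of _ "2 * exp 1"] allI impI; elim conjE)
  fix n Us C \<sigma> l N1 N2 N and p :: real
  assume U: "ideal_circuit n Us" and C: "noisy_circuit n C" and \<sigma>: "noise_svds C \<sigma>"
    and p: "\<forall>s\<in>noises C. noise_rate (C ! s) \<le> p"
    and "N1 = num_noises 1 C" "N2 = num_noises 2 C" "N = N1 + N2" and l: "l \<le> N"
  then have N: "N = card (noises C)" by (simp add: card_noises)
  note U' = unitary_mat_circuit_unitary[OF U]
  show "cmod (jamiolkowski_fidelity (2 ^ n) (unitary_channel n (circuit_unitary n Us)) (circuit_channel n C)
      - approx_fidelity n (circuit_unitary n Us) C \<sigma> l)
    \<le> (\<Sum>u = l + 1..N. real (N choose u) * (16 * p) ^ u * (1 + 16 * p) ^ (N - u))"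
    unfolding jamiolkowski_fidelity_circuit[OF U' C] N
    using p l N by (intro approx_fidelity_error[OF C \<sigma> U']) auto
next
  fix n Us C \<sigma> l N1 N2 N
  assume U: "ideal_circuit n Us" and C: "noisy_circuit n C" and "noise_svds C \<sigma>"
    and "N1 = num_noises 1 C" "N2 = num_noises 2 C" "N = N1 + N2" and l: "l \<le> N"
  then have N: "N = card (noises C)" by (simp add: card_noises)
  show "alg_output n (circuit_unitary n Us) C \<sigma> l = approx_fidelity n (circuit_unitary n Us) C \<sigma> l"
    by (rule alg_output_eq_approx_fidelity[OF C unitary_mat_circuit_unitary[OF U]])
  show "real (num_contractions C l) \<le> 2 * exp 1 * (15 ^ l * real N ^ l)"
    unfolding N using l N by (intro num_contractions_le[OF C]) simp
qed

end
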